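(* Let $F=\{f_1,\ldots,f_r\}\subset K\{\mathbb{Y}\}$ be a system of difference polynomials which is quasi-regular at the $\sigma$-prime ideal $\mathfrak{p}$ and satisfies the rank hypothesis stated in the context, and let $e\ge1$ be the maximal order occurring in $F$. Then the Hilbert-Levin regularity of $\mathfrak{p}$ is bounded by $e-1$ (that is, it is at most $e-1$).
   Context: Difference algebra. A $\sigma$-ring is a commutative ring $R$ with a ring endomorphism $\sigma:R\to R$; a $\sigma$-field is a $\sigma$-ring that is a field. A $\sigma$-ideal $I$ of $R$ is an ideal with $\sigma(I)\subseteq I$; it is reflexive if $\sigma(a)\in I$ implies $a\in I$, and $\sigma$-prime if it is reflexive and a prime ideal. $[F]$ denotes the $\sigma$-ideal generated by a set $F$. $\mathbb{N}$ contains $0$. Setting. $K$ is a $\sigma$-field of characteristic $0$; $\mathbb{Y}=\{y_1,\ldots,y_n\}$ are $\sigma$-indeterminates, and $K\{\mathbb{Y}\}$ is the $\sigma$-polynomial ring, i.e. the polynomial ring over $K$ in the algebraically independent variables $y_j^{(l)}:=\sigma^l(y_j)$, $1\le j\le n$, $l\in\mathbb{N}$, with its natural $\sigma$. For an element $a$ put $a^{(l)}=\sigma^l(a)$ and $a^{[l]}=\{a,a^{(1)},\ldots,a^{(l)}\}$; for a set $S$ put $S^{(l)}=\{a^{(l)}:a\in S\}$, $S^{[l]}=\bigcup_{a\in S}a^{[l]}$. $F=\{f_1,\ldots,f_r\}\subset K\{\mathbb{Y}\}$, and $\mathfrak{p}\subset K\{\mathbb{Y}\}$ is a $\sigma$-prime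 ideal minimal over $[F]$ (minimal among $\sigma$-prime ideals containing $[F]$). $\epsilon_{ij}=\operatorname{ord}_{y_j}(f_i)$ is the largest $l$ such that $y_j^{(l)}$ occurs in $f_i$ (and $0$ if $y_j$ does not appear), $e=\max\epsilon_{ij}$, and it is assumed that $e\ge1$. $\kappa$ is the residue class field of $\mathfrak{p}$, i.e. the fraction field of $K\{\mathbb{Y}\}/\mathfrak{p}$. Rings and ideals. For $k\in\mathbb{N}$: $A_k=K[\mathbb{Y}^{[k]}]$; $B_k$ is the localization of $A_k$ at the prime ideal $A_k\cap\mathfrak{p}$; $\mathfrak{p}_k=A_{k-1+e}\cap\mathfrak{p}$; $\Delta_k$ is the ideal generated by $f_1^{[k-1]},\ldots,f_r^{[k-1]}$ in $B_{k-1+e}$, with $\Delta_0=(0)$. $\Delta$ denotes the $\sigma$-ideal generated by $F$ in $K\{\mathbb{Y}\}_{\mathfrak{p}}$. Quasi-regularity. $F$ is quasi-regular at $\mathfrak{p}$ if for every positive integer $k$ the Jacobian matrix of the polynomials $f_1^{[k-1]},\ldots,f_r^{[k-1]}$ with respect to the variables $\mathbb{Y}^{[k-1+e]}$ has full row rank over the domain $A_{k-1+e}/\mathfrak{p}_k$, and $\Delta$ is reflexive. (In this case each $\Delta_k$ is a prime ideal of $B_{k-1+e}$.) Rank hypothesis (standing). For $k\in\mathbb{N}$ and $i\ge e-1$, $J_{k,i}$ is the $kr\times kn$ matrix with $k\times k$ blocks of size $r\times n$ whose $(p,q)$ block ($1\le p,q\le k$) is the Jacobian matrix $\partial F^{(i-e+p)}/\partial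 \mathbb{Y}^{(i+q)}=\big(\partial f_a^{(i-e+p)}/\partial y_b^{(i+q)}\big)_{1\le a\le r,\,1\le b\le n}$ (zero for $q>p$). Let $\kappa(\Delta_k)$ be the residue class field of $\Delta_k$ in $B_{k-1+e}$ and $\kappa(\mathfrak{p}_k)$ the residue class field of $\mathfrak{p}_k$ in $A_{k-1+e}$. It is assumed that for all $k\in\mathbb{N}$, $i\ge e-1$ the rank of $J_{k,i}$ over $\kappa(\Delta_{i-e+1+k+s})$ does not depend on $s\in\mathbb{N}$; that is, the rank of $J_{k,i}$ over $\kappa(\Delta_{i-e+1+k})$, over $\kappa(\mathfrak{p}_{i-e+1+k})$ and over $\kappa$ is always the same. Hilbert-Levin regularity. For a $\sigma$-prime ideal $\mathfrak{p}$ of $K\{\mathbb{Y}\}$ there are non-negative integers $\sigma\text{-}\dim(\mathfrak{p})$ (the difference transcendence degree of $\kappa$ over $K$) and $\operatorname{ord}(\mathfrak{p})$ such that, with $\varphi(i)=\sigma\text{-}\dim(\mathfrak{p})(i+1)+\operatorname{ord}(\mathfrak{p})$ (the dimension polynomial of $\mathfrak{p}$), $\varphi(i)=\operatorname{trdeg}_K\operatorname{Frac}(A_i/(A_i\cap\mathfrak{p}))$ for all sufficiently large $i$. The Hilbert-Levin regularity of $\mathfrak{p}$ is the minimum of the indices $i_0$ such that $\varphi(i)=\operatorname{trdeg}_K\operatorname{Frac}(A_i/(A_i\cap\mathfrak{p}))$ for all $i\ge i_0$. *)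

theory Defs
  imports
    "HOL-Algebra.Algebraic_Closure_Type"
    "HOL-Library.Poly_Mapping"
    "HOL-Library.Extended_Nat"
begin

section \<open>Localization, fraction fields and residue class fields\<close>

text \<open>Elements of the localization \<open>S\<inverse>R\<close> are classes of pairs \<open>(a, s)\<close>, standing for \<open>a/s\<close>.\<close>

definition loc_rel :: "('a, 'b) ring_scheme \<Rightarrow> 'a set \<Rightarrow> (('a \<times> 'a) \<times> ('a \<times> 'a)) set" where
  "loc_rel R S = {((a, s), (b, t)). a \<in> carrier R \<and> s \<in> S \<and> b \<in> carrier R \<and> t \<in> S \<and>
     (\<exists>u\<in>S. u \<otimes>\<^bsub>R\<^esub> (a \<otimes>\<^bsub>R\<^esub> t \<ominus>\<^bsub>R\<^esub> b \<otimes>\<^bsub>R\<^esub> s) = \<zero>\<^bsub>R\<^esub>)}"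

definition loc_frac :: "('a, 'b) ring_scheme \<Rightarrow> 'a set \<Rightarrow> 'a \<Rightarrow> 'a \<Rightarrow> ('a \<times> 'a) set" where
  "loc_frac R S a s = loc_rel R S `` {(a, s)}"

definition localization :: "('a, 'b) ring_scheme \<Rightarrow> 'a set \<Rightarrow> ('a \<times> 'a) set ring" where
  "localization R S =
    \<lparr>carrier = (carrier R \<times> S) // loc_rel R S,
     monoid.mult = (\<lambda>U V. \<Union>(a, s)\<in>U. \<Union>(b, t)\<in>V. loc_frac R S (a \<otimes>\<^bsub>R\<^esub> b) (s \<otimes>\<^bsub>R\<^esub> t)),
     monoid.one = loc_frac R S \<one>\<^bsub>R\<^esub> \<one>\<^bsub>R\<^esub>,
     ring.zero = loc_frac R S \<zero>\<^bsub>R\<^esub> \<one>\<^bsub>R\<^esub>,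
     ring.add = (\<lambda>U V. \<Union>(a, s)\<in>U. \<Union>(b, t)\<in>V.
       loc_frac R S (a \<otimes>\<^bsub>R\<^esub> t \<oplus>\<^bsub>R\<^esub> b \<otimes>\<^bsub>R\<^esub> s) (s \<otimes>\<^bsub>R\<^esub> t))\<rparr>"

definition loc_map :: "('a, 'b) ring_scheme \<Rightarrow> 'a set \<Rightarrow> 'a \<Rightarrow> ('a \<times> 'a) set" where
  "loc_map R S a = loc_frac R S a \<one>\<^bsub>R\<^esub>"

text \<open>The endomorphism \<open>a/s \<mapsto> \<sigma>(a)/\<sigma>(s)\<close>, for \<open>\<sigma>\<close> with \<open>\<sigma>(S) \<subseteq> S\<close>.\<close>

definition loc_endo :: "('a, 'b) ring_scheme \<Rightarrow> 'a set \<Rightarrow> ('a \<Rightarrow> 'a) \<Rightarrow> ('a \<times> 'a) set \<Rightarrow> ('a \<times> 'a) set" where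
  "loc_endo R S \<sigma> U = (\<Union>(a, s)\<in>U. loc_frac R S (\<sigma> a) (\<sigma> s))"

definition quot_endo :: "('a, 'b) ring_scheme \<Rightarrow> 'a set \<Rightarrow> ('a \<Rightarrow> 'a) \<Rightarrow> 'a set \<Rightarrow> 'a set" where
  "quot_endo R I \<sigma> U = (\<Union>a\<in>U. I +>\<^bsub>R\<^esub> \<sigma> a)"

definition nonzeros :: "('a, 'b) ring_scheme \<Rightarrow> 'a set" where
  "nonzeros R = carrier R - {\<zero>\<^bsub>R\<^esub>}"

definition residue_field :: "('a, 'b) ring_scheme \<Rightarrow> 'a set \<Rightarrow> ('a set \<times> 'a set) set ring" where
  "residue_field R I = localization (R Quot I) (nonzeros (R Quot I))"

definition residue_map :: "('a, 'b) ring_scheme \<Rightarrow> 'a set \<Rightarrow> 'a \<Rightarrow> ('a set \<times> 'a set) set" where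
  "residue_map R I a = loc_map (R Quot I) (nonzeros (R Quot I)) (I +>\<^bsub>R\<^esub> a)"

definition residue_endo ::
  "('a, 'b) ring_scheme \<Rightarrow> 'a set \<Rightarrow> ('a \<Rightarrow> 'a) \<Rightarrow> ('a set \<times> 'a set) set \<Rightarrow> ('a set \<times> 'a set) set" where
  "residue_endo R I \<sigma> = loc_endo (R Quot I) (nonzeros (R Quot I)) (quot_endo R I \<sigma>)"

section \<open>Rank of a matrix\<close>

text \<open>A matrix over \<open>R\<close> with rows indexed by \<open>I\<close> and columns indexed by \<open>J\<close> is a function \<open>M\<close>
  of which only the entries \<open>M i j\<close> with \<open>i \<in> I\<close>, \<open>j \<in> J\<close> matter. Over a domain \<open>R\<close> this rank
  is the rank over the fraction field of \<open>R\<close>.\<close>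

definition rows_independent ::
  "('a, 'b) ring_scheme \<Rightarrow> 'i set \<Rightarrow> 'j set \<Rightarrow> ('i \<Rightarrow> 'j \<Rightarrow> 'a) \<Rightarrow> bool" where
  "rows_independent R S J M \<longleftrightarrow>
    (\<forall>c \<in> S \<rightarrow> carrier R. (\<forall>j\<in>J. (\<Oplus>\<^bsub>R\<^esub>i\<in>S. c i \<otimes>\<^bsub>R\<^esub> M i j) = \<zero>\<^bsub>R\<^esub>) \<longrightarrow> (\<forall>i\<in>S. c i = \<zero>\<^bsub>R\<^esub>))"

definition matrix_rank ::
  "('a, 'b) ring_scheme \<Rightarrow> 'i set \<Rightarrow> 'j set \<Rightarrow> ('i \<Rightarrow> 'j \<Rightarrow> 'a) \<Rightarrow> nat" where
  "matrix_rank R I J M = Max {card S | S. S \<subseteq> I \<and> rows_independent R S J M}"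

section \<open>Polynomials, algebraic independence, transcendence degree\<close>

type_synonym ('v, 'k) mpol = "('v \<Rightarrow>\<^sub>0 nat) \<Rightarrow>\<^sub>0 'k"

definition mpol_vars :: "('v, 'k::zero) mpol \<Rightarrow> 'v set" where
  "mpol_vars p = (\<Union>m \<in> Poly_Mapping.keys p. Poly_Mapping.keys m)"

definition mpol_const :: "'k \<Rightarrow> ('v, 'k::zero) mpol" where
  "mpol_const c = Poly_Mapping.single 0 c"

definition mpol_deriv :: "'v \<Rightarrow> ('v, 'k::comm_ring_1) mpol \<Rightarrow> ('v, 'k) mpol" where
  "mpol_deriv v p = (\<Sum>m \<in> Poly_Mapping.keys p.
     Poly_Mapping.single (m - Poly_Mapping.single v 1)
       (of_nat (Poly_Mapping.lookup m v) * Poly_Mapping.lookup p m))"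

text \<open>Here \<open>L\<close> is a field extension of \<open>'k\<close> with structure map \<open>\<iota>\<close>.\<close>

definition mpol_eval ::
  "('a, 'b) ring_scheme \<Rightarrow> ('k::zero \<Rightarrow> 'a) \<Rightarrow> ('v \<Rightarrow> 'a) \<Rightarrow> ('v, 'k) mpol \<Rightarrow> 'a" where
  "mpol_eval L \<iota> x p = (\<Oplus>\<^bsub>L\<^esub>m \<in> Poly_Mapping.keys p. \<iota> (Poly_Mapping.lookup p m) \<otimes>\<^bsub>L\<^esub>
     (\<Otimes>\<^bsub>L\<^esub>v \<in> Poly_Mapping.keys m. x v [^]\<^bsub>L\<^esub> Poly_Mapping.lookup m v))"

definition alg_independent ::
  "('a, 'b) ring_scheme \<Rightarrow> ('k::zero \<Rightarrow> 'a) \<Rightarrow> 'v set \<Rightarrow> ('v \<Rightarrow> 'a) \<Rightarrow> bool" where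
  "alg_independent L \<iota> V x \<longleftrightarrow>
    (\<forall>p. mpol_vars p \<subseteq> V \<longrightarrow> mpol_eval L \<iota> x p = \<zero>\<^bsub>L\<^esub> \<longrightarrow> p = 0)"

definition trdeg :: "('a, 'b) ring_scheme \<Rightarrow> ('k::zero \<Rightarrow> 'a) \<Rightarrow> enat" where
  "trdeg L \<iota> = (SUP S \<in> {S. S \<subseteq> carrier L \<and> finite S \<and> alg_independent L \<iota> S (\<lambda>s. s)}. enat (card S))"

definition diff_independent ::
  "('a, 'b) ring_scheme \<Rightarrow> ('a \<Rightarrow> 'a) \<Rightarrow> ('k::zero \<Rightarrow> 'a) \<Rightarrow> 'a set \<Rightarrow> bool" where
  "diff_independent L \<sigma> \<iota> S \<longleftrightarrow> alg_independent L \<iota> (S \<times> UNIV) (\<lambda>(s, l::nat). (\<sigma> ^^ l) s)"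

definition diff_trdeg :: "('a, 'b) ring_scheme \<Rightarrow> ('a \<Rightarrow> 'a) \<Rightarrow> ('k::zero \<Rightarrow> 'a) \<Rightarrow> enat" where
  "diff_trdeg L \<sigma> \<iota> = (SUP S \<in> {S. S \<subseteq> carrier L \<and> finite S \<and> diff_independent L \<sigma> \<iota> S}. enat (card S))"

section \<open>Difference ideals\<close>

definition diff_ideal :: "('a, 'b) ring_scheme \<Rightarrow> ('a \<Rightarrow> 'a) \<Rightarrow> 'a set \<Rightarrow> bool" where
  "diff_ideal R \<sigma> I \<longleftrightarrow> ideal I R \<and> \<sigma> ` I \<subseteq> I"

definition diff_reflexive :: "('a, 'b) ring_scheme \<Rightarrow> ('a \<Rightarrow> 'a) \<Rightarrow> 'a set \<Rightarrow> bool" where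
  "diff_reflexive R \<sigma> I \<longleftrightarrow> (\<forall>a\<in>carrier R. \<sigma> a \<in> I \<longrightarrow> a \<in> I)"

definition diff_prime :: "('a, 'b) ring_scheme \<Rightarrow> ('a \<Rightarrow> 'a) \<Rightarrow> 'a set \<Rightarrow> bool" where
  "diff_prime R \<sigma> I \<longleftrightarrow> diff_ideal R \<sigma> I \<and> diff_reflexive R \<sigma> I \<and> primeideal I R"

definition diff_ideal_gen :: "('a, 'b) ring_scheme \<Rightarrow> ('a \<Rightarrow> 'a) \<Rightarrow> 'a set \<Rightarrow> 'a set" where
  "diff_ideal_gen R \<sigma> F = \<Inter>{I. diff_ideal R \<sigma> I \<and> F \<subseteq> I}"

definition minimal_diff_prime_over :: "('a, 'b) ring_scheme \<Rightarrow> ('a \<Rightarrow> 'a) \<Rightarrow> 'a set \<Rightarrow> 'a set \<Rightarrow> bool" where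
  "minimal_diff_prime_over R \<sigma> I P \<longleftrightarrow> diff_prime R \<sigma> P \<and> I \<subseteq> P \<and>
    (\<forall>Q. diff_prime R \<sigma> Q \<and> I \<subseteq> Q \<and> Q \<subseteq> P \<longrightarrow> Q = P)"

section \<open>Difference polynomials\<close>

text \<open>The variable \<open>(j, l)\<close> is \<open>y\<^sub>j\<^sup>(\<^sup>l\<^sup>)\<close>; the finite type \<open>'n\<close> indexes the \<open>\<sigma>\<close>-indeterminates.\<close>

type_synonym ('n, 'k) dpol = "('n \<times> nat, 'k) mpol"

definition dpol_sigma :: "('k \<Rightarrow> 'k) \<Rightarrow> ('n, 'k::comm_ring_1) dpol \<Rightarrow> ('n, 'k) dpol" where
  "dpol_sigma \<sigma> p = (\<Sum>m \<in> Poly_Mapping.keys p.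
     Poly_Mapping.single
       (\<Sum>v \<in> Poly_Mapping.keys m. Poly_Mapping.single (fst v, Suc (snd v)) (Poly_Mapping.lookup m v))
       (\<sigma> (Poly_Mapping.lookup p m)))"

abbreviation dpol_ring :: "('n, 'k::comm_ring_1) dpol ring" where
  "dpol_ring \<equiv> ring_of_type_algebra"

definition dpol_ord :: "'n \<Rightarrow> ('n, 'k::zero) dpol \<Rightarrow> nat" where
  "dpol_ord j p = Max (insert 0 {l. (j, l) \<in> mpol_vars p})"

definition max_ord :: "('r::finite \<Rightarrow> ('n::finite, 'k::zero) dpol) \<Rightarrow> nat" where
  "max_ord f = Max {dpol_ord j (f i) | i j. True}"

definition A_set :: "nat \<Rightarrow> ('n, 'k::zero) dpol set" where
  "A_set k = {p. \<forall>(j, l) \<in> mpol_vars p. l \<le> k}"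

definition A_ring :: "nat \<Rightarrow> ('n, 'k::comm_ring_1) dpol ring" where
  "A_ring k = dpol_ring\<lparr>carrier := A_set k\<rparr>"

definition B_ring :: "('n, 'k::comm_ring_1) dpol set \<Rightarrow> nat \<Rightarrow> (('n, 'k) dpol \<times> ('n, 'k) dpol) set ring" where
  "B_ring P k = localization (A_ring k) (A_set k - P)"

definition B_map :: "('n, 'k::comm_ring_1) dpol set \<Rightarrow> nat \<Rightarrow> ('n, 'k) dpol \<Rightarrow> (('n, 'k) dpol \<times> ('n, 'k) dpol) set" where
  "B_map P k = loc_map (A_ring k) (A_set k - P)"

text \<open>In \<open>p_ideal\<close> and \<open>Delta_ideal\<close> the index \<open>k - 1 + e\<close> is written \<open>k + e - 1\<close>, which is correct on
  the natural numbers also for \<open>k = 0\<close> as \<open>e \<ge> 1\<close>. For \<open>k = 0\<close> the ideal \<open>Delta_ideal\<close> is the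
  zero ideal, generated by the empty set.\<close>

definition p_ideal :: "('r::finite \<Rightarrow> ('n::finite, 'k::comm_ring_1) dpol) \<Rightarrow> ('n, 'k) dpol set \<Rightarrow> nat \<Rightarrow> ('n, 'k) dpol set" where
  "p_ideal f P k = A_set (k + max_ord f - 1) \<inter> P"

definition Delta_ideal ::
  "('k \<Rightarrow> 'k) \<Rightarrow> ('r::finite \<Rightarrow> ('n::finite, 'k::comm_ring_1) dpol) \<Rightarrow> ('n, 'k) dpol set \<Rightarrow> nat \<Rightarrow>
    (('n, 'k) dpol \<times> ('n, 'k) dpol) set set" where
  "Delta_ideal \<sigma> f P k =
    Idl\<^bsub>B_ring P (k + max_ord f - 1)\<^esub> {B_map P (k + max_ord f - 1) ((dpol_sigma \<sigma> ^^ l) (f a)) | a l. l < k}"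

text \<open>The \<open>\<sigma>\<close>-ideal generated by the \<open>f\<^sub>a\<close> in the localization of the whole \<open>\<sigma>\<close>-polynomial ring at \<open>P\<close>.\<close>

definition Delta_infinity ::
  "('k \<Rightarrow> 'k) \<Rightarrow> ('r \<Rightarrow> ('n, 'k::comm_ring_1) dpol) \<Rightarrow> ('n, 'k) dpol set \<Rightarrow>
    (('n, 'k) dpol \<times> ('n, 'k) dpol) set set" where
  "Delta_infinity \<sigma> f P =
    diff_ideal_gen (localization dpol_ring (- P)) (loc_endo dpol_ring (- P) (dpol_sigma \<sigma>))
      (range (\<lambda>a. loc_map dpol_ring (- P) (f a)))"

section \<open>Quasi-regularity and the rank hypothesis\<close>

text \<open>Rows \<open>(a, l)\<close> with \<open>l \<le> k - 1\<close> stand for \<open>f\<^sub>a\<^sup>(\<^sup>l\<^sup>)\<close>, columns for the variables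
  of order at most \<open>k - 1 + e\<close>.\<close>

definition quasi_regular ::
  "('k \<Rightarrow> 'k) \<Rightarrow> ('r::finite \<Rightarrow> ('n::finite, 'k::comm_ring_1) dpol) \<Rightarrow> ('n, 'k) dpol set \<Rightarrow> bool" where
  "quasi_regular \<sigma> f P \<longleftrightarrow>
    (\<forall>k\<ge>1. matrix_rank (A_ring (k + max_ord f - 1) Quot p_ideal f P k)
        (UNIV \<times> {..k - 1}) (UNIV \<times> {..k + max_ord f - 1})
        (\<lambda>(a, l) v. p_ideal f P k +>\<^bsub>A_ring (k + max_ord f - 1)\<^esub>
                      mpol_deriv v ((dpol_sigma \<sigma> ^^ l) (f a)))
      = card (UNIV :: 'r set) * k) \<and>
    diff_reflexive (localization dpol_ring (- P)) (loc_endo dpol_ring (- P) (dpol_sigma \<sigma>))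
      (Delta_infinity \<sigma> f P)"

text \<open>Row \<open>(p, a)\<close> and column \<open>(q, b)\<close> of \<open>J\<^sub>k\<^sub>,\<^sub>i\<close> are row \<open>a\<close> and column \<open>b\<close> of its block \<open>(p, q)\<close>.
  The order \<open>i - e + p\<close> is written \<open>i + p - e\<close>, with \<open>i + p \<ge> e\<close> since \<open>i \<ge> e - 1\<close> and \<open>p \<ge> 1\<close>.
  Blocks with \<open>q > p\<close> vanish because \<open>f\<^sub>a\<^sup>(\<^sup>i\<^sup>-\<^sup>e\<^sup>+\<^sup>p\<^sup>)\<close> has order at most \<open>i + p\<close>.\<close>

definition J_matrix ::
  "('k \<Rightarrow> 'k) \<Rightarrow> ('r::finite \<Rightarrow> ('n::finite, 'k::comm_ring_1) dpol) \<Rightarrow> nat \<Rightarrow>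
    nat \<times> 'r \<Rightarrow> nat \<times> 'n \<Rightarrow> ('n, 'k) dpol" where
  "J_matrix \<sigma> f i = (\<lambda>(p, a) (q, b). mpol_deriv (b, i + q) ((dpol_sigma \<sigma> ^^ (i + p - max_ord f)) (f a)))"

text \<open>Rank of \<open>J\<^sub>k\<^sub>,\<^sub>i\<close> over a field \<open>L\<close> into which its entries are mapped by \<open>h\<close>.\<close>

definition J_rank ::
  "('k \<Rightarrow> 'k) \<Rightarrow> ('r::finite \<Rightarrow> ('n::finite, 'k::comm_ring_1) dpol) \<Rightarrow> nat \<Rightarrow> nat \<Rightarrow>
    ('a, 'b) ring_scheme \<Rightarrow> (('n, 'k) dpol \<Rightarrow> 'a) \<Rightarrow> nat" where
  "J_rank \<sigma> f k i L h =
    matrix_rank L ({1..k} \<times> UNIV) ({1..k} \<times> UNIV) (\<lambda>x y. h (J_matrix \<sigma> f i x y))"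

definition J_rank_Delta ::
  "('k \<Rightarrow> 'k) \<Rightarrow> ('r::finite \<Rightarrow> ('n::finite, 'k::comm_ring_1) dpol) \<Rightarrow> ('n, 'k) dpol set \<Rightarrow>
    nat \<Rightarrow> nat \<Rightarrow> nat \<Rightarrow> nat" where
  "J_rank_Delta \<sigma> f P k i m =
    J_rank \<sigma> f k i (residue_field (B_ring P (m + max_ord f - 1)) (Delta_ideal \<sigma> f P m))
      (residue_map (B_ring P (m + max_ord f - 1)) (Delta_ideal \<sigma> f P m) \<circ> B_map P (m + max_ord f - 1))"

definition J_rank_p ::
  "('k \<Rightarrow> 'k) \<Rightarrow> ('r::finite \<Rightarrow> ('n::finite, 'k::comm_ring_1) dpol) \<Rightarrow> ('n, 'k) dpol set \<Rightarrow>
    nat \<Rightarrow> nat \<Rightarrow> nat \<Rightarrow> nat" where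
  "J_rank_p \<sigma> f P k i m =
    J_rank \<sigma> f k i (residue_field (A_ring (m + max_ord f - 1)) (p_ideal f P m))
      (residue_map (A_ring (m + max_ord f - 1)) (p_ideal f P m))"

definition J_rank_kappa ::
  "('k \<Rightarrow> 'k) \<Rightarrow> ('r::finite \<Rightarrow> ('n::finite, 'k::comm_ring_1) dpol) \<Rightarrow> ('n, 'k) dpol set \<Rightarrow>
    nat \<Rightarrow> nat \<Rightarrow> nat" where
  "J_rank_kappa \<sigma> f P k i = J_rank \<sigma> f k i (residue_field dpol_ring P) (residue_map dpol_ring P)"

definition rank_hypothesis ::
  "('k \<Rightarrow> 'k) \<Rightarrow> ('r::finite \<Rightarrow> ('n::finite, 'k::comm_ring_1) dpol) \<Rightarrow> ('n, 'k) dpol set \<Rightarrow> bool" where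
  "rank_hypothesis \<sigma> f P \<longleftrightarrow>
    (\<forall>k i. i + 1 \<ge> max_ord f \<longrightarrow>
      (let m = i + 1 + k - max_ord f in
        (\<forall>s. J_rank_Delta \<sigma> f P k i (m + s) = J_rank_Delta \<sigma> f P k i m) \<and>
        J_rank_Delta \<sigma> f P k i m = J_rank_p \<sigma> f P k i m \<and>
        J_rank_p \<sigma> f P k i m = J_rank_kappa \<sigma> f P k i))"

section \<open>Dimension polynomial and Hilbert-Levin regularity\<close>

definition trdeg_A :: "('n, 'k::comm_ring_1) dpol set \<Rightarrow> nat \<Rightarrow> enat" where
  "trdeg_A P i = trdeg (residue_field (A_ring i) (A_set i \<inter> P))
     (\<lambda>c. residue_map (A_ring i) (A_set i \<inter> P) (mpol_const c))"

definition sigma_dim :: "('k \<Rightarrow> 'k) \<Rightarrow> ('n, 'k::comm_ring_1) dpol set \<Rightarrow> enat" where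
  "sigma_dim \<sigma> P = diff_trdeg (residue_field dpol_ring P) (residue_endo dpol_ring P (dpol_sigma \<sigma>))
     (\<lambda>c. residue_map dpol_ring P (mpol_const c))"

text \<open>The order is the constant coefficient of the dimension polynomial; that such a number exists
  for every \<open>\<sigma>\<close>-prime ideal is a theorem.\<close>

definition diff_ideal_order :: "('k \<Rightarrow> 'k) \<Rightarrow> ('n, 'k::comm_ring_1) dpol set \<Rightarrow> nat" where
  "diff_ideal_order \<sigma> P =
    (THE h. \<exists>i0. \<forall>i\<ge>i0. sigma_dim \<sigma> P * enat (i + 1) + enat h = trdeg_A P i)"

definition dimension_polynomial :: "('k \<Rightarrow> 'k) \<Rightarrow> ('n, 'k::comm_ring_1) dpol set \<Rightarrow> nat \<Rightarrow> enat" where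
  "dimension_polynomial \<sigma> P i = sigma_dim \<sigma> P * enat (i + 1) + enat (diff_ideal_order \<sigma> P)"

definition hilbert_levin_regularity :: "('k \<Rightarrow> 'k) \<Rightarrow> ('n, 'k::comm_ring_1) dpol set \<Rightarrow> nat" where
  "hilbert_levin_regularity \<sigma> P =
    (LEAST i0. \<forall>i\<ge>i0. dimension_polynomial \<sigma> P i = trdeg_A P i)"

end

theory Submission
  imports Defs
begin

text \<open>
  Over the residue field \<open>\<kappa>\<close> of \<open>P\<close> the Jacobian criterion of characteristic zero gives
  \<open>trdeg A\<^sub>i/(A\<^sub>i \<inter> P) = n(i + 1) - h\<^sub>i\<close>, where \<open>h\<^sub>i\<close> is the dimension of the span of the gradients of
  the elements of \<open>A\<^sub>i \<inter> P\<close>. By quasi-regularity, the elements annihilated by a denominator modulo the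
  prolongations \<open>f\<^sub>a\<^sup>(\<^sup>l\<^sup>)\<close> form a \<open>\<sigma>\<close>-prime ideal, so minimality makes it equal to \<open>P\<close>. Hence
  \<open>h\<^sub>i = r m - \<rho>\<close> for large \<open>m\<close>, where \<open>\<rho>\<close> is the rank over \<open>\<kappa>\<close> of the Jacobian of the \<open>f\<^sub>a\<^sup>(\<^sup>l\<^sup>)\<close>,
  \<open>l < m\<close>, with respect to the variables of order greater than \<open>i\<close>. Replacing \<open>(m, i)\<close> by
  \<open>(m + 1, i + 1)\<close> applies \<open>\<sigma>\<close> to that matrix and adds the rows of the \<open>f\<^sub>a\<close>, which vanish as soon as
  \<open>e \<le> i + 1\<close>; so \<open>\<rho>\<close> is unchanged and \<open>h\<^sub>i\<^sub>+\<^sub>1 = h\<^sub>i + r\<close> for all \<open>i \<ge> e - 1\<close>.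
\<close>

section \<open>Subrings, ideals and linear independence modulo a prime\<close>

text \<open>The hard point is primality of the ideal of elements annihilated modulo the
  prolongations. Classically it follows because a regular local ring modulo elements with
  independent differentials is a domain. Here the graded ring of the maximal-ideal filtration is
  shown to be a domain directly: the derivations dual to a maximal family in \<open>P\<close> with
  independent gradients give an Euler operator that acts on degree \<open>d\<close> as
  \<open>d\<close> times a unit, which characteristic zero makes invertible; Krull's intersection
  theorem gives every element outside the ideal a finite degree. Reflexivity of this ideal is what
  the reflexivity of \<open>Delta_infinity\<close> supplies. Linear algebra over \<kappa> is done
  without fractions, as independence modulo \<open>P\<close> with multipliers outside
  \<open>P\<close>, and dimensions are counted by local generators of \<open>P\<close> with
  independent gradients. The growth by \<open>r\<close> must also be matched with the leading
  coefficient of the dimension polynomial. The indices whose variables stay non-algebraic in all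
  orders number \<open>n - r\<close>, and they attain the difference transcendence degree.\<close>

definition subring_set :: "'a::comm_ring_1 set \<Rightarrow> bool" where
  "subring_set B \<longleftrightarrow> 1 \<in> B \<and> (\<forall>x\<in>B. \<forall>y\<in>B. x - y \<in> B \<and> x * y \<in> B)"

lemma subring_set_UNIV: "subring_set UNIV"
  by (simp add: subring_set_def)

context
  fixes B :: "'a::comm_ring_1 set"
  assumes B: "subring_set B"
begin

lemma subring_set_one: "1 \<in> B"
  using B by (simp add: subring_set_def)

lemma subring_set_diff: "x \<in> B \<Longrightarrow> y \<in> B \<Longrightarrow> x - y \<in> B"
  using B by (simp add: subring_set_def)

lemma subring_set_mult: "x \<in> B \<Longrightarrow> y \<in> B \<Longrightarrow> x * y \<in> B"
  using B by (simp add: subring_set_def)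

lemma subring_set_zero: "0 \<in> B"
  using subring_set_diff[OF subring_set_one subring_set_one] by simp

lemma subring_set_uminus: "x \<in> B \<Longrightarrow> - x \<in> B"
  using subring_set_diff[OF subring_set_zero] by fastforce

lemma subring_set_add: "x \<in> B \<Longrightarrow> y \<in> B \<Longrightarrow> x + y \<in> B"
  using subring_set_diff[of x "- y"] subring_set_uminus by fastforce

lemma subring_set_power: "x \<in> B \<Longrightarrow> x ^ n \<in> B"
  by (induction n) (auto intro: subring_set_one subring_set_mult)

lemma subring_set_sum: "(\<And>i. i \<in> S \<Longrightarrow> h i \<in> B) \<Longrightarrow> sum h S \<in> B"
  by (induction S rule: infinite_finite_induct) (auto intro: subring_set_zero subring_set_add)

lemma subring_set_prod: "(\<And>i. i \<in> S \<Longrightarrow> h i \<in> B) \<Longrightarrow> prod h S \<in> B"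
  by (induction S rule: infinite_finite_induct) (auto intro: subring_set_one subring_set_mult)

lemma subring_set_of_nat: "of_nat n \<in> B"
  by (induction n) (auto intro: subring_set_zero subring_set_one subring_set_add)

end

lemmas subring_set_intros =
  subring_set_one subring_set_zero subring_set_diff subring_set_mult subring_set_uminus
  subring_set_add subring_set_power subring_set_sum subring_set_prod subring_set_of_nat

definition ideal_in :: "'a::comm_ring_1 set \<Rightarrow> 'a set \<Rightarrow> bool" where
  "ideal_in B I \<longleftrightarrow> I \<subseteq> B \<and> 0 \<in> I \<and> (\<forall>x\<in>I. \<forall>y\<in>I. x + y \<in> I) \<and> (\<forall>b\<in>B. \<forall>x\<in>I. b * x \<in> I)"

lemma ideal_inD:
  assumes "ideal_in B I"
  shows "I \<subseteq> B" "0 \<in> I" "x \<in> I \<Longrightarrow> y \<in> I \<Longrightarrow> x + y \<in> I" "b \<in> B \<Longrightarrow> x \<in> I \<Longrightarrow> b * x \<in> I"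
    "b \<in> B \<Longrightarrow> x \<in> I \<Longrightarrow> x * b \<in> I"
  using assms by (auto simp: ideal_in_def mult.commute)

lemma ideal_in_uminus: "subring_set B \<Longrightarrow> ideal_in B I \<Longrightarrow> x \<in> I \<Longrightarrow> - x \<in> I"
  using ideal_inD(4)[of B I "- 1" x] by (simp add: subring_set_intros)

lemma ideal_in_diff: "subring_set B \<Longrightarrow> ideal_in B I \<Longrightarrow> x \<in> I \<Longrightarrow> y \<in> I \<Longrightarrow> x - y \<in> I"
  using ideal_inD(3)[of B I x "- y"] ideal_in_uminus[of B I y] by simp

lemma ideal_in_sum: "ideal_in B I \<Longrightarrow> (\<And>i. i \<in> S \<Longrightarrow> h i \<in> I) \<Longrightarrow> sum h S \<in> I"
  by (induction S rule: infinite_finite_induct) (auto intro: ideal_inD)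

definition prime_id :: "'a::comm_ring_1 set \<Rightarrow> bool" where
  "prime_id P \<longleftrightarrow> ideal_in UNIV P \<and> 1 \<notin> P \<and> (\<forall>a b. a * b \<in> P \<longrightarrow> a \<in> P \<or> b \<in> P)"

context
  fixes P :: "'a::comm_ring_1 set"
  assumes P: "prime_id P"
begin

lemma prime_id_zero: "0 \<in> P"
  and prime_id_add: "x \<in> P \<Longrightarrow> y \<in> P \<Longrightarrow> x + y \<in> P"
  and prime_id_mult_left: "x \<in> P \<Longrightarrow> b * x \<in> P"
  and prime_id_mult_right: "x \<in> P \<Longrightarrow> x * b \<in> P"
  and prime_id_one: "1 \<notin> P"
  and prime_id_mult_iff: "a * b \<in> P \<longleftrightarrow> a \<in> P \<or> b \<in> P"
  using P by (auto simp: prime_id_def ideal_in_def) (metis mult.commute)+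

lemma prime_id_uminus: "x \<in> P \<Longrightarrow> - x \<in> P"
  using prime_id_mult_left[of x "- 1"] by simp

lemma prime_id_diff: "x \<in> P \<Longrightarrow> y \<in> P \<Longrightarrow> x - y \<in> P"
  using prime_id_add[of x "- y"] prime_id_uminus by simp

lemma prime_id_sum: "(\<And>i. i \<in> S \<Longrightarrow> h i \<in> P) \<Longrightarrow> sum h S \<in> P"
  by (induction S rule: infinite_finite_induct) (auto intro: prime_id_zero prime_id_add)

lemma prime_id_add_cancel: "y \<in> P \<Longrightarrow> x + y \<in> P \<longleftrightarrow> x \<in> P"
  using prime_id_add prime_id_diff[of "x + y" y] by auto

lemma prime_id_diff_cancel: "y \<in> P \<Longrightarrow> x - y \<in> P \<longleftrightarrow> x \<in> P"
  using prime_id_diff prime_id_add[of "x - y" y] by auto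

lemma prime_id_ideal: "subring_set B \<Longrightarrow> ideal_in B (P \<inter> B)"
  by (auto simp: ideal_in_def prime_id_zero prime_id_add prime_id_mult_left subring_set_intros)

end

lemmas prime_id_intros =
  prime_id_zero prime_id_add prime_id_mult_left prime_id_mult_right prime_id_uminus
  prime_id_diff prime_id_sum

text \<open>Independence of the rows \<open>M i\<close>, \<open>i \<in> S\<close>, over the fraction field of \<open>B / (B \<inter> P)\<close>, with
  denominators cleared.\<close>

definition indep ::
  "'a::comm_ring_1 set \<Rightarrow> 'a set \<Rightarrow> 'j set \<Rightarrow> 'i set \<Rightarrow> ('i \<Rightarrow> 'j \<Rightarrow> 'a) \<Rightarrow> bool" where
  "indep B P J S M \<longleftrightarrow>
    (\<forall>c. (\<forall>i\<in>S. c i \<in> B) \<longrightarrow> (\<forall>j\<in>J. (\<Sum>i\<in>S. c i * M i j) \<in> P) \<longrightarrow> (\<forall>i\<in>S. c i \<in> P))"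

lemma indepD:
  "indep B P J S M \<Longrightarrow> (\<And>i. i \<in> S \<Longrightarrow> c i \<in> B) \<Longrightarrow> (\<And>j. j \<in> J \<Longrightarrow> (\<Sum>i\<in>S. c i * M i j) \<in> P)
    \<Longrightarrow> i \<in> S \<Longrightarrow> c i \<in> P"
  unfolding indep_def by blast

lemma indep_mono: "indep B P J S M \<Longrightarrow> J \<subseteq> J' \<Longrightarrow> indep B P J' S M"
  unfolding indep_def by blast

lemma indep_coeffs_mono: "indep B P J S M \<Longrightarrow> C \<subseteq> B \<Longrightarrow> indep C P J S M"
  unfolding indep_def by blast

lemma indep_subset:
  assumes "indep B P J S M" "T \<subseteq> S" "finite S" "subring_set B"
  shows "indep B P J T M"
  unfolding indep_def
proof (intro allI impI ballI)
  fix c i assume c: "\<forall>i\<in>T. c i \<in> B" "\<forall>j\<in>J. (\<Sum>i\<in>T. c i * M i j) \<in> P" and i: "i \<in> T"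
  let ?d = "\<lambda>i. if i \<in> T then c i else 0"
  have "(\<Sum>i\<in>S. ?d i * M i j) = (\<Sum>i\<in>T. c i * M i j)" for j
    using assms by (intro sum.mono_neutral_cong_right) auto
  note eq = this
  have "?d i \<in> P"
    by (rule indepD[OF assms(1), where c = ?d]) (use eq assms c i in \<open>auto intro: subring_set_zero\<close>)
  then show "c i \<in> P" using i by simp
qed

lemma indep_reindex:
  assumes "inj_on g S"
  shows "indep B P J (g ` S) M \<longleftrightarrow> indep B P J S (\<lambda>i. M (g i))"
proof
  assume L: "indep B P J (g ` S) M"
  show "indep B P J S (\<lambda>i. M (g i))"
    unfolding indep_def
  proof (intro allI impI ballI)
    fix c i assume c: "\<forall>i\<in>S. c i \<in> B" "\<forall>j\<in>J. (\<Sum>i\<in>S. c i * M (g i) j) \<in> P" and i: "i \<in> S"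
    let ?d = "\<lambda>x. c (inv_into S g x)"
    have "(\<Sum>x\<in>g ` S. ?d x * M x j) = (\<Sum>i\<in>S. c i * M (g i) j)" for j
      using assms by (simp add: sum.reindex inv_into_f_f)
    note eq = this
    have "?d (g i) \<in> P"
      by (rule indepD[OF L, where c = ?d]) (use eq assms c i in \<open>auto simp: inv_into_f_f\<close>)
    then show "c i \<in> P" using i assms by (simp add: inv_into_f_f)
  qed
next
  assume R: "indep B P J S (\<lambda>i. M (g i))"
  show "indep B P J (g ` S) M"
    unfolding indep_def
  proof (intro allI impI ballI)
    fix c x assume c: "\<forall>i\<in>g ` S. c i \<in> B" "\<forall>j\<in>J. (\<Sum>i\<in>g ` S. c i * M i j) \<in> P" and x: "x \<in> g ` S"
    then obtain i where i: "i \<in> S" "x = g i" by blast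
    have "(c \<circ> g) i \<in> P"
      by (rule indepD[OF R, where c = "c \<circ> g"]) (use assms c i in \<open>auto simp: sum.reindex\<close>)
    then show "c x \<in> P" using i by simp
  qed
qed

text \<open>The prime of \<open>B\<close> that matters is the contraction
  \<open>P \<inter> B\<close>. Keeping \<open>P\<close> as a prime of the whole type lets one
  \<open>P\<close> serve for all polynomial subrings at once.\<close>

locale prime_over_subring =
  fixes B P :: "'a::comm_ring_1 set"
  assumes sub: "subring_set B" and prime: "prime_id P"
begin

text \<open>Gaussian elimination without divisions. The relation with the pseudo-inverse \<open>N\<close> is an
  identity in \<open>B\<close>, not only modulo \<open>P\<close>.\<close>

lemma indep_pseudo_inverse:
  assumes "finite J" "finite S" "\<And>i j. i \<in> S \<Longrightarrow> j \<in> J \<Longrightarrow> M i j \<in> B" "indep B P J S M"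
  shows "\<exists>N \<delta>. \<delta> \<in> B - P \<and> (\<forall>j k. N j k \<in> B) \<and>
    (\<forall>i\<in>S. \<forall>k\<in>S. (\<Sum>j\<in>J. M i j * N j k) = (if i = k then \<delta> else 0))"
  using assms(2-)
proof (induction S rule: finite_induct)
  case empty
  show ?case
    using prime_id_one[OF prime] subring_set_one[OF sub] subring_set_zero[OF sub]
    by (intro exI[of _ "\<lambda>_ _. 0"] exI[of _ 1]) auto
next
  case (insert i0 S)
  have MB: "M i j \<in> B" if "i \<in> insert i0 S" "j \<in> J" for i j using insert.prems that by blast
  have "indep B P J S M"
    using insert.hyps insert.prems sub by (auto intro: indep_subset)
  then obtain N \<delta> where N: "\<delta> \<in> B - P" "\<And>j k. N j k \<in> B"
    "\<And>i k. i \<in> S \<Longrightarrow> k \<in> S \<Longrightarrow> (\<Sum>j\<in>J. M i j * N j k) = (if i = k then \<delta> else 0)"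
    using insert by blast
  \<comment> \<open>\<open>w\<close> is \<open>\<delta>\<close> times the new row minus its
    expansion in the old rows through \<open>N\<close>. It is a combination of rows whose
    coefficient at \<open>i0\<close> is \<open>\<delta>\<close>, so independence keeps some entry
    outside \<open>P\<close>.\<close>
  define t where "t k = (\<Sum>j\<in>J. M i0 j * N j k)" for k
  define w where "w j = \<delta> * M i0 j - (\<Sum>k\<in>S. t k * M k j)" for j
  have tB: "t k \<in> B" for k
    unfolding t_def using N MB by (auto intro!: subring_set_intros[OF sub])
  have "\<exists>j\<in>J. w j \<notin> P"
  proof (rule ccontr)
    assume neg: "\<not> ?thesis"
    let ?c = "\<lambda>i. if i = i0 then \<delta> else - t i"
    have "(\<Sum>i\<in>insert i0 S. ?c i * M i j) = w j" for j
    proof -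
      have "(\<Sum>i\<in>S. ?c i * M i j) = (\<Sum>i\<in>S. - (t i * M i j))"
        using insert.hyps by (intro sum.cong) auto
      then show ?thesis using insert.hyps by (simp add: w_def sum_negf)
    qed
    note eq = this
    have "?c i0 \<in> P"
      by (rule indepD[OF insert.prems(2), where c = ?c]) (use eq neg N tB in \<open>auto intro: subring_set_uminus[OF sub]\<close>)
    then show False using N by simp
  qed
  then obtain j0 where j0: "j0 \<in> J" "w j0 \<notin> P" by blast
  define \<epsilon> where "\<epsilon> = w j0"
  \<comment> \<open>\<open>z\<close> corrects \<open>\<delta>\<close> times the \<open>j0\<close>-th
    unit vector so that all old rows annihilate it, while the new row sends it to
    \<open>\<epsilon>\<close>.\<close>
  define z where "z j = (if j = j0 then \<delta> else 0) - (\<Sum>k\<in>S. N j k * M k j0)" for j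
  have eB: "\<epsilon> \<in> B"
    unfolding \<epsilon>_def w_def using N tB MB j0 by (auto intro!: subring_set_intros[OF sub])
  have zB: "z j \<in> B" for j
    unfolding z_def using N MB j0 by (auto intro!: subring_set_intros[OF sub])
  have Mz: "(\<Sum>j\<in>J. M i j * z j) = M i j0 * \<delta> - (\<Sum>k\<in>S. (\<Sum>j\<in>J. M i j * N j k) * M k j0)" for i
  proof -
    have "(\<Sum>j\<in>J. M i j * z j) = (\<Sum>j\<in>J. (if j = j0 then M i j0 * \<delta> else 0))
        - (\<Sum>j\<in>J. \<Sum>k\<in>S. M i j * N j k * M k j0)"
      unfolding sum_subtractf[symmetric]
      by (intro sum.cong) (auto simp: z_def right_diff_distrib sum_distrib_left mult.assoc)
    also have "(\<Sum>j\<in>J. (if j = j0 then M i j0 * \<delta> else 0)) = M i j0 * \<delta>"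
      using j0 assms(1) by simp
    also have "(\<Sum>j\<in>J. \<Sum>k\<in>S. M i j * N j k * M k j0) = (\<Sum>k\<in>S. (\<Sum>j\<in>J. M i j * N j k) * M k j0)"
      by (subst sum.swap) (simp add: sum_distrib_right)
    finally show ?thesis .
  qed
  have Mz_S: "(\<Sum>j\<in>J. M i j * z j) = 0" if "i \<in> S" for i
  proof -
    have "(\<Sum>k\<in>S. (\<Sum>j\<in>J. M i j * N j k) * M k j0) = (\<Sum>k\<in>S. if k = i then \<delta> * M i j0 else 0)"
      using N(3) that by (intro sum.cong) auto
    also have "\<dots> = \<delta> * M i j0" using insert.hyps that by simp
    finally show ?thesis unfolding Mz by (simp add: mult.commute)
  qed
  have Mz_i0: "(\<Sum>j\<in>J. M i0 j * z j) = \<epsilon>"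
    unfolding Mz \<epsilon>_def w_def t_def by (simp add: mult.commute)
  \<comment> \<open>Old columns are scaled by \<open>\<epsilon>\<close> and corrected by a multiple
    of \<open>z\<close> to make the new row vanish on them; the new column is \<open>z\<close>,
    scaled so that the common diagonal value is \<open>\<delta> * \<epsilon>\<close>.\<close>
  define N' where "N' j k = (if k = i0 then \<delta> * z j else \<epsilon> * N j k - t k * z j)" for j k
  have N'1: "(\<Sum>j\<in>J. M i j * N' j i0) = \<delta> * (\<Sum>j\<in>J. M i j * z j)" for i
    by (simp add: N'_def sum_distrib_left mult.left_commute)
  have N'2: "(\<Sum>j\<in>J. M i j * N' j k) = \<epsilon> * (\<Sum>j\<in>J. M i j * N j k) - t k * (\<Sum>j\<in>J. M i j * z j)"
    if "k \<noteq> i0" for i k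
    using that by (simp add: N'_def right_diff_distrib sum_subtractf sum_distrib_left mult.left_commute)
  show ?case
  proof (intro exI conjI allI ballI)
    show "\<delta> * \<epsilon> \<in> B - P"
      using N eB j0 by (auto simp: prime_id_mult_iff[OF prime] \<epsilon>_def intro: subring_set_mult[OF sub])
    show "N' j k \<in> B" for j k
      unfolding N'_def using N eB zB tB by (auto intro!: subring_set_intros[OF sub])
    fix i k assume ik: "i \<in> insert i0 S" "k \<in> insert i0 S"
    show "(\<Sum>j\<in>J. M i j * N' j k) = (if i = k then \<delta> * \<epsilon> else 0)"
    proof (cases "k = i0")
      case True
      then show ?thesis using ik N'1[of i] Mz_S Mz_i0 insert.hyps by auto
    next
      case False
      then have "k \<in> S" using ik by simp
      show ?thesis
      proof (cases "i = i0")
        case True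
        then show ?thesis using False N'2[OF False, of i] Mz_i0
          by (simp add: t_def[symmetric] mult.commute)
      next
        case i: False
        then have "i \<in> S" using ik by simp
        then show ?thesis using N'2[OF False, of i] Mz_S[of i] N(3)[of i k] \<open>k \<in> S\<close>
          by (simp add: mult.commute)
      qed
    qed
  qed
qed

text \<open>Multiplying a relation by \<open>N\<close> isolates each coefficient times
  \<open>\<delta>\<close>. As the relation with \<open>N\<close> is an identity, it survives ring
  homomorphisms, and this converse then yields independence over the target.\<close>

lemma pseudo_inverse_indep:
  assumes "finite S" "\<delta> \<notin> P"
    and "\<And>i k. i \<in> S \<Longrightarrow> k \<in> S \<Longrightarrow> (\<Sum>j\<in>J. M i j * N j k) = (if i = k then \<delta> else 0)"
  shows "indep UNIV P J S M"
  unfolding indep_def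
proof (intro allI impI ballI)
  fix c k assume c: "\<forall>j\<in>J. (\<Sum>i\<in>S. c i * M i j) \<in> P" and k: "k \<in> S"
  have "(\<Sum>j\<in>J. (\<Sum>i\<in>S. c i * M i j) * N j k) \<in> P"
    using c by (simp add: prime_id_sum[OF prime] prime_id_mult_right[OF prime])
  also have "(\<Sum>j\<in>J. (\<Sum>i\<in>S. c i * M i j) * N j k) = (\<Sum>i\<in>S. c i * (\<Sum>j\<in>J. M i j * N j k))"
    by (simp only: sum_distrib_left sum_distrib_right mult.assoc) (rule sum.swap)
  also have "\<dots> = (\<Sum>i\<in>S. if i = k then c k * \<delta> else 0)"
    using assms(3) k by (intro sum.cong) auto
  also have "\<dots> = c k * \<delta>" using assms(1) k by simp
  finally show "c k \<in> P" using assms(2) by (simp add: prime_id_mult_iff[OF prime])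
qed

text \<open>Linear independence over a field persists over every extension field: the pseudo-inverse
  found inside \<open>B\<close> works against coefficients from the whole ring.\<close>

lemma indep_coeffs_UNIV:
  assumes "finite J" "finite S" "\<And>i j. i \<in> S \<Longrightarrow> j \<in> J \<Longrightarrow> M i j \<in> B" "indep B P J S M"
  shows "indep UNIV P J S M"
  using indep_pseudo_inverse[OF assms] pseudo_inverse_indep[OF assms(2)] by (metis DiffD2)

end

text \<open>Elimination of one column: a pivot row outside \<open>P\<close> in that column is used
  up, and the remaining rows, cross-multiplied with it, stay independent in the other
  columns.\<close>

lemma indep_card_le:
  assumes P: "prime_id P" and "finite J" "finite S" "indep UNIV P J S M"
  shows "card S \<le> card J"
  using assms(2-)
proof (induction J arbitrary: S M rule: finite_induct)
  case empty
  have "(1::'a) \<in> P" if "i \<in> S" for i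
    using indepD[OF empty.prems(2), of "\<lambda>_. 1" i] that by auto
  then have "S = {}" using prime_id_one[OF P] by blast
  then show ?case by simp
next
  case (insert j J)
  show ?case
  proof (cases "\<forall>i\<in>S. M i j \<in> P")
    case True
    have "indep UNIV P J S M"
      unfolding indep_def
    proof (intro allI impI)
      fix c assume c: "\<forall>j\<in>J. (\<Sum>i\<in>S. c i * M i j) \<in> P"
      have "(\<Sum>i\<in>S. c i * M i j) \<in> P"
        using True by (auto intro!: prime_id_sum[OF P] prime_id_mult_left[OF P])
      then show "\<forall>i\<in>S. c i \<in> P"
        using c insert.prems(2) by (auto simp: indep_def)
    qed
    then show ?thesis using insert.IH[of S M] insert.prems insert.hyps by simp
  next
    case False
    then obtain i0 where i0: "i0 \<in> S" "M i0 j \<notin> P" by blast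
    let ?M = "\<lambda>i k. M i0 j * M i k - M i j * M i0 k"
    have "indep UNIV P J (S - {i0}) ?M"
      unfolding indep_def
    proof (intro allI impI ballI)
      fix c i assume c: "\<forall>k\<in>J. (\<Sum>i\<in>S - {i0}. c i * ?M i k) \<in> P" and i: "i \<in> S - {i0}"
      \<comment> \<open>The coefficient of the pivot row is chosen to cancel column
        \<open>j\<close>.\<close>
      let ?d = "\<lambda>i. if i = i0 then - (\<Sum>i\<in>S - {i0}. c i * M i j) else c i * M i0 j"
      have eq: "(\<Sum>i\<in>S. ?d i * M i k) = (\<Sum>i\<in>S - {i0}. c i * ?M i k)" for k
      proof -
        have "(\<Sum>i\<in>S. ?d i * M i k) = ?d i0 * M i0 k + (\<Sum>i\<in>S - {i0}. ?d i * M i k)"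
          using i0 insert.prems by (intro sum.remove) auto
        also have "(\<Sum>i\<in>S - {i0}. ?d i * M i k) = (\<Sum>i\<in>S - {i0}. c i * M i0 j * M i k)"
          by (intro sum.cong) auto
        also have "?d i0 * M i0 k = - (\<Sum>i\<in>S - {i0}. c i * M i j * M i0 k)"
          by (simp add: sum_distrib_right)
        finally show ?thesis
          by (simp add: right_diff_distrib sum_subtractf mult.assoc)
      qed
      have "(\<Sum>i\<in>S. ?d i * M i k) \<in> P" if "k \<in> insert j J" for k
      proof (cases "k = j")
        case True
        show ?thesis unfolding eq True by (auto intro!: prime_id_intros[OF P] simp: mult.commute)
      next
        case False
        then show ?thesis unfolding eq using c that by auto
      qed
      note eq = this
      have "?d i \<in> P"
        by (rule indepD[OF insert.prems(2), where c = ?d]) (use eq i in auto)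
      then show "c i \<in> P" using i i0 by (auto simp: prime_id_mult_iff[OF P])
    qed
    then have "card (S - {i0}) \<le> card J" using insert by blast
    then show ?thesis using i0 insert by (simp add: card_Diff_singleton)
  qed
qed

text \<open>A relation among the rows of \<open>C\<close> gives one among the rows of
  \<open>M\<close>, weighted by \<open>s i\<close>. Since \<open>s i\<close> is a unit modulo
  \<open>P\<close>, the rows of \<open>C\<close> are independent, and they have only
  \<open>card T\<close> columns.\<close>

lemma indep_card_le_span:
  assumes P: "prime_id P" and fin: "finite S" "finite T" and ind: "indep UNIV P J S M"
    and M: "\<And>i j. i \<in> S \<Longrightarrow> j \<in> J \<Longrightarrow> s i * M i j - (\<Sum>t\<in>T. C i t * G t j) \<in> P"
    and s: "\<And>i. i \<in> S \<Longrightarrow> s i \<notin> P"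
  shows "card S \<le> card T"
proof (rule indep_card_le[OF P fin(2,1)])
  show "indep UNIV P T S C"
    unfolding indep_def
  proof (intro allI impI ballI)
    fix c i assume c: "\<forall>t\<in>T. (\<Sum>i\<in>S. c i * C i t) \<in> P" and i: "i \<in> S"
    have "(\<Sum>i\<in>S. (c i * s i) * M i j) \<in> P" if j: "j \<in> J" for j
    proof -
      have a: "(\<Sum>i\<in>S. c i * (s i * M i j - (\<Sum>t\<in>T. C i t * G t j))) \<in> P"
        using M j by (auto intro!: prime_id_sum[OF P] prime_id_mult_left[OF P])
      have b: "(\<Sum>t\<in>T. (\<Sum>i\<in>S. c i * C i t) * G t j) \<in> P"
        using c by (simp add: prime_id_sum[OF P] prime_id_mult_right[OF P])
      have eq: "(\<Sum>t\<in>T. (\<Sum>i\<in>S. c i * C i t) * G t j) = (\<Sum>i\<in>S. c i * (\<Sum>t\<in>T. C i t * G t j))"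
        by (simp only: sum_distrib_left sum_distrib_right mult.assoc) (rule sum.swap)
      from prime_id_add[OF P a b[unfolded eq]] show ?thesis
        by (simp add: right_diff_distrib sum_subtractf mult.assoc)
    qed
    note eq = this
    have "c i * s i \<in> P"
      by (rule indepD[OF ind, where c = "\<lambda>i. c i * s i"]) (use eq i in simp_all)
    then show "c i \<in> P" using s[OF i] by (simp add: prime_id_mult_iff[OF P])
  qed
qed

section \<open>Generated and saturated ideals\<close>

inductive_set gen_ideal :: "'a::comm_ring_1 set \<Rightarrow> 'a set \<Rightarrow> 'a set" for B S where
  zero: "0 \<in> gen_ideal B S"
| step: "b \<in> B \<Longrightarrow> x \<in> S \<Longrightarrow> a \<in> gen_ideal B S \<Longrightarrow> b * x + a \<in> gen_ideal B S"

lemma gen_mono: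
  assumes "B \<subseteq> B'" "S \<subseteq> S'"
  shows "gen_ideal B S \<subseteq> gen_ideal B' S'"
proof
  fix a assume "a \<in> gen_ideal B S"
  then show "a \<in> gen_ideal B' S'"
    by induction (use assms in \<open>auto intro: gen_ideal.intros\<close>)
qed

lemma gen_add: "x \<in> gen_ideal B S \<Longrightarrow> y \<in> gen_ideal B S \<Longrightarrow> x + y \<in> gen_ideal B S"
  by (induction rule: gen_ideal.induct) (auto simp: add.assoc intro: gen_ideal.intros)

lemma gen_incl: "subring_set B \<Longrightarrow> x \<in> S \<Longrightarrow> x \<in> gen_ideal B S"
  using gen_ideal.step[OF subring_set_one _ gen_ideal.zero, of B x S] by simp

lemma ideal_in_gen:
  assumes "subring_set B" "S \<subseteq> B"
  shows "ideal_in B (gen_ideal B S)"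
  unfolding ideal_in_def
proof (intro conjI ballI)
  show "gen_ideal B S \<subseteq> B"
  proof
    fix a assume "a \<in> gen_ideal B S"
    then show "a \<in> B"
      by induction (use assms in \<open>auto intro!: subring_set_intros[OF assms(1)]\<close>)
  qed
  fix b x assume b: "b \<in> B" and "x \<in> gen_ideal B S"
  from this(2) show "b * x \<in> gen_ideal B S"
  proof induction
    case (step c x a)
    have "(b * c) * x + b * a \<in> gen_ideal B S"
      using step b assms by (intro gen_ideal.step) (auto intro: subring_set_mult)
    then show ?case by (simp add: algebra_simps)
  qed (auto intro: gen_ideal.zero)
qed (auto intro: gen_ideal.zero gen_add)

lemma gen_least:
  assumes "ideal_in B I" "S \<subseteq> I"
  shows "gen_ideal B S \<subseteq> I"
proof
  fix a assume "a \<in> gen_ideal B S"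
  then show "a \<in> I"
    by induction (use assms in \<open>auto intro: ideal_inD\<close>)
qed

lemma gen_insert_ideal:
  assumes B: "subring_set B" and Q: "ideal_in B Q" and a: "a \<in> gen_ideal B (insert y Q)"
  shows "\<exists>r\<in>B. \<exists>q\<in>Q. a = r * y + q"
  using a
proof induction
  case zero
  then show ?case using ideal_inD(2)[OF Q] subring_set_zero[OF B] by force
next
  case (step b x a)
  then obtain r q where rq: "r \<in> B" "q \<in> Q" "a = r * y + q" by blast
  show ?case
  proof (cases "x = y")
    case True
    then have "b * x + a = (b + r) * y + q" using rq by (simp add: algebra_simps)
    then show ?thesis using rq step B by (meson subring_set_add)
  next
    case False
    then have "b * x + a = r * y + (b * x + q)" "b * x + q \<in> Q"
      using rq step Q by (auto intro: ideal_inD)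
    then show ?thesis using rq by blast
  qed
qed

lemma sum_in_gen:
  assumes "subring_set B" "S \<subseteq> B" "\<And>i. i \<in> T \<Longrightarrow> c i \<in> B" "\<And>i. i \<in> T \<Longrightarrow> h i \<in> S"
  shows "(\<Sum>i\<in>T. c i * h i) \<in> gen_ideal B S"
  using assms
  by (intro ideal_in_sum[OF ideal_in_gen[OF assms(1,2)]] ideal_inD(4)[OF ideal_in_gen[OF assms(1,2)]] gen_incl)

lemma gen_image_sum:
  assumes B: "subring_set B" and "finite T" and "a \<in> gen_ideal B (h ` T)"
  shows "\<exists>c. (\<forall>x. c x \<in> B) \<and> a = (\<Sum>x\<in>T. c x * h x)"
  using assms(3)
proof induction
  case zero
  show ?case using subring_set_zero[OF B] by (intro exI[of _ "\<lambda>_. 0"]) auto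
next
  case (step b y a)
  then obtain x c where x: "x \<in> T" "y = h x" and c: "\<forall>x. c x \<in> B" "a = (\<Sum>x\<in>T. c x * h x)"
    by blast
  let ?d = "\<lambda>z. c z + (if z = x then b else 0)"
  have "(\<Sum>z\<in>T. ?d z * h z) = a + (\<Sum>z\<in>T. if z = x then b * h x else 0)"
    unfolding c(2) sum.distrib[symmetric] by (intro sum.cong) (auto simp: algebra_simps)
  also have "\<dots> = b * y + a" using x assms(2) by simp
  finally show ?case using c step B
    by (intro exI[of _ ?d]) (auto intro: subring_set_intros)
qed

text \<open>The contraction to \<open>B\<close> of the extension of \<open>I\<close> to the
  localization of \<open>B\<close> at \<open>P \<inter> B\<close>, written without fractions. The
  \<open>saturated\<close> ideals are those contracted from this localization.\<close>

definition saturation :: "'a::comm_ring_1 set \<Rightarrow> 'a set \<Rightarrow> 'a set \<Rightarrow> 'a set" where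
  "saturation B P I = {a \<in> B. \<exists>s\<in>B - P. s * a \<in> I}"

definition saturated :: "'a::comm_ring_1 set \<Rightarrow> 'a set \<Rightarrow> 'a set \<Rightarrow> bool" where
  "saturated B P I \<longleftrightarrow> ideal_in B I \<and> (\<forall>a\<in>B. \<forall>s\<in>B - P. s * a \<in> I \<longrightarrow> a \<in> I)"

lemma saturatedD: "saturated B P I \<Longrightarrow> a \<in> B \<Longrightarrow> s \<in> B \<Longrightarrow> s \<notin> P \<Longrightarrow> s * a \<in> I \<Longrightarrow> a \<in> I"
  unfolding saturated_def by blast

lemma sat_least: "saturated B P J \<Longrightarrow> I \<subseteq> J \<Longrightarrow> saturation B P I \<subseteq> J"
  unfolding saturation_def saturated_def by blast

lemma sat_mono: "I \<subseteq> J \<Longrightarrow> saturation B P I \<subseteq> saturation B P J"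
  unfolding saturation_def by blast

context prime_over_subring
begin

lemma denominators_mult: "s \<in> B - P \<Longrightarrow> t \<in> B - P \<Longrightarrow> s * t \<in> B - P"
  by (auto simp: prime_id_mult_iff[OF prime] intro: subring_set_mult[OF sub])

lemma denominators_one: "1 \<in> B - P"
  by (simp add: prime_id_one[OF prime] subring_set_one[OF sub])

lemma sat_incl: "ideal_in B I \<Longrightarrow> I \<subseteq> saturation B P I"
  using denominators_one by (force simp: saturation_def dest: ideal_inD(1))

lemma saturated_sat:
  assumes I: "ideal_in B I"
  shows "saturated B P (saturation B P I)"
  unfolding saturated_def ideal_in_def
proof (intro conjI ballI impI)
  show "saturation B P I \<subseteq> B" by (auto simp: saturation_def)
  show "0 \<in> saturation B P I" using sat_incl[OF I] ideal_inD(2)[OF I] by blast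
next
  fix x y assume "x \<in> saturation B P I" "y \<in> saturation B P I"
  then obtain s t where st: "s \<in> B - P" "s * x \<in> I" "t \<in> B - P" "t * y \<in> I" "x \<in> B" "y \<in> B"
    by (auto simp: saturation_def)
  have "(s * t) * (x + y) = t * (s * x) + s * (t * y)" by (simp add: algebra_simps)
  also have "\<dots> \<in> I" using st I by (auto intro: ideal_inD)
  finally show "x + y \<in> saturation B P I"
    using st denominators_mult[of s t] by (auto simp: saturation_def intro: subring_set_add[OF sub])
next
  fix b x assume b: "b \<in> B" and "x \<in> saturation B P I"
  then obtain s where s: "s \<in> B - P" "s * x \<in> I" "x \<in> B" by (auto simp: saturation_def)
  have "s * (b * x) = b * (s * x)" by (simp add: algebra_simps)
  also have "\<dots> \<in> I" using s b I by (auto intro: ideal_inD)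
  finally show "b * x \<in> saturation B P I" using s b by (auto simp: saturation_def intro: subring_set_mult[OF sub])
next
  fix a s assume a: "a \<in> B" and s: "s \<in> B - P" and "s * a \<in> saturation B P I"
  then obtain t where "t \<in> B - P" "t * (s * a) \<in> I" by (auto simp: saturation_def)
  then have "t * s * a \<in> I" "t * s \<in> B - P" using denominators_mult[OF _ s, of t]
    by (auto simp: mult.assoc)
  then show "a \<in> saturation B P I" using a unfolding saturation_def by blast
qed

lemma saturated_prime: "saturated B P (P \<inter> B)"
  unfolding saturated_def using prime_id_ideal[OF prime sub] by (auto simp: prime_id_mult_iff[OF prime])

end

section \<open>The Hilbert basis theorem and Krull's intersection theorem\<close>

definition noetherian :: "'a::comm_ring_1 set \<Rightarrow> bool" where
  "noetherian B \<longleftrightarrow> (\<forall>I. ideal_in B I \<longrightarrow> (\<exists>F. finite F \<and> F \<subseteq> I \<and> I \<subseteq> gen_ideal B F))"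

lemma noeth_chain:
  assumes "noetherian B" and I: "\<And>n. ideal_in B (I n)" and mono: "\<And>n. I n \<subseteq> I (Suc n)"
  shows "\<exists>N. \<forall>n\<ge>N. I n = I N"
proof -
  have le: "I m \<subseteq> I n" if "m \<le> n" for m n
    using lift_Suc_mono_le[of I, OF mono that] .
  have "ideal_in B (\<Union>n. I n)"
    unfolding ideal_in_def
  proof (intro conjI ballI)
    show "(\<Union>n. I n) \<subseteq> B" "0 \<in> (\<Union>n. I n)" using I by (auto dest: ideal_inD)
    fix x y assume "x \<in> (\<Union>n. I n)" "y \<in> (\<Union>n. I n)"
    then obtain m n where "x \<in> I m" "y \<in> I n" by blast
    then have "x \<in> I (max m n)" "y \<in> I (max m n)" using le[of m "max m n"] le[of n "max m n"] by auto
    then show "x + y \<in> (\<Union>n. I n)" using I by (auto intro: ideal_inD)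
  next
    fix b x assume "b \<in> B" "x \<in> (\<Union>n. I n)"
    then show "b * x \<in> (\<Union>n. I n)" using I by (auto intro: ideal_inD)
  qed
  then obtain F where F: "finite F" "F \<subseteq> (\<Union>n. I n)" "(\<Union>n. I n) \<subseteq> gen_ideal B F"
    using assms(1) by (auto simp: noetherian_def)
  have "\<exists>N. F \<subseteq> I N" using F(1,2)
  proof (induction F rule: finite_induct)
    case (insert x F)
    then obtain N n where "F \<subseteq> I N" "x \<in> I n" by auto
    then have "insert x F \<subseteq> I (max N n)" using le[of N "max N n"] le[of n "max N n"] by auto
    then show ?case by blast
  qed simp
  then obtain N where "F \<subseteq> I N" by blast
  then have "(\<Union>n. I n) \<subseteq> I N" using F(3) gen_least[OF I] by blast
  then show ?thesis using le by (intro exI[of _ N]) blast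
qed

lemma noeth_field:
  assumes "subring_set B" and inv: "\<And>x. x \<in> B \<Longrightarrow> x \<noteq> 0 \<Longrightarrow> \<exists>y\<in>B. x * y = 1"
  shows "noetherian B"
  unfolding noetherian_def
proof (intro allI impI)
  fix I assume I: "ideal_in B I"
  show "\<exists>F. finite F \<and> F \<subseteq> I \<and> I \<subseteq> gen_ideal B F"
  proof (cases "I \<subseteq> {0}")
    case True
    then show ?thesis by (intro exI[of _ "{}"]) (auto intro: gen_ideal.zero)
  next
    case False
    then obtain x where x: "x \<in> I" "x \<noteq> 0" by blast
    then obtain y where y: "y \<in> B" "x * y = 1" using inv ideal_inD(1)[OF I] by blast
    have "z \<in> gen_ideal B {x}" if "z \<in> I" for z
    proof -
      have "z = z * y * x + 0" using y by (simp add: mult.assoc mult.commute[of y])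
      moreover have "z * y \<in> B" using that y assms(1) ideal_inD(1)[OF I] by (auto intro: subring_set_mult)
      ultimately show ?thesis using gen_ideal.step[of "z * y" B x "{x}" 0] gen_ideal.zero by fastforce
    qed
    then show ?thesis using x by (intro exI[of _ "{x}"]) auto
  qed
qed

text \<open>These are values at \<open>x\<close> of polynomials of degree below \<open>n\<close>. As
  \<open>x\<close> need not be transcendental over \<open>B\<close>, the coefficients are not
  determined by the value.\<close>

definition poly_below :: "'a::comm_ring_1 set \<Rightarrow> 'a \<Rightarrow> nat \<Rightarrow> 'a set" where
  "poly_below B x n = {\<Sum>d<n. c d * x ^ d | c. \<forall>d. c d \<in> B}"

definition adjoin :: "'a::comm_ring_1 set \<Rightarrow> 'a \<Rightarrow> 'a set" where
  "adjoin B x = (\<Union>n. poly_below B x n)"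

section \<open>Polynomials in one adjoined element and the Hilbert basis theorem\<close>

context
  fixes B :: "'a::comm_ring_1 set" and x :: 'a
  assumes B: "subring_set B"
begin

lemma poly_below_0: "poly_below B x 0 = {0}"
  using subring_set_zero[OF B] by (auto simp: poly_below_def)

lemma poly_below_SucI: "c \<in> B \<Longrightarrow> r \<in> poly_below B x n \<Longrightarrow> c * x ^ n + r \<in> poly_below B x (Suc n)"
proof -
  assume c: "c \<in> B" and "r \<in> poly_below B x n"
  then obtain e where e: "\<forall>d. e d \<in> B" "r = (\<Sum>d<n. e d * x ^ d)" by (auto simp: poly_below_def)
  have "c * x ^ n + r = (\<Sum>d<Suc n. (e(n := c)) d * x ^ d)" using e by (simp add: add.commute)
  then show ?thesis using c e unfolding poly_below_def by (intro CollectI exI[of _ "e(n := c)"]) auto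
qed

lemma poly_below_SucE:
  assumes "a \<in> poly_below B x (Suc n)"
  obtains c r where "c \<in> B" "r \<in> poly_below B x n" "a = c * x ^ n + r"
proof -
  from assms obtain e where e: "\<forall>d. e d \<in> B" "a = (\<Sum>d<Suc n. e d * x ^ d)"
    by (auto simp: poly_below_def)
  show ?thesis
    by (rule that[of "e n" "\<Sum>d<n. e d * x ^ d"])
      (use e in \<open>auto simp: poly_below_def add.commute\<close>)
qed

lemma poly_below_add:
  assumes "a \<in> poly_below B x n" "b \<in> poly_below B x n"
  shows "a + b \<in> poly_below B x n"
proof -
  from assms obtain c e where ce: "\<forall>d. c d \<in> B" "a = (\<Sum>d<n. c d * x ^ d)"
    "\<forall>d. e d \<in> B" "b = (\<Sum>d<n. e d * x ^ d)" by (auto simp: poly_below_def)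
  show ?thesis unfolding poly_below_def
    by (rule CollectI, rule exI[of _ "\<lambda>d. c d + e d"])
      (use ce B in \<open>auto simp: sum.distrib distrib_right intro: subring_set_add\<close>)
qed

lemma poly_below_smult:
  assumes "b \<in> B" "a \<in> poly_below B x n"
  shows "b * a \<in> poly_below B x n"
proof -
  from assms obtain c where c: "\<forall>d. c d \<in> B" "a = (\<Sum>d<n. c d * x ^ d)" by (auto simp: poly_below_def)
  show ?thesis unfolding poly_below_def
    by (rule CollectI, rule exI[of _ "\<lambda>d. b * c d"])
      (use c assms B in \<open>auto simp: sum_distrib_left mult.assoc intro: subring_set_mult\<close>)
qed

lemma poly_below_zero: "0 \<in> poly_below B x n"
  unfolding poly_below_def
  by (rule CollectI, rule exI[of _ "\<lambda>d. 0"]) (use B in \<open>auto intro: subring_set_zero\<close>)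

lemma poly_below_uminus: "a \<in> poly_below B x n \<Longrightarrow> - a \<in> poly_below B x n"
  using poly_below_smult[of "- 1" a n] subring_set_uminus[OF B subring_set_one[OF B]] by simp

lemma poly_below_Suc: "a \<in> poly_below B x n \<Longrightarrow> a \<in> poly_below B x (Suc n)"
  using poly_below_SucI[OF subring_set_zero[OF B], of a n] by simp

lemma poly_below_le: "a \<in> poly_below B x m \<Longrightarrow> m \<le> n \<Longrightarrow> a \<in> poly_below B x n"
  by (induction n) (auto simp: le_Suc_eq intro: poly_below_Suc)

lemma poly_below_mult_var: "a \<in> poly_below B x n \<Longrightarrow> x * a \<in> poly_below B x (Suc n)"
proof (induction n arbitrary: a)
  case 0
  then show ?case using poly_below_zero by (auto simp: poly_below_0)
next
  case (Suc n)
  from Suc.prems obtain c r where cr: "c \<in> B" "r \<in> poly_below B x n" "a = c * x ^ n + r"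
    by (rule poly_below_SucE)
  have "c * x ^ Suc n + x * r \<in> poly_below B x (Suc (Suc n))"
    using cr Suc.IH by (intro poly_below_SucI) auto
  then show ?case by (simp add: cr(3) algebra_simps)
qed

lemma poly_below_mult_power: "a \<in> poly_below B x n \<Longrightarrow> x ^ k * a \<in> poly_below B x (n + k)"
  by (induction k) (auto simp: mult.assoc intro: poly_below_mult_var)

lemma poly_below_mult:
  "a \<in> poly_below B x m \<Longrightarrow> b \<in> poly_below B x n \<Longrightarrow> a * b \<in> poly_below B x (m + n)"
proof (induction m arbitrary: a)
  case 0
  then show ?case by (auto simp: poly_below_0 intro: poly_below_zero)
next
  case (Suc m)
  from Suc.prems obtain c r where cr: "c \<in> B" "r \<in> poly_below B x m" "a = c * x ^ m + r"
    by (auto elim: poly_below_SucE)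
  have "a * b = c * (x ^ m * b) + r * b" by (simp add: cr(3) algebra_simps)
  moreover have "c * (x ^ m * b) \<in> poly_below B x (Suc m + n)"
    using poly_below_smult[OF cr(1) poly_below_mult_power[OF Suc.prems(2), of m]]
    by (rule poly_below_le) simp
  moreover have "r * b \<in> poly_below B x (Suc m + n)"
    using Suc.IH[OF cr(2) Suc.prems(2)] by (rule poly_below_le) simp
  ultimately show ?case by (simp add: poly_below_add)
qed

lemma adjoinI: "a \<in> poly_below B x n \<Longrightarrow> a \<in> adjoin B x"
  by (auto simp: adjoin_def)

lemma adjoin_pair:
  assumes "a \<in> adjoin B x" "b \<in> adjoin B x"
  obtains n where "a \<in> poly_below B x n" "b \<in> poly_below B x n"
proof -
  from assms obtain m n where "a \<in> poly_below B x m" "b \<in> poly_below B x n" by (auto simp: adjoin_def)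
  then show ?thesis using that[of "max m n"] poly_below_le by auto
qed

lemma adjoin_base: "b \<in> B \<Longrightarrow> b \<in> adjoin B x"
  using poly_below_SucI[of b 0 0] by (auto simp: poly_below_0 intro: adjoinI)

lemma adjoin_var: "x \<in> adjoin B x"
  using poly_below_SucI[OF subring_set_one[OF B] poly_below_zero, of 1] by (auto intro: adjoinI)

lemma subring_set_adjoin: "subring_set (adjoin B x)"
  unfolding subring_set_def
proof (intro conjI ballI)
  show "1 \<in> adjoin B x" using adjoin_base subring_set_one[OF B] by blast
  fix a b assume "a \<in> adjoin B x" "b \<in> adjoin B x"
  then obtain n where n: "a \<in> poly_below B x n" "b \<in> poly_below B x n" by (rule adjoin_pair)
  show "a - b \<in> adjoin B x" using poly_below_add[OF n(1) poly_below_uminus[OF n(2)]] by (auto intro: adjoinI)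
  show "a * b \<in> adjoin B x" using poly_below_mult[OF n] by (rule adjoinI)
qed

text \<open>The ideals \<open>L n\<close> of coefficients of \<open>x ^ n\<close> increase and are
  stationary from some \<open>N\<close> on, so lifts of finite generating sets of \<open>L 0\<close>
  up to \<open>L N\<close> generate \<open>I\<close>. Since representations are not unique,
  \<open>L n\<close> ranges over all of them.\<close>

lemma noeth_adjoin:
  assumes "noetherian B"
  shows "noetherian (adjoin B x)"
  unfolding noetherian_def
proof (intro allI impI)
  let ?A = "adjoin B x"
  note A = subring_set_adjoin
  fix I assume I: "ideal_in ?A I"
  define L where "L n = {c \<in> B. \<exists>r\<in>poly_below B x n. c * x ^ n + r \<in> I}" for n
  have LI: "ideal_in B (L n)" for n
    unfolding ideal_in_def
  proof (intro conjI ballI)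
    show "L n \<subseteq> B" by (auto simp: L_def)
    show "0 \<in> L n" using poly_below_zero subring_set_zero[OF B] ideal_inD(2)[OF I]
      by (auto simp: L_def intro!: bexI[of _ 0])
    fix c e assume "c \<in> L n" "e \<in> L n"
    then obtain r s where "c \<in> B" "r \<in> poly_below B x n" "c * x ^ n + r \<in> I"
      "e \<in> B" "s \<in> poly_below B x n" "e * x ^ n + s \<in> I" by (auto simp: L_def)
    moreover from this have "(c + e) * x ^ n + (r + s) \<in> I"
      using ideal_inD(3)[OF I, of "c * x ^ n + r" "e * x ^ n + s"] by (simp add: algebra_simps)
    ultimately show "c + e \<in> L n" using poly_below_add subring_set_add[OF B] by (auto simp: L_def)
  next
    fix b c assume b: "b \<in> B" and "c \<in> L n"
    then obtain r where r: "c \<in> B" "r \<in> poly_below B x n" "c * x ^ n + r \<in> I" by (auto simp: L_def)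
    have "(b * c) * x ^ n + b * r \<in> I"
      using ideal_inD(4)[OF I adjoin_base[OF b] r(3)] by (simp add: algebra_simps)
    then show "b * c \<in> L n" using b r poly_below_smult subring_set_mult[OF B] by (auto simp: L_def)
  qed
  have "L n \<subseteq> L (Suc n)" for n
  proof
    fix c assume "c \<in> L n"
    then obtain r where r: "c \<in> B" "r \<in> poly_below B x n" "c * x ^ n + r \<in> I" by (auto simp: L_def)
    have "c * x ^ Suc n + x * r \<in> I"
      using ideal_inD(4)[OF I adjoin_var r(3)] by (simp add: algebra_simps)
    then show "c \<in> L (Suc n)" using r poly_below_mult_var[OF r(2)] by (auto simp: L_def simp del: power_Suc)
  qed
  from noeth_chain[of B L, OF assms LI this] obtain N where N: "\<And>n. n \<ge> N \<Longrightarrow> L n = L N" by blast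
  have "\<forall>n. \<exists>F. finite F \<and> F \<subseteq> L n \<and> L n \<subseteq> gen_ideal B F"
    using assms LI by (auto simp: noetherian_def)
  then obtain F where F: "\<And>n. finite (F n)" "\<And>n. F n \<subseteq> L n" "\<And>n. L n \<subseteq> gen_ideal B (F n)" by metis
  have "\<exists>h. \<forall>n. \<forall>c\<in>F n. h n c \<in> I \<and> (\<exists>r\<in>poly_below B x n. h n c = c * x ^ n + r)"
    using F(2) by (intro choice allI) (fastforce simp: L_def intro!: bchoice)
  then obtain h where h: "\<And>n c. c \<in> F n \<Longrightarrow> h n c \<in> I"
    "\<And>n c. c \<in> F n \<Longrightarrow> \<exists>r\<in>poly_below B x n. h n c = c * x ^ n + r" by blast
  define G where "G = (\<Union>n\<in>{..N}. h n ` F n)"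
  have GI: "G \<subseteq> I" using h by (auto simp: G_def)
  have GA: "ideal_in ?A (gen_ideal ?A G)"
    using GI ideal_inD(1)[OF I] by (intro ideal_in_gen[OF A]) auto
  have lift: "\<exists>g\<in>gen_ideal ?A G. \<exists>r\<in>poly_below B x m. g = c * x ^ m + r"
    if "m \<le> N" "c \<in> gen_ideal B (F m)" for m c
    using that(2)
  proof induction
    case zero
    show ?case using poly_below_zero gen_ideal.zero by fastforce
  next
    case (step b y a)
    obtain g r where g: "g \<in> gen_ideal ?A G" "r \<in> poly_below B x m" "g = a * x ^ m + r" using step by blast
    obtain s where s: "s \<in> poly_below B x m" "h m y = y * x ^ m + s" using h(2) step by blast
    have "h m y \<in> gen_ideal ?A G" using step that by (intro gen_incl[OF A]) (auto simp: G_def)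
    then have "b * h m y + g \<in> gen_ideal ?A G"
      using g GA adjoin_base[OF step(1)] by (auto intro: ideal_inD)
    moreover have "b * h m y + g = (b * y + a) * x ^ m + (b * s + r)"
      by (simp add: g s algebra_simps)
    moreover have "b * s + r \<in> poly_below B x m" using g s step by (intro poly_below_add poly_below_smult)
    ultimately show ?case by blast
  qed
  have main: "a \<in> gen_ideal ?A G" if "a \<in> I" "a \<in> poly_below B x n" for a n
    using that
  proof (induction n arbitrary: a)
    case 0
    then show ?case by (simp add: poly_below_0 gen_ideal.zero)
  next
    case (Suc n)
    from Suc.prems(2) obtain c r where cr: "c \<in> B" "r \<in> poly_below B x n" "a = c * x ^ n + r"
      by (rule poly_below_SucE)
    \<comment> \<open>Beyond \<open>N\<close> the leading coefficient already lies in
      \<open>L N\<close>; an element of degree \<open>N\<close> with that leading coefficient is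
      then raised to degree \<open>n\<close> by a power of \<open>x\<close>.\<close>
    define m where "m = min n N"
    have "c \<in> L n" using cr Suc.prems by (auto simp: L_def)
    also have "L n = L m" using N[of n] by (cases "n \<le> N") (simp_all add: m_def)
    finally have "c \<in> gen_ideal B (F m)" using F by blast
    then obtain g s where g: "g \<in> gen_ideal ?A G" "s \<in> poly_below B x m" "g = c * x ^ m + s"
      using lift[of m c] by (auto simp: m_def)
    have nm: "m + (n - m) = n" by (simp add: m_def)
    have xp: "x ^ (n - m) \<in> ?A" using adjoin_var by (intro subring_set_power[OF A])
    have xg: "x ^ (n - m) * g \<in> gen_ideal ?A G" using g GA xp by (auto intro: ideal_inD)
    have xn: "x ^ (n - m) * x ^ m = x ^ n" unfolding power_add[symmetric] by (simp add: m_def)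
    have "x ^ (n - m) * g = c * (x ^ (n - m) * x ^ m) + x ^ (n - m) * s"
      by (simp add: g distrib_left mult.left_commute)
    also have "\<dots> = c * x ^ n + x ^ (n - m) * s" unfolding xn ..
    finally have "x ^ (n - m) * g = c * x ^ n + x ^ (n - m) * s" .
    then have eq: "a - x ^ (n - m) * g = r + - (x ^ (n - m) * s)" by (simp add: cr)
    have "a - x ^ (n - m) * g \<in> I"
      using ideal_in_diff[OF A I Suc.prems(1), of "x ^ (n - m) * g"] xg gen_least[OF I GI] by blast
    moreover have "a - x ^ (n - m) * g \<in> poly_below B x n"
      unfolding eq
      by (rule poly_below_add[OF cr(2) poly_below_uminus])
        (use poly_below_mult_power[OF g(2), of "n - m"] nm in simp)
    ultimately have "a - x ^ (n - m) * g \<in> gen_ideal ?A G" by (rule Suc.IH)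
    then have "(a - x ^ (n - m) * g) + x ^ (n - m) * g \<in> gen_ideal ?A G" using xg by (rule gen_add)
    then show ?case by simp
  qed
  have "I \<subseteq> gen_ideal ?A G"
    using main ideal_inD(1)[OF I] by (auto simp: adjoin_def)
  then show "\<exists>F. finite F \<and> F \<subseteq> I \<and> I \<subseteq> gen_ideal ?A F"
    using GI F(1) by (intro exI[of _ G]) (auto simp: G_def)
qed

end

text \<open>Modulo the ideal generated by \<open>F\<close>, \<open>filt B P F d\<close> is the contraction to \<open>B\<close> of the \<open>d\<close>-th
  power of the maximal ideal of \<open>B\<^sub>P\<close>.\<close>

primrec filt :: "'a::comm_ring_1 set \<Rightarrow> 'a set \<Rightarrow> 'a set \<Rightarrow> nat \<Rightarrow> 'a set" where
  "filt B P F 0 = B"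
| "filt B P F (Suc d) = saturation B P (gen_ideal B ({p * q | p q. p \<in> P \<inter> B \<and> q \<in> filt B P F d} \<union> F))"

declare filt.simps(2) [simp del]

section \<open>The filtration by powers of the maximal ideal and Krull's intersection
  theorem\<close>

context prime_over_subring
begin

context
  fixes F assumes F: "F \<subseteq> P \<inter> B"
begin

lemma saturated_UNIV: "saturated B P B"
  using sub by (auto simp: saturated_def ideal_in_def intro: subring_set_intros)

lemma saturated_filt: "saturated B P (filt B P F d)"
proof (induction d)
  case 0
  show ?case using saturated_UNIV by simp
next
  case (Suc d)
  then have "filt B P F d \<subseteq> B" by (auto simp: saturated_def dest: ideal_inD)
  then have "{p * q | p q. p \<in> P \<inter> B \<and> q \<in> filt B P F d} \<union> F \<subseteq> B"
    using F sub by (auto intro: subring_set_mult)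
  then show ?case using saturated_sat[OF ideal_in_gen[OF sub]] by (simp add: filt.simps(2))
qed

lemma ideal_filt: "ideal_in B (filt B P F d)"
  using saturated_filt by (simp add: saturated_def)

lemma filt_subset: "filt B P F d \<subseteq> B"
  using ideal_filt ideal_inD(1) by blast

lemma filt_gens_subset: "{p * q | p q. p \<in> P \<inter> B \<and> q \<in> filt B P F d} \<union> F \<subseteq> B"
  using F sub filt_subset by (auto intro!: subring_set_mult)

lemma gens_subset_filt: "{p * q | p q. p \<in> P \<inter> B \<and> q \<in> filt B P F d} \<union> F \<subseteq> filt B P F (Suc d)"
  (is "?S \<subseteq> _")
proof -
  have "?S \<subseteq> gen_ideal B ?S" by (intro subsetI gen_incl[OF sub])
  also have "\<dots> \<subseteq> filt B P F (Suc d)"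
    using sat_incl[OF ideal_in_gen[OF sub filt_gens_subset]] by (simp only: filt.simps)
  finally show ?thesis .
qed

lemma filt_Suc_mult: "p \<in> P \<Longrightarrow> p \<in> B \<Longrightarrow> q \<in> filt B P F d \<Longrightarrow> p * q \<in> filt B P F (Suc d)"
  using gens_subset_filt[of d] by blast

lemma filt_gen: "f \<in> F \<Longrightarrow> f \<in> filt B P F d"
  using gens_subset_filt[of "d - 1"] F by (cases d) auto

text \<open>This serves as the induction rule of the filtration: an inclusion in a saturated ideal
  has to be tested on products and on \<open>F\<close> only.\<close>

lemma filt_Suc_least:
  assumes "saturated B P J" "F \<subseteq> J"
    and "\<And>p q. p \<in> P \<Longrightarrow> p \<in> B \<Longrightarrow> q \<in> filt B P F d \<Longrightarrow> p * q \<in> J"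
  shows "filt B P F (Suc d) \<subseteq> J"
proof -
  have "ideal_in B J" using assms(1) by (simp add: saturated_def)
  then have "gen_ideal B ({p * q | p q. p \<in> P \<inter> B \<and> q \<in> filt B P F d} \<union> F) \<subseteq> J"
    using assms by (intro gen_least) auto
  then show ?thesis using sat_least[OF assms(1)] by (simp add: filt.simps(2))
qed

lemma filt_Suc_subset: "filt B P F (Suc d) \<subseteq> filt B P F d"
  using filt_gen ideal_filt by (intro filt_Suc_least saturated_filt) (auto intro: ideal_inD)

lemma filt_antimono: "m \<le> n \<Longrightarrow> filt B P F n \<subseteq> filt B P F m"
  using lift_Suc_antimono_le[of "filt B P F", OF filt_Suc_subset] .

lemma filt_1: "filt B P F (Suc 0) = P \<inter> B"
proof
  show "filt B P F (Suc 0) \<subseteq> P \<inter> B"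
    using F by (intro filt_Suc_least saturated_prime)
      (auto intro: prime_id_mult_right[OF prime] subring_set_mult[OF sub])
  show "P \<inter> B \<subseteq> filt B P F (Suc 0)"
    using filt_Suc_mult[of _ 1 0] subring_set_one[OF sub] by auto
qed

text \<open>For fixed \<open>b\<close>, the elements whose product with \<open>b\<close> lies deep
  enough form a saturated ideal, so the induction on \<open>d\<close> needs to treat generators
  only.\<close>

lemma filt_mult: "a \<in> filt B P F d \<Longrightarrow> b \<in> filt B P F k \<Longrightarrow> a * b \<in> filt B P F (d + k)"
proof (induction d arbitrary: a)
  case 0
  then show ?case using ideal_filt by (auto intro: ideal_inD)
next
  case (Suc d)
  let ?J = "{a \<in> B. a * b \<in> filt B P F (Suc (d + k))}"
  note I = ideal_filt[of "Suc (d + k)"]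
  have b: "b \<in> B" using Suc.prems filt_subset by blast
  have "saturated B P ?J"
    unfolding saturated_def ideal_in_def
  proof (intro conjI ballI impI)
    fix x y assume "x \<in> ?J" "y \<in> ?J"
    then show "x + y \<in> ?J"
      using ideal_inD(3)[OF I, of "x * b" "y * b"] subring_set_add[OF sub] by (auto simp: distrib_right)
  next
    fix c x assume "c \<in> B" "x \<in> ?J"
    then show "c * x \<in> ?J"
      using ideal_inD(4)[OF I, of c "x * b"] subring_set_mult[OF sub] by (auto simp: mult.assoc)
  next
    fix x s assume "x \<in> B" "s \<in> B - P" "s * x \<in> ?J"
    then show "x \<in> ?J"
      using saturatedD[OF saturated_filt, of "x * b" s "Suc (d + k)"] b subring_set_mult[OF sub]
      by (auto simp: mult.assoc)
  qed (use ideal_inD(2)[OF I] subring_set_zero[OF sub] in auto)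
  then have "filt B P F (Suc d) \<subseteq> ?J"
  proof (rule filt_Suc_least)
    show "F \<subseteq> ?J" using F b filt_gen[of _ "Suc (d + k)"] I by (auto intro: ideal_inD(5))
    fix p q assume pq: "p \<in> P" "p \<in> B" "q \<in> filt B P F d"
    then have "p * (q * b) \<in> filt B P F (Suc (d + k))"
      using Suc by (intro filt_Suc_mult) auto
    then show "p * q \<in> ?J" using pq filt_subset[of d] subring_set_mult[OF sub] by (auto simp: mult.assoc)
  qed
  then show ?case using Suc.prems by auto
qed

lemma gen_subset_filt: "saturation B P (gen_ideal B F) \<subseteq> filt B P F d"
  using filt_gen by (intro sat_least saturated_filt gen_least ideal_filt) auto

text \<open>An ideal \<open>Q \<supseteq> F\<close> maximal among the saturated ideals avoiding \<open>x\<close> contains a power of \<open>P\<close>: the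
  iterated colon ideals of \<open>Q\<close> by \<open>P\<close> must reach the unit ideal.\<close>

lemma krull_intersection:
  assumes N: "noetherian B" and x: "\<And>d. x \<in> filt B P F d"
  shows "x \<in> saturation B P (gen_ideal B F)"
proof (rule ccontr)
  assume neg: "x \<notin> saturation B P (gen_ideal B F)"
  have xB: "x \<in> B" using x[of 0] by simp
  define \<A> where "\<A> = {Q. saturated B P Q \<and> F \<subseteq> Q \<and> x \<notin> Q}"
  have genF: "ideal_in B (gen_ideal B F)" using F by (intro ideal_in_gen[OF sub]) auto
  have "saturation B P (gen_ideal B F) \<in> \<A>"
    using neg saturated_sat[OF genF] sat_incl[OF genF] gen_incl[OF sub, of _ F] by (auto simp: \<A>_def)
  then have "\<A> \<noteq> {}" by blast
  moreover have "\<Union>\<C> \<in> \<A>" if C0: "\<C> \<noteq> {}" and C: "subset.chain \<A> \<C>" for \<C>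
  proof -
    have CA: "\<And>Q. Q \<in> \<C> \<Longrightarrow> saturated B P Q \<and> F \<subseteq> Q \<and> x \<notin> Q"
      and lin: "\<And>Q R. Q \<in> \<C> \<Longrightarrow> R \<in> \<C> \<Longrightarrow> Q \<subseteq> R \<or> R \<subseteq> Q"
      using C by (auto simp: \<A>_def subset.chain_def)
    then have CI: "\<And>Q. Q \<in> \<C> \<Longrightarrow> ideal_in B Q" by (simp add: saturated_def)
    obtain Q0 where Q0: "Q0 \<in> \<C>" using C0 by blast
    have "saturated B P (\<Union>\<C>)"
      unfolding saturated_def ideal_in_def
    proof (intro conjI ballI impI)
      show "\<Union>\<C> \<subseteq> B" using CI by (auto dest: ideal_inD)
      show "0 \<in> \<Union>\<C>" using CI[OF Q0] Q0 by (auto dest: ideal_inD)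
      fix a b assume "a \<in> \<Union>\<C>" "b \<in> \<Union>\<C>"
      then obtain Q R where "Q \<in> \<C>" "a \<in> Q" "R \<in> \<C>" "b \<in> R" by blast
      then show "a + b \<in> \<Union>\<C>" using lin[of Q R] CI ideal_inD(3) by blast
    next
      fix b a assume "b \<in> B" "a \<in> \<Union>\<C>"
      then show "b * a \<in> \<Union>\<C>" using CI ideal_inD(4) by blast
    next
      fix a s assume "a \<in> B" "s \<in> B - P" "s * a \<in> \<Union>\<C>"
      then show "a \<in> \<Union>\<C>" using CA saturatedD by blast
    qed
    then show ?thesis using CA Q0 by (auto simp: \<A>_def)
  qed
  ultimately obtain Q where QA: "Q \<in> \<A>" and max: "\<And>R. R \<in> \<A> \<Longrightarrow> Q \<subseteq> R \<Longrightarrow> R = Q"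
    using subset_Zorn_nonempty[of \<A>] by blast
  have Q: "saturated B P Q" "F \<subseteq> Q" "x \<notin> Q" using QA by (auto simp: \<A>_def)
  have QI: "ideal_in B Q" using Q by (simp add: saturated_def)
  \<comment> \<open>By maximality, adjoining any \<open>y\<close> outside \<open>Q\<close> and
    saturating captures \<open>x\<close>.\<close>
  have ext: "\<exists>s\<in>B - P. \<exists>r\<in>B. \<exists>q\<in>Q. s * x = r * y + q" if "y \<in> B" "y \<notin> Q" for y
  proof -
    let ?R = "gen_ideal B (insert y Q)"
    have RI: "ideal_in B ?R" using that QI by (intro ideal_in_gen[OF sub]) (auto dest: ideal_inD)
    have "insert y Q \<subseteq> saturation B P ?R" using sat_incl[OF RI] gen_incl[OF sub, of _ "insert y Q"] by blast
    then have "saturation B P ?R \<notin> \<A>" using max[of "saturation B P ?R"] that by blast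
    then have "x \<in> saturation B P ?R"
      using \<open>insert y Q \<subseteq> saturation B P ?R\<close> saturated_sat[OF RI] Q by (auto simp: \<A>_def)
    then obtain s where "s \<in> B - P" "s * x \<in> ?R" by (auto simp: saturation_def)
    then show ?thesis using gen_insert_ideal[OF sub QI] by blast
  qed
  \<comment> \<open>If \<open>a * x\<close> were outside \<open>Q\<close>, it could play the part of
    \<open>y\<close>. Then \<open>s - r * a\<close> multiplies \<open>x\<close> into
    \<open>Q\<close>, and it is still a denominator because \<open>a \<in> P\<close>; so
    \<open>x\<close> itself would lie in \<open>Q\<close>.\<close>
  have Px: "a * x \<in> Q" if "a \<in> P" "a \<in> B" for a
  proof (rule ccontr)
    assume "a * x \<notin> Q"
    from ext[OF subring_set_mult[OF sub that(2) xB] this] obtain s r q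
      where srq: "s \<in> B - P" "r \<in> B" "q \<in> Q" "s * x = r * (a * x) + q" by blast
    have "s - r * a \<in> B - P"
      using srq that by (auto simp: prime_id_diff_cancel[OF prime] prime_id_mult_left[OF prime]
          intro!: subring_set_intros[OF sub])
    moreover have "(s - r * a) * x \<in> Q" using srq by (simp add: left_diff_distrib mult.assoc)
    ultimately show False using saturatedD[OF Q(1) xB] Q(3) by blast
  qed
  \<comment> \<open>The colon ideals of \<open>Q\<close> by powers of \<open>a\<close> become
    stationary at some \<open>N\<close>. If \<open>a ^ N\<close> were outside \<open>Q\<close>, then
    \<open>s * x = r * a ^ N + q\<close>; multiplying by \<open>a\<close> puts \<open>r\<close> into
    the next colon ideal, hence into the \<open>N\<close>-th, and \<open>x\<close> into
    \<open>Q\<close>.\<close>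
  have nilp: "\<exists>n. a ^ n \<in> Q" if a: "a \<in> P" "a \<in> B" for a
  proof -
    have apow: "a ^ n \<in> B" for n using a by (intro subring_set_power[OF sub])
    define I where "I n = {y \<in> B. a ^ n * y \<in> Q}" for n
    have "ideal_in B (I n)" for n
      unfolding ideal_in_def
    proof (intro conjI ballI)
      fix y z assume "y \<in> I n" "z \<in> I n"
      then show "y + z \<in> I n" using ideal_inD(3)[OF QI] subring_set_add[OF sub]
        by (auto simp: I_def distrib_left)
    next
      fix b y assume "b \<in> B" "y \<in> I n"
      then show "b * y \<in> I n" using ideal_inD(4)[OF QI] subring_set_mult[OF sub]
        by (auto simp: I_def mult.left_commute)
    qed (use QI sub in \<open>auto simp: I_def intro: subring_set_zero ideal_inD\<close>)
    moreover have "I n \<subseteq> I (Suc n)" for n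
      using ideal_inD(4)[OF QI a(2)] by (auto simp: I_def mult.assoc)
    ultimately obtain N where "\<And>n. n \<ge> N \<Longrightarrow> I n = I N" using noeth_chain[OF N, of I] by blast
    from this[of "Suc N"] have IN: "I (Suc N) = I N" by simp
    have "a ^ N \<in> Q"
    proof (rule ccontr)
      assume "a ^ N \<notin> Q"
      from ext[OF apow this] obtain s r q
        where srq: "s \<in> B - P" "r \<in> B" "q \<in> Q" "s * x = r * a ^ N + q" by blast
      have "s * (a * x) - a * q \<in> Q"
        by (rule ideal_in_diff[OF sub QI ideal_inD(4)[OF QI _ Px[OF a]] ideal_inD(4)[OF QI a(2)]])
          (use srq in auto)
      moreover have "s * (a * x) - a * q = a ^ Suc N * r"
      proof -
        have "s * (a * x) = a * (s * x)" by (simp add: algebra_simps)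
        then show ?thesis using srq(4) by (simp add: algebra_simps)
      qed
      ultimately have "r \<in> I (Suc N)" using srq by (simp add: I_def)
      then have "r \<in> I N" by (simp only: IN)
      then have "a ^ N * r \<in> Q" by (simp add: I_def)
      then have "s * x \<in> Q" using srq ideal_inD(3)[OF QI] by (simp add: mult.commute)
      then show False using saturatedD[OF Q(1) xB, of s] srq Q(3) by blast
    qed
    then show ?thesis by blast
  qed
  \<comment> \<open>\<open>col i\<close> is the colon ideal of \<open>Q\<close> by the
    \<open>i\<close>-th power of \<open>P \<inter> B\<close>.\<close>
  define col where "col = rec_nat Q (\<lambda>_ R. {y \<in> B. \<forall>p\<in>P \<inter> B. p * y \<in> R})"
  have col0: "col 0 = Q" and colS: "col (Suc i) = {y \<in> B. \<forall>p\<in>P \<inter> B. p * y \<in> col i}" for i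
    by (simp_all add: col_def)
  have col_sat: "saturated B P (col i)" for i
  proof (induction i)
    case (Suc i)
    then have I: "ideal_in B (col i)" by (simp add: saturated_def)
    show ?case
      unfolding saturated_def ideal_in_def
    proof (intro conjI ballI impI)
      fix y z assume "y \<in> col (Suc i)" "z \<in> col (Suc i)"
      then show "y + z \<in> col (Suc i)" using ideal_inD(3)[OF I] subring_set_add[OF sub]
        by (auto simp: colS distrib_left)
    next
      fix b y assume "b \<in> B" "y \<in> col (Suc i)"
      then show "b * y \<in> col (Suc i)" using ideal_inD(4)[OF I] subring_set_mult[OF sub]
        by (auto simp: colS mult.left_commute[of _ b])
    next
      fix y s assume y: "y \<in> B" "s \<in> B - P" "s * y \<in> col (Suc i)"
      have "p * y \<in> col i" if "p \<in> P \<inter> B" for p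
      proof (rule saturatedD[OF Suc, of _ s])
        show "s * (p * y) \<in> col i" using y that by (auto simp: colS mult.left_commute)
      qed (use y that subring_set_mult[OF sub] in auto)
      then show "y \<in> col (Suc i)" using y by (auto simp: colS)
    qed (use I sub in \<open>auto simp: colS intro: subring_set_zero ideal_inD\<close>)
  qed (use Q col0 in simp)
  then have colI: "ideal_in B (col i)" for i by (simp add: saturated_def)
  have col_mono: "col i \<subseteq> col (Suc i)" for i
    using colI[of i] by (auto simp: colS dest: ideal_inD)
  have Qcol: "Q \<subseteq> col i" for i
    using lift_Suc_mono_le[of col, OF col_mono, of 0 i] col0 by auto
  obtain M where M0: "\<forall>n\<ge>M. col n = col M" using noeth_chain[of B col, OF N colI col_mono] ..
  have M: "col (Suc M) = col M" by (rule M0[rule_format, OF le_SucI[OF le_refl]])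
  \<comment> \<open>At a stationary stage nothing outside \<open>col M\<close> is multiplied into it
    by all of \<open>P \<inter> B\<close>. If \<open>1\<close> were missing, multiplying
    \<open>1\<close> by suitable powers of the finitely many generators of
    \<open>P \<inter> B\<close>, nilpotent modulo \<open>Q\<close>, would produce such an
    element.\<close>
  have one: "1 \<in> col M"
  proof (rule ccontr)
    assume one: "1 \<notin> col M"
    obtain G where G: "finite G" "G \<subseteq> P \<inter> B" "P \<inter> B \<subseteq> gen_ideal B G"
      using N[unfolded noetherian_def, rule_format, OF prime_id_ideal[OF prime sub]] by blast
    have "\<exists>y\<in>B. y \<notin> col M \<and> (\<forall>g\<in>G. g * y \<in> col M)" using G(1,2)
    proof (induction G rule: finite_induct)
      case empty
      then show ?case using one subring_set_one[OF sub] by auto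
    next
      case (insert g G)
      then obtain y where y: "y \<in> B" "y \<notin> col M" "\<And>h. h \<in> G \<Longrightarrow> h * y \<in> col M" by auto
      obtain n where "g ^ n \<in> Q" using nilp[of g] insert.prems by auto
      then have ex: "g ^ n * y \<in> col M" using Qcol[of M] colI y by (auto intro: ideal_inD)
      define m where "m = (LEAST n. g ^ n * y \<in> col M)"
      have m: "g ^ m * y \<in> col M" using ex unfolding m_def by (rule LeastI)
      then obtain k where k: "m = Suc k" using y by (cases m) auto
      have "g ^ k * y \<notin> col M" using not_less_Least[of k "\<lambda>n. g ^ n * y \<in> col M"] k by (simp add: m_def)
      moreover have gk: "g ^ k \<in> B" using insert.prems by (intro subring_set_power[OF sub]) auto
      moreover have "h * (g ^ k * y) \<in> col M" if "h \<in> insert g G" for h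
      proof (cases "h = g")
        case True
        then show ?thesis using m k by (simp add: mult.assoc)
      next
        case False
        then show ?thesis
          using that ideal_inD(4)[OF colI gk y(3), of h] by (simp add: mult.left_commute[of h])
      qed
      ultimately show ?case using y subring_set_mult[OF sub] by blast
    qed
    then obtain y where y: "y \<in> B" "y \<notin> col M" "\<And>g. g \<in> G \<Longrightarrow> g * y \<in> col M" by blast
    have "p * y \<in> col M" if "p \<in> gen_ideal B G" for p
      using that
    proof induction
      case (step b g a)
      then show ?case
        using ideal_inD(3)[OF colI ideal_inD(4)[OF colI step(1) y(3)[OF step(2)]] step(4)]
        by (simp add: distrib_right mult.assoc)
    qed (use colI in \<open>auto dest: ideal_inD\<close>)
    then have "y \<in> col (Suc M)" using y G by (auto simp: colS)
    then show False using y M by simp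
  qed
  \<comment> \<open>Each factor from \<open>P\<close> uses up one colon step; at
    \<open>i = M\<close> the filtration has fallen into \<open>Q\<close>, which misses
    \<open>x\<close>.\<close>
  have "filt B P F i \<subseteq> col (M - i)" if "i \<le> M" for i
    using that
  proof (induction i)
    case 0
    have "b \<in> col M" if "b \<in> B" for b using ideal_inD(4)[OF colI that one] by simp
    then show ?case by auto
  next
    case (Suc i)
    then have eq: "M - i = Suc (M - Suc i)" by simp
    show ?case
    proof (rule filt_Suc_least[OF col_sat])
      show "F \<subseteq> col (M - Suc i)" using Q Qcol by blast
      fix p q assume "p \<in> P" "p \<in> B" "q \<in> filt B P F i"
      moreover from this have "q \<in> col (Suc (M - Suc i))" using Suc by (auto simp: eq)
      ultimately show "p * q \<in> col (M - Suc i)" by (auto simp: colS)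
    qed
  qed
  from this[of M] x[of M] col0 Q(3) show False by auto
qed

end

end

section \<open>A Jacobian criterion for primality\<close>

definition derivation_on :: "'a::comm_ring_1 set \<Rightarrow> ('a \<Rightarrow> 'a) \<Rightarrow> bool" where
  "derivation_on B E \<longleftrightarrow> E ` B \<subseteq> B \<and> (\<forall>a b. E (a + b) = E a + E b \<and> E (a * b) = a * E b + b * E a)"

section \<open>Calculus of derivations\<close>

context
  fixes B and E :: "'a::comm_ring_1 \<Rightarrow> 'a"
  assumes E: "derivation_on B E"
begin

lemma derivation_closed: "a \<in> B \<Longrightarrow> E a \<in> B"
  and derivation_add: "E (a + b) = E a + E b"
  and derivation_mult: "E (a * b) = a * E b + b * E a"
  using E by (auto simp: derivation_on_def)

lemma derivation_zero: "E 0 = 0"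
  using derivation_add[of 0 0] by simp

lemma derivation_uminus: "E (- a) = - E a"
  using derivation_add[of a "- a"] derivation_zero by (simp add: eq_neg_iff_add_eq_0 add.commute)

lemma derivation_diff: "E (a - b) = E a - E b"
  using derivation_add[of a "- b"] by (simp add: derivation_uminus)

lemma derivation_sum: "E (sum h S) = (\<Sum>i\<in>S. E (h i))"
  by (induction S rule: infinite_finite_induct) (auto simp: derivation_add derivation_zero)

lemma derivation_one: "E 1 = 0"
  using derivation_mult[of 1 1] by simp

lemma derivation_of_nat: "E (of_nat n) = 0"
  by (induction n) (auto simp: derivation_add derivation_zero derivation_one)

lemma derivation_power: "E (x ^ n) = of_nat n * x ^ (n - 1) * E x"
proof (induction n)
  case (Suc n)
  then show ?case by (cases n) (auto simp: derivation_mult algebra_simps)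
qed (simp add: derivation_one)

lemma derivation_iter_closed: "a \<in> B \<Longrightarrow> (E ^^ n) a \<in> B"
  by (induction n) (auto intro: derivation_closed)

lemma derivation_leibniz:
  "(E ^^ n) (a * b) = (\<Sum>i\<le>n. of_nat (n choose i) * ((E ^^ i) a * (E ^^ (n - i)) b))"
proof (induction n)
  case (Suc n)
  let ?t = "\<lambda>i j. (E ^^ i) a * (E ^^ j) b"
  have "(E ^^ Suc n) (a * b)
      = (\<Sum>i\<le>n. of_nat (n choose i) * ?t (Suc i) (n - i)) + (\<Sum>i\<le>n. of_nat (n choose i) * ?t i (Suc n - i))"
    unfolding sum.distrib[symmetric] funpow.simps(2) comp_def Suc.IH derivation_sum
    by (intro sum.cong) (auto simp: derivation_mult derivation_of_nat algebra_simps Suc_diff_le)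
  also have "(\<Sum>i\<le>n. of_nat (n choose i) * ?t i (Suc n - i))
      = ?t 0 (Suc n) + (\<Sum>i\<le>n. of_nat (n choose Suc i) * ?t (Suc i) (n - i))"
  proof -
    have "(\<Sum>i\<le>n. of_nat (n choose i) * ?t i (Suc n - i)) = (\<Sum>i\<le>Suc n. of_nat (n choose i) * ?t i (Suc n - i))"
      by (simp add: binomial_eq_0)
    also have "\<dots> = ?t 0 (Suc n) + (\<Sum>i\<le>n. of_nat (n choose Suc i) * ?t (Suc i) (n - i))"
      by (subst sum.atMost_Suc_shift) simp
    finally show ?thesis .
  qed
  also have "(\<Sum>i\<le>n. of_nat (n choose i) * ?t (Suc i) (n - i))
      + (?t 0 (Suc n) + (\<Sum>i\<le>n. of_nat (n choose Suc i) * ?t (Suc i) (n - i)))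
      = ?t 0 (Suc n) + (\<Sum>i\<le>n. of_nat (Suc n choose Suc i) * ?t (Suc i) (n - i))"
    by (simp add: algebra_simps sum.distrib)
  also have "\<dots> = (\<Sum>i\<le>Suc n. of_nat (Suc n choose i) * ?t i (Suc n - i))"
    by (subst sum.atMost_Suc_shift) simp
  finally show ?case .
qed simp

end

lemma derivation_on_combination:
  assumes "subring_set B" "\<And>v. v \<in> V \<Longrightarrow> derivation_on B (D v)" "\<And>v. v \<in> V \<Longrightarrow> N v \<in> B"
  shows "derivation_on B (\<lambda>a. \<Sum>v\<in>V. N v * D v a)"
  unfolding derivation_on_def
proof (intro conjI allI image_subsetI)
  fix a b
  show "(\<Sum>v\<in>V. N v * D v (a + b)) = (\<Sum>v\<in>V. N v * D v a) + (\<Sum>v\<in>V. N v * D v b)"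
    unfolding sum.distrib[symmetric] using assms
    by (intro sum.cong) (auto simp: derivation_add[OF assms(2)] distrib_left)
  show "(\<Sum>v\<in>V. N v * D v (a * b)) = a * (\<Sum>v\<in>V. N v * D v b) + b * (\<Sum>v\<in>V. N v * D v a)"
    unfolding sum_distrib_left sum.distrib[symmetric] using assms
    by (intro sum.cong) (auto simp: derivation_mult[OF assms(2)] algebra_simps)
next
  fix a assume "a \<in> B"
  then show "(\<Sum>v\<in>V. N v * D v a) \<in> B"
    using assms by (intro subring_set_sum subring_set_mult) (auto intro: derivation_closed)
qed

lemma not_indep_insert:
  assumes P: "prime_id P" and S: "finite S" "x \<notin> S" "indep B P J S M" "\<not> indep B P J (insert x S) M"
  shows "\<exists>c. (\<forall>i\<in>insert x S. c i \<in> B) \<and> c x \<notin> P \<and> (\<forall>j\<in>J. c x * M x j + (\<Sum>i\<in>S. c i * M i j) \<in> P)"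
proof -
  obtain c i where c: "\<forall>i\<in>insert x S. c i \<in> B" "\<forall>j\<in>J. (\<Sum>i\<in>insert x S. c i * M i j) \<in> P"
    "i \<in> insert x S" "c i \<notin> P"
    using S(4) unfolding indep_def by blast
  have eq: "(\<Sum>i\<in>insert x S. c i * M i j) = c x * M x j + (\<Sum>i\<in>S. c i * M i j)" for j
    using S by simp
  have "c x \<notin> P"
  proof
    assume x: "c x \<in> P"
    have "(\<Sum>i\<in>S. c i * M i j) \<in> P" if "j \<in> J" for j
      using c(2) that prime_id_add_cancel[OF P prime_id_mult_right[OF P x], of "\<Sum>i\<in>S. c i * M i j" "M x j"]
      unfolding eq by (simp add: add.commute)
    then have "\<forall>i\<in>S. c i \<in> P" using S(3) c(1) unfolding indep_def by blast
    then show False using c x by auto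
  qed
  then show ?thesis using c(1,2) unfolding eq by blast
qed

context prime_over_subring
begin

context
  fixes F assumes F: "F \<subseteq> P \<inter> B"
begin

text \<open>By the product rule a derivation lowers the order at \<open>P\<close> by at most one,
  and killing \<open>F\<close> makes it compatible with reduction modulo \<open>F\<close>.
  Saturation is respected because \<open>s * E x = E (s * x) - x * E s\<close>.\<close>

lemma derivation_filt:
  assumes E: "derivation_on B E" and EF: "\<And>f. f \<in> F \<Longrightarrow> E f = 0"
  shows "a \<in> filt B P F (Suc d) \<Longrightarrow> E a \<in> filt B P F d"
proof (induction d arbitrary: a)
  case 0
  then show ?case using filt_subset[OF F, of "Suc 0"] derivation_closed[OF E] by auto
next
  case (Suc d)
  let ?J = "{a \<in> filt B P F (Suc d). E a \<in> filt B P F (Suc d)}"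
  note I = ideal_filt[OF F, of "Suc d"] and S = saturated_filt[OF F, of "Suc d"]
  have IB: "x \<in> B" if "x \<in> filt B P F (Suc d)" for x using filt_subset[OF F] that by blast
  have "saturated B P ?J"
    unfolding saturated_def ideal_in_def
  proof (intro conjI ballI impI)
    show "?J \<subseteq> B" using IB by blast
    show "0 \<in> ?J" using ideal_inD(2)[OF I] by (simp add: derivation_zero[OF E])
    fix x y assume "x \<in> ?J" "y \<in> ?J"
    then show "x + y \<in> ?J" using ideal_inD(3)[OF I] by (auto simp: derivation_add[OF E])
  next
    fix b x assume "b \<in> B" "x \<in> ?J"
    then show "b * x \<in> ?J"
      using ideal_inD(3,4,5)[OF I] derivation_closed[OF E] by (auto simp: derivation_mult[OF E])
  next
    fix x s assume x: "x \<in> B" "s \<in> B - P" "s * x \<in> ?J"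
    have xd: "x \<in> filt B P F (Suc d)" using x saturatedD[OF S] by blast
    have "E (s * x) - x * E s \<in> filt B P F (Suc d)"
      using x xd derivation_closed[OF E, of s] by (intro ideal_in_diff[OF sub I] ideal_inD(5)[OF I]) auto
    then have "s * E x \<in> filt B P F (Suc d)" by (simp add: derivation_mult[OF E])
    then show "x \<in> ?J" using xd x saturatedD[OF S derivation_closed[OF E x(1)]] by blast
  qed
  then have "filt B P F (Suc (Suc d)) \<subseteq> ?J"
  proof (rule filt_Suc_least[OF F])
    show "F \<subseteq> ?J" using filt_gen[OF F, of _ "Suc d"] EF ideal_inD(2)[OF I] by auto
    fix p q assume pq: "p \<in> P" "p \<in> B" "q \<in> filt B P F (Suc d)"
    have "p * E q \<in> filt B P F (Suc d)" using pq Suc.IH by (intro filt_Suc_mult[OF F]) auto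
    moreover have "q * E p \<in> filt B P F (Suc d)" "p * q \<in> filt B P F (Suc d)"
      using pq ideal_inD(4,5)[OF I] derivation_closed[OF E] by auto
    ultimately show "p * q \<in> ?J" using ideal_inD(3)[OF I] by (auto simp: derivation_mult[OF E])
  qed
  then show ?case using Suc.prems by blast
qed

lemma derivation_iter_filt:
  assumes E: "derivation_on B E" and EF: "\<And>f. f \<in> F \<Longrightarrow> E f = 0"
  shows "a \<in> filt B P F d \<Longrightarrow> (E ^^ n) a \<in> filt B P F (d - n)"
proof (induction n)
  case (Suc n)
  then have a: "(E ^^ n) a \<in> filt B P F (d - n)" by simp
  show ?case
  proof (cases "d - n")
    case 0
    then show ?thesis using a derivation_closed[OF E] by (simp add: diff_Suc)
  next
    case (Suc m)
    then show ?thesis using derivation_filt[OF E EF, of "(E ^^ n) a" m] a by (simp add: diff_Suc)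
  qed
qed simp

text \<open>If the derivations \<open>E g\<close> detect the degree of the filtration, then the associated graded
  ring is a domain: the leading coefficients of \<open>a\<close> and \<open>b\<close> with respect to one \<open>E g\<close> multiply to
  that of \<open>a * b\<close> and have smaller total degree.\<close>

lemma filt_graded_domain:
  assumes E: "\<And>g. g \<in> G \<Longrightarrow> derivation_on B (E g)" and EF: "\<And>g f. g \<in> G \<Longrightarrow> f \<in> F \<Longrightarrow> E g f = 0"
    and char: "\<And>n. n > 0 \<Longrightarrow> of_nat n \<notin> P"
    and detect: "\<And>a d. a \<in> P \<inter> B \<Longrightarrow> (\<And>g. g \<in> G \<Longrightarrow> E g a \<in> filt B P F d) \<Longrightarrow> a \<in> filt B P F (Suc d)"
  shows "a \<in> filt B P F d - filt B P F (Suc d) \<Longrightarrow> b \<in> filt B P F k - filt B P F (Suc k)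
    \<Longrightarrow> a * b \<notin> filt B P F (Suc (d + k))"
proof (induction "d + k" arbitrary: a b d k rule: less_induct)
  case less
  have aB: "a \<in> B" and bB: "b \<in> B" using less.prems filt_subset[OF F] by blast+
  show ?case
  proof (cases "d = 0 \<and> k = 0")
    case True
    then show ?thesis using less.prems aB bB
      by (auto simp: filt_1[OF F] prime_id_mult_iff[OF prime])
  next
    case False
    have det: "\<exists>g\<in>G. E g x \<notin> filt B P F m"
      if "x \<in> filt B P F m - filt B P F (Suc m)" "m > 0" for x m
    proof -
      have "x \<in> filt B P F (Suc 0)" using that filt_antimono[OF F, of "Suc 0" m] by auto
      then have "x \<in> P \<inter> B" by (simp only: filt_1[OF F])
      then show ?thesis using detect[of x m] that by blast
    qed
    have "\<exists>g\<in>G. (d > 0 \<and> E g a \<notin> filt B P F d) \<or> (k > 0 \<and> E g b \<notin> filt B P F k)"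
    proof (cases "d > 0")
      case True
      then show ?thesis using det[OF less.prems(1)] by blast
    next
      case d: False
      then have "k > 0" using False by simp
      then show ?thesis using det[OF less.prems(2)] by blast
    qed
    then obtain g where g: "g \<in> G" "(d > 0 \<and> E g a \<notin> filt B P F d) \<or> (k > 0 \<and> E g b \<notin> filt B P F k)"
      by blast
    let ?E = "E g"
    note dE = E[OF g(1)] and EgF = EF[OF g(1)]
    \<comment> \<open>\<open>n\<close> is the last iterate whose order is exactly
      \<open>m - n\<close>; every later one lies one step deeper than expected. It is positive if a
      single application of \<open>E g\<close> already meets the expected order.\<close>
    have lead: "\<exists>n\<le>m. (?E ^^ n) x \<notin> filt B P F (Suc m - n) \<and> (\<forall>i>n. (?E ^^ i) x \<in> filt B P F (Suc m - i))
        \<and> (m > 0 \<longrightarrow> ?E x \<notin> filt B P F m \<longrightarrow> n > 0)"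
      if x: "x \<in> filt B P F m - filt B P F (Suc m)" for x m
    proof -
      define N where "N = {n. n \<le> m \<and> (?E ^^ n) x \<notin> filt B P F (Suc m - n)}"
      have fin: "finite N" by (simp add: N_def)
      have "0 \<in> N" using x by (simp add: N_def)
      then obtain n where n: "n \<in> N" "\<And>i. i \<in> N \<Longrightarrow> i \<le> n"
        using Max_in[OF fin] Max_ge[OF fin] by blast
      show ?thesis
      proof (intro exI[of _ n] conjI allI impI)
        show "n \<le> m" "(?E ^^ n) x \<notin> filt B P F (Suc m - n)" using n(1) by (auto simp: N_def)
        show "n > 0" if "m > 0" "?E x \<notin> filt B P F m"
          using n(2)[of 1] that by (simp add: N_def)
        fix i assume i: "i > n"
        show "(?E ^^ i) x \<in> filt B P F (Suc m - i)"
        proof (rule ccontr)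
          assume neg: "(?E ^^ i) x \<notin> filt B P F (Suc m - i)"
          have "x \<in> B" using x filt_subset[OF F] by blast
          then have "i \<le> m"
            using neg derivation_iter_closed[OF dE] by (cases "i \<le> m") auto
          then have "i \<in> N" using neg by (simp add: N_def)
          then show False using n(2)[of i] i by simp
        qed
      qed
    qed
    obtain n where n: "n \<le> d" "(?E ^^ n) a \<notin> filt B P F (Suc d - n)"
      "\<And>i. i > n \<Longrightarrow> (?E ^^ i) a \<in> filt B P F (Suc d - i)" "d > 0 \<longrightarrow> ?E a \<notin> filt B P F d \<longrightarrow> n > 0"
      using lead[OF less.prems(1)] by blast
    obtain m where m: "m \<le> k" "(?E ^^ m) b \<notin> filt B P F (Suc k - m)"
      "\<And>i. i > m \<Longrightarrow> (?E ^^ i) b \<in> filt B P F (Suc k - i)" "k > 0 \<longrightarrow> ?E b \<notin> filt B P F k \<longrightarrow> m > 0"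
      using lead[OF less.prems(2)] by blast
    have nm: "n + m > 0" using g n(4) m(4) by auto
    let ?a = "(?E ^^ n) a" and ?b = "(?E ^^ m) b"
    let ?K = "Suc ((d - n) + (k - m))"
    have a': "?a \<in> filt B P F (d - n) - filt B P F (Suc (d - n))"
      using derivation_iter_filt[OF dE EgF, of a d n] n(1,2) less.prems(1) by (auto simp: Suc_diff_le)
    have b': "?b \<in> filt B P F (k - m) - filt B P F (Suc (k - m))"
      using derivation_iter_filt[OF dE EgF, of b k m] m(1,2) less.prems(2) by (auto simp: Suc_diff_le)
    have IH: "?a * ?b \<notin> filt B P F ?K"
      using n(1) m(1) nm by (intro less.hyps a' b') auto
    note I = ideal_filt[OF F, of ?K]
    let ?t = "\<lambda>i. of_nat ((n + m) choose i) * ((?E ^^ i) a * (?E ^^ (n + m - i)) b)"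
    \<comment> \<open>For \<open>i > n\<close> the left factor is one step too deep; for
      \<open>i < n\<close> the right factor is, since it is differentiated more than
      \<open>m\<close> times.\<close>
    have t: "?t i \<in> filt B P F ?K" if i: "i \<le> n + m" "i \<noteq> n" for i
    proof -
      have ea: "(?E ^^ i) a \<in> filt B P F (d - i)" and eb: "(?E ^^ (n + m - i)) b \<in> filt B P F (k - (n + m - i))"
        using less.prems derivation_iter_filt[OF dE EgF] by auto
      have "\<exists>u v. ?K \<le> u + v \<and> (?E ^^ i) a \<in> filt B P F u \<and> (?E ^^ (n + m - i)) b \<in> filt B P F v"
      proof (cases "i > n")
        case True
        then show ?thesis using n(3)[OF True] eb n(1) m(1) i
          by (intro exI[of _ "Suc d - i"] exI[of _ "k - (n + m - i)"]) auto
      next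
        case False
        then have "n + m - i > m" using i by auto
        from m(3)[OF this] show ?thesis using ea n(1) m(1) i False
          by (intro exI[of _ "d - i"] exI[of _ "Suc k - (n + m - i)"]) auto
      qed
      then obtain u v where uv: "?K \<le> u + v" "(?E ^^ i) a \<in> filt B P F u" "(?E ^^ (n + m - i)) b \<in> filt B P F v"
        by blast
      then have "(?E ^^ i) a * (?E ^^ (n + m - i)) b \<in> filt B P F ?K"
        using filt_mult[OF F uv(2,3)] filt_antimono[OF F uv(1)] by blast
      then show ?thesis using I subring_set_of_nat[OF sub] by (auto intro: ideal_inD)
    qed
    have split: "(?E ^^ (n + m)) (a * b) = ?t n + (\<Sum>i\<in>{..n + m} - {n}. ?t i)"
      unfolding derivation_leibniz[OF dE] by (rule sum.remove) auto
    have rest: "(\<Sum>i\<in>{..n + m} - {n}. ?t i) \<in> filt B P F ?K"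
      using t by (intro ideal_in_sum[OF I]) auto
    show ?thesis
    proof
      assume "a * b \<in> filt B P F (Suc (d + k))"
      from derivation_iter_filt[OF dE EgF this, of "n + m"]
      have "(?E ^^ (n + m)) (a * b) \<in> filt B P F ?K"
        using n(1) m(1) by (simp add: Suc_diff_le)
      from ideal_in_diff[OF sub I this rest] have "?t n \<in> filt B P F ?K" unfolding split by simp
      \<comment> \<open>The single surviving Leibniz term carries a binomial coefficient, a
        denominator in characteristic zero.\<close>
      then have "of_nat ((n + m) choose n) * (?a * ?b) \<in> filt B P F ?K" by simp
      moreover have "(n + m) choose n > 0" by (simp add: zero_less_binomial)
      ultimately have "?a * ?b \<in> filt B P F ?K"
        using saturatedD[OF saturated_filt[OF F, of ?K], of "?a * ?b" "of_nat ((n + m) choose n)"]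
          char subring_set_of_nat[OF sub] subring_set_mult[OF sub]
          derivation_iter_closed[OF dE aB] derivation_iter_closed[OF dE bB] by auto
      then show False using IH by contradiction
    qed
  qed
qed

end

text \<open>Plays the role of the theorem that a regular local ring modulo part of a regular system
  of parameters is a domain. Assumption \<open>H\<close> says that elements of \<open>P\<close> with
  all derivatives in \<open>P\<close> lie in the second symbolic power. \<open>F\<close> is enlarged
  to a system of parameters, and the associated graded ring modulo \<open>F\<close> is shown to be a
  domain.\<close>

theorem jacobian_prime:
  assumes N: "noetherian B" and V: "finite V" and D: "\<And>v. v \<in> V \<Longrightarrow> derivation_on B (D v)"
    and char: "\<And>n. n > 0 \<Longrightarrow> of_nat n \<notin> P"
    and H: "\<And>p. p \<in> P \<inter> B \<Longrightarrow> (\<And>v. v \<in> V \<Longrightarrow> D v p \<in> P) \<Longrightarrow>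
      p \<in> saturation B P (gen_ideal B {p * q | p q. p \<in> P \<inter> B \<and> q \<in> P \<inter> B})"
    and F: "finite F" "F \<subseteq> P \<inter> B" "indep B P V F (\<lambda>p v. D v p)"
    and ab: "a \<in> B" "b \<in> B" "a * b \<in> saturation B P (gen_ideal B F)"
  shows "a \<in> saturation B P (gen_ideal B F) \<or> b \<in> saturation B P (gen_ideal B F)"
proof -
  \<comment> \<open>A maximal family exists because independent gradients are at most
    \<open>card V\<close> in number.\<close>
  define \<S> where "\<S> S \<longleftrightarrow> finite S \<and> F \<subseteq> S \<and> S \<subseteq> P \<inter> B \<and> indep B P V S (\<lambda>p v. D v p)" for S
  have bound: "card S \<le> card V" if "\<S> S" for S
    by (rule indep_card_le[OF prime V _ indep_coeffs_UNIV[OF V, of S "\<lambda>p v. D v p"]])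
      (use that D in \<open>auto simp: \<S>_def intro: derivation_closed\<close>)
  have "\<S> F" using F by (simp add: \<S>_def)
  then have "\<exists>S. \<S> S \<and> (\<forall>T. \<S> T \<longrightarrow> card T \<le> card S)"
    by (rule ex_has_greatest_nat[where b = "Suc (card V)"]) (use bound in \<open>auto simp: less_Suc_eq_le\<close>)
  then obtain S where S: "\<S> S" and Smax: "\<And>T. \<S> T \<Longrightarrow> card T \<le> card S" by blast
  have fS: "finite S" "F \<subseteq> S" "S \<subseteq> P \<inter> B" "indep B P V S (\<lambda>p v. D v p)" using S by (auto simp: \<S>_def)
  have DB: "D v p \<in> B" if "p \<in> S" "v \<in> V" for p v
    using derivation_closed[OF D] fS that by auto
  obtain M \<delta> where M: "\<delta> \<in> B - P" "\<And>v k. M v k \<in> B"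
    "\<And>p q. p \<in> S \<Longrightarrow> q \<in> S \<Longrightarrow> (\<Sum>v\<in>V. D v p * M v q) = (if p = q then \<delta> else 0)"
    using indep_pseudo_inverse[where M = "\<lambda>p v. D v p", OF V fS(1) DB fS(4)] by blast
  \<comment> \<open>These derivations are dual to \<open>S\<close> up to the common factor
    \<open>\<delta>\<close>; those belonging to \<open>S - F\<close> kill \<open>F\<close>.\<close>
  define E where "E q a = (\<Sum>v\<in>V. M v q * D v a)" for q a
  have dE: "derivation_on B (E q)" for q
    unfolding E_def using sub D M(2) by (intro derivation_on_combination) auto
  have ES: "E q p = (if p = q then \<delta> else 0)" if "p \<in> S" "q \<in> S" for p q
    using M(3)[OF that] by (simp add: E_def mult.commute)
  define G where "G = S - F"
  have fG: "finite G" and GP: "\<And>g. g \<in> G \<Longrightarrow> g \<in> P \<and> g \<in> B" and GS: "G \<subseteq> S" using fS by (auto simp: G_def)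
  have EF: "E g f = 0" if "g \<in> G" "f \<in> F" for g f
    using ES[of f g] that fS by (auto simp: G_def)
  \<comment> \<open>The Euler operator of the parameters \<open>G\<close>: it should act on the
    degree \<open>d\<close> part as \<open>d * \<delta>\<close>.\<close>
  define T where "T a = (\<Sum>g\<in>G. g * E g a)" for a
  have dT: "derivation_on B T"
    unfolding T_def using GP dE by (intro derivation_on_combination[OF sub]) auto
  have TS: "T p = (if p \<in> G then \<delta> * p else 0)" if "p \<in> S" for p
  proof -
    have "T p = (\<Sum>g\<in>G. if g = p then p * \<delta> else 0)"
      unfolding T_def using ES that GS by (intro sum.cong) auto
    then show ?thesis using fG by (simp add: mult.commute)
  qed
  let ?f = "filt B P F"
  note I = ideal_filt[OF F(2)] and Sat = saturated_filt[OF F(2)]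
  have T_filt: "T x \<in> ?f (Suc d)" if "\<And>g. g \<in> G \<Longrightarrow> E g x \<in> ?f d" for x d
    unfolding T_def using that GP by (intro ideal_in_sum[OF I] filt_Suc_mult[OF F(2)]) auto
  have TP: "T x \<in> P" if "x \<in> B" for x
    unfolding T_def using GP by (auto intro!: prime_id_sum[OF prime] prime_id_mult_right[OF prime])
  have \<delta>: "\<delta> \<in> B" "\<delta> \<notin> P" using M(1) by auto
  \<comment> \<open>The Euler relation of degree \<open>d\<close> defines a saturated ideal, because
    \<open>T\<close> maps \<open>B\<close> into \<open>P\<close> and the error terms
    \<open>T c * x\<close> therefore lie one step deeper. Hence it can be tested on
    generators.\<close>
  have Tsat: "saturated B P {a \<in> ?f d. T a - of_nat d * \<delta> * a \<in> ?f (Suc d)}" for d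
    unfolding saturated_def ideal_in_def
  proof (intro conjI ballI impI)
    let ?J = "{a \<in> ?f d. T a - of_nat d * \<delta> * a \<in> ?f (Suc d)}"
    show "?J \<subseteq> B" using filt_subset[OF F(2)] by blast
    show "0 \<in> ?J" using ideal_inD(2)[OF I] by (simp add: derivation_zero[OF dT])
    fix x y assume "x \<in> ?J" "y \<in> ?J"
    then have "x + y \<in> ?f d" "(T x - of_nat d * \<delta> * x) + (T y - of_nat d * \<delta> * y) \<in> ?f (Suc d)"
      using ideal_inD(3)[OF I] by auto
    then show "x + y \<in> ?J" by (simp add: derivation_add[OF dT] algebra_simps)
  next
    let ?J = "{a \<in> ?f d. T a - of_nat d * \<delta> * a \<in> ?f (Suc d)}"
    fix c x assume c: "c \<in> B" and x: "x \<in> ?J"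
    have "T c * x \<in> ?f (Suc d)"
      using x TP[OF c] derivation_closed[OF dT c] by (intro filt_Suc_mult[OF F(2)]) auto
    moreover have "c * (T x - of_nat d * \<delta> * x) \<in> ?f (Suc d)" using x c ideal_inD(4)[OF I] by auto
    ultimately have "c * (T x - of_nat d * \<delta> * x) + T c * x \<in> ?f (Suc d)" using ideal_inD(3)[OF I] by blast
    moreover have "T (c * x) - of_nat d * \<delta> * (c * x) = c * (T x - of_nat d * \<delta> * x) + T c * x"
      by (simp add: derivation_mult[OF dT] algebra_simps)
    moreover have "c * x \<in> ?f d" using ideal_inD(4)[OF I c] x by blast
    ultimately show "c * x \<in> ?J" by simp
  next
    let ?J = "{a \<in> ?f d. T a - of_nat d * \<delta> * a \<in> ?f (Suc d)}"
    fix x s assume x: "x \<in> B" "s \<in> B - P" "s * x \<in> ?J"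
    have xd: "x \<in> ?f d" using saturatedD[OF Sat x(1)] x by blast
    have "T s * x \<in> ?f (Suc d)"
      using xd x TP derivation_closed[OF dT, of s] by (intro filt_Suc_mult[OF F(2)]) auto
    then have "(T (s * x) - of_nat d * \<delta> * (s * x)) - T s * x \<in> ?f (Suc d)"
      by (rule ideal_in_diff[OF sub I, rotated]) (use x in auto)
    then have sT: "s * (T x - of_nat d * \<delta> * x) \<in> ?f (Suc d)"
      by (simp add: derivation_mult[OF dT] algebra_simps)
    have "T x - of_nat d * \<delta> * x \<in> B"
      by (intro subring_set_diff[OF sub] subring_set_mult[OF sub] derivation_closed[OF dT]
          subring_set_of_nat[OF sub] \<delta> x(1))
    from saturatedD[OF Sat this _ _ sT] have "T x - of_nat d * \<delta> * x \<in> ?f (Suc d)"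
      using x(2) by blast
    then show "x \<in> ?J" using xd by blast
  qed
  have f1: "?f 1 = P \<inter> B" using filt_1[OF F(2)] by simp
  \<comment> \<open>In degree one the relation is clear on \<open>S\<close>. Any other
    \<open>p\<close> is, up to a denominator and an element of order two, a combination of
    \<open>S\<close>.\<close>
  have euler1: "T p - \<delta> * p \<in> ?f 2" if p: "p \<in> P \<inter> B" for p
  proof -
    let ?J = "{a \<in> ?f 1. T a - of_nat 1 * \<delta> * a \<in> ?f (Suc 1)}"
    have J: "ideal_in B ?J" using Tsat[of 1] by (simp only: saturated_def)
    have SJ: "S \<subseteq> ?J"
    proof
      fix s assume s: "s \<in> S"
      then have "s \<in> ?f 1" using fS f1 by auto
      moreover have "T s - of_nat 1 * \<delta> * s \<in> ?f (Suc 1)"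
      proof (cases "s \<in> G")
        case True
        then show ?thesis using TS[OF s] ideal_inD(2)[OF I] by simp
      next
        case False
        then have "s \<in> ?f (Suc 1)" using s filt_gen[OF F(2)] by (simp add: G_def)
        moreover have "- \<delta> \<in> B" using \<delta> subring_set_uminus[OF sub] by blast
        ultimately have "- \<delta> * s \<in> ?f (Suc 1)" using ideal_inD(4)[OF I] by blast
        then show ?thesis using TS[OF s] False by simp
      qed
      ultimately show "s \<in> ?J" by blast
    qed
    have "p \<in> ?J"
    proof (cases "p \<in> S")
      case True
      then show ?thesis using SJ by blast
    next
      case False
      have "\<not> \<S> (insert p S)" using Smax[of "insert p S"] False fS by auto
      then have "\<not> indep B P V (insert p S) (\<lambda>p v. D v p)" using fS p by (auto simp: \<S>_def)
      from not_indep_insert[OF prime fS(1) False fS(4) this]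
      obtain c where c: "\<forall>i\<in>insert p S. c i \<in> B" "c p \<notin> P"
        "\<forall>v\<in>V. c p * D v p + (\<Sum>s\<in>S. c s * D v s) \<in> P" by blast
      \<comment> \<open>The gradient relation forced by maximality of \<open>S\<close> says that all
        derivatives of \<open>b\<close> lie in \<open>P\<close>; then \<open>H\<close> gives it
        order at least two.\<close>
      define b where "b = c p * p + (\<Sum>s\<in>S. c s * s)"
      have bPB: "b \<in> P \<inter> B"
        unfolding b_def using p fS c
        by (auto intro!: prime_id_add[OF prime] prime_id_sum[OF prime] prime_id_mult_left[OF prime]
            subring_set_add[OF sub] subring_set_sum[OF sub] subring_set_mult[OF sub])
      have "D v b \<in> P" if v: "v \<in> V" for v
      proof -
        have "D v b = (c p * D v p + (\<Sum>s\<in>S. c s * D v s)) + (p * D v (c p) + (\<Sum>s\<in>S. s * D v (c s)))"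
          by (simp add: b_def derivation_add[OF D[OF v]] derivation_mult[OF D[OF v]]
              derivation_sum[OF D[OF v]] sum.distrib algebra_simps)
        moreover have "p * D v (c p) + (\<Sum>s\<in>S. s * D v (c s)) \<in> P"
          using p fS by (auto intro!: prime_id_add[OF prime] prime_id_sum[OF prime] prime_id_mult_right[OF prime])
        ultimately show ?thesis using c(3) v prime_id_add[OF prime] by simp
      qed
      from H[OF bPB this] have "b \<in> saturation B P (gen_ideal B {p * q | p q. p \<in> P \<inter> B \<and> q \<in> P \<inter> B})" .
      also have "\<dots> \<subseteq> ?f (Suc 1)"
        unfolding filt.simps(2)[of B P F 1] f1 by (intro sat_mono gen_mono) auto
      finally have b2: "b \<in> ?f (Suc 1)" .
      have "E g b \<in> ?f 1" if "g \<in> G" for g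
        using derivation_filt[OF F(2) dE EF[OF that] b2] by simp
      then have "T b \<in> ?f (Suc 1)" by (rule T_filt)
      moreover have "of_nat 1 * \<delta> * b \<in> ?f (Suc 1)" using b2 \<delta> ideal_inD(4)[OF I] by simp
      ultimately have "b \<in> ?J"
        using bPB f1 ideal_in_diff[OF sub I] by blast
      moreover have "(\<Sum>s\<in>S. c s * s) \<in> ?J"
        using SJ c by (intro ideal_in_sum[OF J] ideal_inD(4)[OF J]) auto
      ultimately have "b - (\<Sum>s\<in>S. c s * s) \<in> ?J" using ideal_in_diff[OF sub J] by blast
      then have "c p * p \<in> ?J" by (simp only: b_def add_diff_cancel_right')
      then show ?thesis using saturatedD[OF Tsat[of 1], of p "c p"] c p by blast
    qed
    then show ?thesis by (simp add: numeral_2_eq_2)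
  qed
  \<comment> \<open>The relation for products follows from the product rule: degree one for the
    factor in \<open>P\<close>, degree \<open>d\<close> for the other.\<close>
  have euler: "?f d \<subseteq> {a \<in> ?f d. T a - of_nat d * \<delta> * a \<in> ?f (Suc d)}" for d
  proof (induction d)
    case 0
    then show ?case using TP derivation_closed[OF dT] by (auto simp: filt_1[OF F(2)])
  next
    case (Suc d)
    show ?case
    proof (rule filt_Suc_least[OF F(2) Tsat])
      show "F \<subseteq> {a \<in> ?f (Suc d). T a - of_nat (Suc d) * \<delta> * a \<in> ?f (Suc (Suc d))}"
      proof
        fix f assume f: "f \<in> F"
        then have "T f = 0" using TS[of f] fS by (auto simp: G_def)
        moreover have "of_nat (Suc d) * \<delta> * f \<in> ?f (Suc (Suc d))"
          by (intro ideal_inD(4)[OF I] filt_gen[OF F(2)] subring_set_mult[OF sub]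
              subring_set_of_nat[OF sub] f \<delta>)
        ultimately show "f \<in> {a \<in> ?f (Suc d). T a - of_nat (Suc d) * \<delta> * a \<in> ?f (Suc (Suc d))}"
          using f filt_gen[OF F(2)] ideal_in_uminus[OF sub I] by simp
      qed
      fix p q assume pq: "p \<in> P" "p \<in> B" "q \<in> ?f d"
      have "p * (T q - of_nat d * \<delta> * q) \<in> ?f (Suc (Suc d))"
        using pq Suc by (intro filt_Suc_mult[OF F(2)]) auto
      moreover have "(T p - \<delta> * p) * q \<in> ?f (Suc (Suc d))"
        using filt_mult[OF F(2) euler1[of p] pq(3)] pq by simp
      ultimately have "p * (T q - of_nat d * \<delta> * q) + (T p - \<delta> * p) * q \<in> ?f (Suc (Suc d))"
        using ideal_inD(3)[OF I] by blast
      also have "p * (T q - of_nat d * \<delta> * q) + (T p - \<delta> * p) * q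
          = T (p * q) - of_nat (Suc d) * \<delta> * (p * q)"
        by (simp add: derivation_mult[OF dT] algebra_simps)
      finally show "p * q \<in> {a \<in> ?f (Suc d). T a - of_nat (Suc d) * \<delta> * a \<in> ?f (Suc (Suc d))}"
        using filt_Suc_mult[OF F(2) pq] by blast
    qed
  qed
  \<comment> \<open>If all \<open>E g x\<close> have order \<open>Suc d\<close>, then
    \<open>T x\<close> has order two more than \<open>d\<close>. By the Euler relation so has
    \<open>Suc d\<close> times \<open>\<delta> * x\<close>, and this multiplier is a
    denominator.\<close>
  have detect: "x \<in> ?f (Suc d)" if x: "x \<in> P \<inter> B" and Ex: "\<And>g. g \<in> G \<Longrightarrow> E g x \<in> ?f d" for x d
    using Ex
  proof (induction d)
    case 0
    then show ?case using x by (simp only: filt_1[OF F(2)])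
  next
    case (Suc d)
    have xd: "x \<in> ?f (Suc d)"
      using Suc filt_Suc_subset[OF F(2), of d] by blast
    then have "T x - of_nat (Suc d) * \<delta> * x \<in> ?f (Suc (Suc d))" using euler[of "Suc d"] by blast
    moreover have Tx: "T x \<in> ?f (Suc (Suc d))" using Suc.prems by (rule T_filt)
    ultimately have "T x - (T x - of_nat (Suc d) * \<delta> * x) \<in> ?f (Suc (Suc d))"
      using ideal_in_diff[OF sub I] by blast
    then have "of_nat (Suc d) * \<delta> * x \<in> ?f (Suc (Suc d))" by simp
    moreover have "of_nat (Suc d) * \<delta> \<in> B - P"
      using \<delta> char[of "Suc d"] subring_set_of_nat[OF sub, of "Suc d"]
      by (auto simp: prime_id_mult_iff[OF prime] simp del: of_nat_Suc intro: subring_set_mult[OF sub])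
    ultimately show ?case using saturatedD[OF Sat] x by blast
  qed
  \<comment> \<open>By Krull's theorem an element outside the saturated ideal leaves the filtration
    at a finite stage; the stage just before is its order.\<close>
  have order: "\<exists>d. x \<in> ?f d - ?f (Suc d)" if x: "x \<in> B" "x \<notin> saturation B P (gen_ideal B F)" for x
  proof -
    obtain d where d: "x \<notin> ?f d" using krull_intersection[OF F(2) N, of x] x by blast
    define e where "e = (LEAST d. x \<notin> ?f d)"
    have e: "x \<notin> ?f e" using d unfolding e_def by (rule LeastI)
    then obtain e' where e': "e = Suc e'" using x by (cases e) auto
    then have "x \<in> ?f e'" using not_less_Least[of e' "\<lambda>d. x \<notin> ?f d"] by (simp add: e_def)
    then show ?thesis using e e' by blast
  qed
  show ?thesis
  proof (rule ccontr)
    assume neg: "\<not> ?thesis"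
    obtain d k where dk: "a \<in> ?f d - ?f (Suc d)" "b \<in> ?f k - ?f (Suc k)"
      using order ab neg by meson
    have "a * b \<notin> ?f (Suc (d + k))"
      by (rule filt_graded_domain[OF F(2) dE EF char detect dk])
    then show False using gen_subset_filt[OF F(2)] ab by blast
  qed
qed

end

section \<open>Polynomials in finitely many variables\<close>

definition polys :: "'v set \<Rightarrow> ('v, 'k::zero) mpol set" where
  "polys V = {p. mpol_vars p \<subseteq> V}"

definition pvar :: "'v \<Rightarrow> ('v, 'k::comm_ring_1) mpol" where
  "pvar v = Poly_Mapping.single (Poly_Mapping.single v 1) 1"

lemma pvar_power: "pvar v ^ k = Poly_Mapping.single (Poly_Mapping.single v k) (1::'k::comm_ring_1)"
proof (induction k)
  case (Suc k)
  have eq: "Poly_Mapping.single v (1::nat) + Poly_Mapping.single v k = Poly_Mapping.single v (Suc k)"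
    by (simp add: single_add[symmetric])
  show ?case unfolding power_Suc Suc.IH unfolding pvar_def mult_single eq by simp
qed simp

lemma prod_single_one:
  "(\<Prod>v\<in>S. Poly_Mapping.single (h v) (1::'k::comm_ring_1)) = Poly_Mapping.single (\<Sum>v\<in>S. h v) 1"
  for h :: "'v \<Rightarrow> ('w \<Rightarrow>\<^sub>0 nat)"
  by (induction S rule: infinite_finite_induct) (auto simp: mult_single)

lemma poly_mapping_sum_singles:
  "p = (\<Sum>m\<in>Poly_Mapping.keys p. Poly_Mapping.single m (Poly_Mapping.lookup p m))"
proof (rule poly_mapping_eqI)
  fix k
  have "Poly_Mapping.lookup (\<Sum>m\<in>Poly_Mapping.keys p. Poly_Mapping.single m (Poly_Mapping.lookup p m)) k
      = (\<Sum>m\<in>Poly_Mapping.keys p. if m = k then Poly_Mapping.lookup p k else 0)"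
    by (auto simp: lookup_sum lookup_single when_def intro!: sum.cong)
  then show "Poly_Mapping.lookup p k
      = Poly_Mapping.lookup (\<Sum>m\<in>Poly_Mapping.keys p. Poly_Mapping.single m (Poly_Mapping.lookup p m)) k"
    by (simp add: in_keys_iff)
qed

lemma single_eq_const_times_pvars:
  "Poly_Mapping.single m c
    = mpol_const c * (\<Prod>v\<in>Poly_Mapping.keys m. pvar v ^ Poly_Mapping.lookup m v)"
  unfolding pvar_power prod_single_one poly_mapping_sum_singles[of m, symmetric]
  by (simp add: mpol_const_def mult_single)

lemma mpol_const_add: "mpol_const (a + b) = mpol_const a + mpol_const b"
  and mpol_const_mult: "mpol_const (a * b) = mpol_const a * mpol_const b"
  and mpol_const_0: "mpol_const 0 = 0"
  and mpol_const_1: "mpol_const 1 = 1"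
  for a b :: "'k::comm_ring_1"
  by (simp_all add: mpol_const_def single_add mult_single)

lemma mpol_const_of_nat: "mpol_const (of_nat n) = (of_nat n :: ('v, 'k::comm_ring_1) mpol)"
  by (induction n) (simp_all add: mpol_const_add mpol_const_0 mpol_const_1)

lemma mpol_add_induct:
  fixes p :: "('v, 'k::comm_ring_1) mpol"
  assumes "\<And>m c. Q (Poly_Mapping.single m c)" "\<And>p q. Q p \<Longrightarrow> Q q \<Longrightarrow> Q (p + q)"
  shows "Q p"
proof -
  have Q0: "Q 0" using assms(1)[of 0 0] by simp
  have "Q (\<Sum>m\<in>M. Poly_Mapping.single m (c m))" if "finite M" for M c
    using that by (induction M rule: finite_induct) (auto intro: assms Q0)
  then show ?thesis using poly_mapping_sum_singles[of p] by (metis finite_keys)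
qed

lemma polys_const: "mpol_const c \<in> polys V"
  by (auto simp: polys_def mpol_vars_def mpol_const_def split: if_splits)

lemma polys_1: "(1 :: ('v, 'k::comm_ring_1) mpol) \<in> polys V"
  using polys_const[of "1::'k" V] by (simp add: mpol_const_1)

lemma polys_0: "(0 :: ('v, 'k::comm_ring_1) mpol) \<in> polys V"
  using polys_const[of "0::'k" V] by (simp add: mpol_const_0)

lemma polys_pvar: "v \<in> V \<Longrightarrow> pvar v \<in> polys V"
  by (auto simp: polys_def mpol_vars_def pvar_def split: if_splits)

lemma polys_add: "p \<in> polys V \<Longrightarrow> q \<in> polys V \<Longrightarrow> p + q \<in> polys V"
  by (auto simp: polys_def mpol_vars_def dest!: subsetD[OF keys_add])

lemma polys_mult:
  fixes p :: "('v, 'k::comm_ring_1) mpol"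
  assumes "p \<in> polys V" "q \<in> polys V"
  shows "p * q \<in> polys V"
proof -
  have "Poly_Mapping.keys m \<subseteq> V" if m: "m \<in> Poly_Mapping.keys (p * q)" for m
  proof -
    from m keys_mult[of p q] obtain a b
      where "a \<in> Poly_Mapping.keys p" "b \<in> Poly_Mapping.keys q" "m = a + b" by blast
    then show ?thesis using assms
      by (auto simp: polys_def mpol_vars_def dest!: subsetD[OF keys_add])
  qed
  then show ?thesis by (auto simp: polys_def mpol_vars_def)
qed

lemma subring_set_polys: "subring_set (polys V :: ('v, 'k::comm_ring_1) mpol set)"
  unfolding subring_set_def
proof (intro conjI ballI)
  show "(1 :: ('v, 'k) mpol) \<in> polys V" by (rule polys_1)
  fix p q :: "('v, 'k) mpol" assume pq: "p \<in> polys V" "q \<in> polys V"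
  have "mpol_const (- 1) + mpol_const 1 = (0 :: ('v, 'k) mpol)"
    by (simp add: mpol_const_add[symmetric] mpol_const_0)
  then have "mpol_const (- 1) = (- 1 :: ('v, 'k) mpol)"
    by (simp add: mpol_const_1 eq_neg_iff_add_eq_0)
  then have "p - q = p + mpol_const (- 1) * q" by simp
  also have "\<dots> \<in> polys V" using pq by (intro polys_add polys_mult polys_const)
  finally show "p - q \<in> polys V" .
  show "p * q \<in> polys V" using pq by (rule polys_mult)
qed

lemma polys_mono: "V \<subseteq> W \<Longrightarrow> polys V \<subseteq> polys W"
  by (auto simp: polys_def)

lemma polys_UNIV: "polys UNIV = UNIV"
  by (auto simp: polys_def)

lemma finite_mpol_vars: "finite (mpol_vars p)"
  by (simp add: mpol_vars_def)

text \<open>Allows compatibility with ring operations to be tested on constants and variables,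
  without sums over monomials.\<close>

lemma polys_induct [consumes 1, case_names const pvar add mult]:
  fixes p :: "('v, 'k::comm_ring_1) mpol"
  assumes p: "p \<in> polys V" and const: "\<And>c. Q (mpol_const c)" and var: "\<And>v. v \<in> V \<Longrightarrow> Q (pvar v)"
    and add: "\<And>p q. p \<in> polys V \<Longrightarrow> q \<in> polys V \<Longrightarrow> Q p \<Longrightarrow> Q q \<Longrightarrow> Q (p + q)"
    and mult: "\<And>p q. p \<in> polys V \<Longrightarrow> q \<in> polys V \<Longrightarrow> Q p \<Longrightarrow> Q q \<Longrightarrow> Q (p * q)"
  shows "Q p"
proof -
  let ?R = "\<lambda>p. p \<in> polys V \<and> Q p"
  have power: "?R (pvar v ^ n)" if "v \<in> V" for v n
    by (induction n) (use that var mult const[of 1] in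
      \<open>auto simp: mpol_const_1 polys_1 intro: polys_mult polys_pvar\<close>)
  have prod: "?R (\<Prod>v\<in>S. pvar v ^ h v)" if "finite S" "S \<subseteq> V" for S h
    using that
    by (induction S rule: finite_induct)
      (use power mult const[of 1] in \<open>auto simp: mpol_const_1 polys_1 intro: polys_mult\<close>)
  have single: "?R (Poly_Mapping.single m c)" if "Poly_Mapping.keys m \<subseteq> V" for m c
    unfolding single_eq_const_times_pvars
    using prod[OF finite_keys that] mult const polys_const polys_mult by blast
  have "?R (\<Sum>m\<in>M. Poly_Mapping.single m (c m))" if "finite M" "\<And>m. m \<in> M \<Longrightarrow> Poly_Mapping.keys m \<subseteq> V" for M c
    using that
    by (induction M rule: finite_induct)
      (use single add const[of 0] in \<open>auto simp: mpol_const_0 polys_0 intro: polys_add\<close>)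
  from this[of "Poly_Mapping.keys p" "Poly_Mapping.lookup p"] show ?thesis
    using p by (simp add: poly_mapping_sum_singles[symmetric] polys_def mpol_vars_def UN_subset_iff)
qed

lemma mpol_deriv_superset:
  fixes p :: "('v, 'k::comm_ring_1) mpol"
  assumes "finite M" "Poly_Mapping.keys p \<subseteq> M"
  shows "mpol_deriv v p = (\<Sum>m\<in>M. Poly_Mapping.single (m - Poly_Mapping.single v 1)
    (of_nat (Poly_Mapping.lookup m v) * Poly_Mapping.lookup p m))"
  unfolding mpol_deriv_def
  by (rule sum.mono_neutral_left) (use assms in \<open>auto simp: in_keys_iff\<close>)

lemma mpol_deriv_add: "mpol_deriv v (p + q) = mpol_deriv v p + mpol_deriv v q"
proof -
  let ?M = "Poly_Mapping.keys p \<union> Poly_Mapping.keys q"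
  have "mpol_deriv v p + mpol_deriv v q
      = (\<Sum>m\<in>?M. Poly_Mapping.single (m - Poly_Mapping.single v 1)
          (of_nat (Poly_Mapping.lookup m v) * Poly_Mapping.lookup (p + q) m))"
    by (subst (1 2) mpol_deriv_superset[of ?M])
      (auto simp: sum.distrib[symmetric] single_add[symmetric] lookup_add distrib_left)
  then show ?thesis using keys_add[of p q] by (subst mpol_deriv_superset[of ?M]) auto
qed

lemma mpol_deriv_single:
  "mpol_deriv v (Poly_Mapping.single m c)
    = Poly_Mapping.single (m - Poly_Mapping.single v 1) (of_nat (Poly_Mapping.lookup m v) * c)"
  by (subst mpol_deriv_superset[of "{m}"]) auto

lemma mpol_deriv_single_mult:
  fixes c d :: "'k::comm_ring_1" and m n :: "'v \<Rightarrow>\<^sub>0 nat"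
  shows "mpol_deriv v (Poly_Mapping.single m c * Poly_Mapping.single n d)
    = Poly_Mapping.single m c * mpol_deriv v (Poly_Mapping.single n d)
      + Poly_Mapping.single n d * mpol_deriv v (Poly_Mapping.single m c)"
proof -
  have eq: "Poly_Mapping.single (a + (b - Poly_Mapping.single v 1)) (of_nat (Poly_Mapping.lookup b v) * e)
      = Poly_Mapping.single (a + b - Poly_Mapping.single v 1) (of_nat (Poly_Mapping.lookup b v) * e)"
    for a b :: "'v \<Rightarrow>\<^sub>0 nat" and e :: 'k
  proof (cases "Poly_Mapping.lookup b v = 0")
    case False
    then have "a + (b - Poly_Mapping.single v 1) = a + b - Poly_Mapping.single v 1"
      by (intro poly_mapping_eqI) (auto simp: lookup_add lookup_minus lookup_single when_def)
    then show ?thesis by simp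
  qed simp
  have "mpol_deriv v (Poly_Mapping.single m c * Poly_Mapping.single n d)
      = Poly_Mapping.single (m + n - Poly_Mapping.single v 1) (of_nat (Poly_Mapping.lookup n v) * (c * d))
      + Poly_Mapping.single (n + m - Poly_Mapping.single v 1) (of_nat (Poly_Mapping.lookup m v) * (c * d))"
    by (simp add: mult_single mpol_deriv_single lookup_add single_add[symmetric] algebra_simps)
  then show ?thesis
    unfolding mult_single mpol_deriv_single eq[symmetric] by (simp add: ac_simps)
qed

lemma mpol_deriv_mult: "mpol_deriv v (p * q) = p * mpol_deriv v q + q * mpol_deriv v p"
proof (induction p rule: mpol_add_induct)
  case (1 m c)
  show ?case
    by (induction q rule: mpol_add_induct)
      (simp_all only: mpol_deriv_single_mult distrib_left distrib_right mpol_deriv_add ac_simps)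
next
  case (2 p1 p2)
  then show ?case by (simp add: distrib_left distrib_right mpol_deriv_add ac_simps)
qed

lemma mpol_deriv_const: "mpol_deriv v (mpol_const c) = 0"
  by (simp add: mpol_const_def mpol_deriv_single)

lemma mpol_deriv_pvar: "mpol_deriv v (pvar u) = (if u = v then 1 else 0)"
  by (auto simp: pvar_def mpol_deriv_single lookup_single when_def)

lemma mpol_deriv_polys: "p \<in> polys V \<Longrightarrow> mpol_deriv v p \<in> polys V"
proof (induction rule: polys_induct)
  case (pvar u)
  then show ?case by (simp add: mpol_deriv_pvar polys_0 polys_1)
qed (auto simp: mpol_deriv_const polys_0 mpol_deriv_add mpol_deriv_mult intro: polys_add polys_mult)

lemma mpol_deriv_notin: "p \<in> polys V \<Longrightarrow> v \<notin> V \<Longrightarrow> mpol_deriv v p = 0"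
  by (induction rule: polys_induct)
    (auto simp: mpol_deriv_const mpol_deriv_pvar mpol_deriv_add mpol_deriv_mult)

lemma derivation_on_mpol_deriv: "derivation_on (polys V) (mpol_deriv v)"
  by (auto simp: derivation_on_def mpol_deriv_add mpol_deriv_mult intro: mpol_deriv_polys)

text \<open>Reduces a new variable to the one-element theory of \<open>adjoin\<close>: this is how
  the Hilbert basis theorem and division in one variable apply to \<open>polys V\<close>.\<close>

lemma polys_insert: "polys (insert v V) = adjoin (polys V) (pvar v :: ('v, 'k::comm_ring_1) mpol)"
proof
  have A: "subring_set (adjoin (polys V) (pvar v :: ('v, 'k) mpol))"
    by (rule subring_set_adjoin[OF subring_set_polys])
  show "polys (insert v V) \<subseteq> adjoin (polys V) (pvar v :: ('v, 'k) mpol)"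
  proof
    fix p :: "('v, 'k) mpol" assume "p \<in> polys (insert v V)"
    then show "p \<in> adjoin (polys V) (pvar v)"
      by (induction rule: polys_induct)
        (auto intro: subring_set_add[OF A] subring_set_mult[OF A] adjoin_var[OF subring_set_polys]
          adjoin_base[OF subring_set_polys] polys_const polys_pvar)
  qed
  have "b \<in> polys (insert v V)" if "b \<in> polys V" for b :: "('v, 'k) mpol"
    using that polys_mono[of V "insert v V"] by blast
  then show "adjoin (polys V) (pvar v :: ('v, 'k) mpol) \<subseteq> polys (insert v V)"
    by (auto simp: adjoin_def poly_below_def
        intro!: subring_set_sum[OF subring_set_polys] polys_mult
          subring_set_power[OF subring_set_polys] polys_pvar)
qed

lemma polys_empty_const:
  fixes p :: "('v, 'k::comm_ring_1) mpol"
  assumes "p \<in> polys {}"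
  shows "\<exists>c. p = mpol_const c"
  using assms by (induction rule: polys_induct) (auto simp: mpol_const_add[symmetric] mpol_const_mult[symmetric])

lemma noeth_polys: "finite V \<Longrightarrow> noetherian (polys V :: ('v, 'k::field) mpol set)"
proof (induction V rule: finite_induct)
  case empty
  show ?case
  proof (rule noeth_field[OF subring_set_polys])
    fix p :: "('v, 'k) mpol" assume p: "p \<in> polys {}" "p \<noteq> 0"
    then obtain c where c: "p = mpol_const c" using polys_empty_const by blast
    then have "c \<noteq> 0" using p by (auto simp: mpol_const_0)
    then have "p * mpol_const (inverse c) = 1"
      by (simp add: c mpol_const_mult[symmetric] mpol_const_1)
    then show "\<exists>q\<in>polys {}. p * q = 1" using polys_const by blast
  qed
next
  case (insert v V)
  then show ?case unfolding polys_insert by (intro noeth_adjoin subring_set_polys)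
qed

lemma prime_id_const:
  assumes P: "prime_id (P :: ('v, 'k::field) mpol set)" and "c \<noteq> 0"
  shows "mpol_const c \<notin> P"
proof
  assume "mpol_const c \<in> P"
  then have "mpol_const (inverse c) * mpol_const c \<in> P" by (rule prime_id_mult_left[OF P])
  then show False using assms by (simp add: mpol_const_mult[symmetric] mpol_const_1 prime_id_one)
qed

lemma prime_id_of_nat:
  assumes "prime_id (P :: ('v, 'k::field_char_0) mpol set)" "n > 0"
  shows "of_nat n \<notin> P"
  using prime_id_const[OF assms(1), of "of_nat n"] assms(2) by (simp add: mpol_const_of_nat)

section \<open>Triangular systems\<close>

lemma poly_below_derivation:
  assumes B: "subring_set B" and E: "derivation_on UNIV E" and EB: "\<And>b. b \<in> B \<Longrightarrow> E b = 0" and Ex: "E x = 1"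
  shows "a \<in> poly_below B x (Suc n) \<Longrightarrow> E a \<in> poly_below B x n"
proof (induction n arbitrary: a)
  case 0
  then show ?case
    using EB by (auto simp: poly_below_def)
next
  case (Suc n)
  from Suc.prems obtain c r where cr: "c \<in> B" "r \<in> poly_below B x (Suc n)" "a = c * x ^ Suc n + r"
    by (rule poly_below_SucE[OF B])
  have "E a = (c * of_nat (Suc n)) * x ^ n + E r"
    unfolding cr(3) derivation_add[OF E] derivation_mult[OF E] derivation_power[OF E]
    by (simp add: EB[OF cr(1)] Ex mult.assoc)
  then show ?case
    using Suc.IH[OF cr(2)] cr(1) B
    by (auto intro!: poly_below_SucI subring_set_intros[OF B] simp del: of_nat_Suc)
qed

lemma poly_below_derivation_iter:
  assumes B: "subring_set B" and E: "derivation_on UNIV E" and EB: "\<And>b. b \<in> B \<Longrightarrow> E b = 0" and Ex: "E x = 1"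
    and c: "c \<in> B"
  shows "r \<in> poly_below B x n \<Longrightarrow> (E ^^ n) (c * x ^ n + r) = of_nat (fact n) * c"
  using c
proof (induction n arbitrary: r c)
  case 0
  then show ?case by (auto simp: poly_below_0[OF B])
next
  case (Suc n)
  have "E (c * x ^ Suc n + r) = (of_nat (Suc n) * c) * x ^ n + E r"
    unfolding derivation_add[OF E] derivation_mult[OF E] derivation_power[OF E]
    by (simp add: EB[OF Suc.prems(2)] Ex ac_simps)
  then have "(E ^^ Suc n) (c * x ^ Suc n + r) = (E ^^ n) ((of_nat (Suc n) * c) * x ^ n + E r)"
    by (simp add: funpow_Suc_right del: funpow.simps)
  also have "\<dots> = of_nat (fact n) * (of_nat (Suc n) * c)"
    using Suc.prems B
    by (intro Suc.IH poly_below_derivation[OF B E EB Ex]) (auto intro: subring_set_intros)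
  finally show ?case by (simp add: algebra_simps)
qed

text \<open>Up to a factorial, the leading coefficient is the top derivative.\<close>

lemma poly_below_coeffs_in_prime:
  assumes B: "subring_set B" and P: "prime_id P" and char: "\<And>n. n > 0 \<Longrightarrow> of_nat n \<notin> P"
    and E: "derivation_on UNIV E" and EB: "\<And>b. b \<in> B \<Longrightarrow> E b = 0" and Ex: "E x = 1"
    and closed: "\<And>h. h \<in> P \<Longrightarrow> h \<in> poly_below B x n \<Longrightarrow> E h \<in> P"
  shows "g \<in> P \<Longrightarrow> g \<in> poly_below B x n \<Longrightarrow> \<exists>c. (\<forall>d. c d \<in> P \<inter> B) \<and> g = (\<Sum>d<n. c d * x ^ d)"
  using closed
proof (induction n arbitrary: g)
  case 0
  then show ?case using prime_id_zero[OF P] subring_set_zero[OF B]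
    by (auto simp: poly_below_0[OF B])
next
  case (Suc n)
  from Suc.prems(2) obtain a r where ar: "a \<in> B" "r \<in> poly_below B x n" "g = a * x ^ n + r"
    by (rule poly_below_SucE[OF B])
  note closed = Suc.prems(3)
  have "(E ^^ i) g \<in> P \<and> (E ^^ i) g \<in> poly_below B x (Suc n)" for i
  proof (induction i)
    case (Suc i)
    then show ?case using closed poly_below_derivation[OF B E EB Ex] poly_below_Suc[OF B] by simp
  qed (use Suc.prems in simp)
  then have "of_nat (fact n) * a \<in> P"
    using poly_below_derivation_iter[OF B E EB Ex ar(1,2)] ar(3) by metis
  then have a: "a \<in> P" using char[of "fact n"] by (simp add: prime_id_mult_iff[OF P])
  have "r \<in> P" using Suc.prems(1) prime_id_diff[OF P, of g "a * x ^ n"] prime_id_mult_right[OF P a] ar(3) by simp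
  then obtain c where c: "\<forall>d. c d \<in> P \<inter> B" "r = (\<Sum>d<n. c d * x ^ d)"
    using Suc.IH[OF _ ar(2)] Suc.prems(3) poly_below_Suc[OF B] by blast
  have "g = (\<Sum>d<Suc n. (c(n := a)) d * x ^ d)" using c ar(3) by (simp add: add.commute)
  then show ?case using c a ar(1) by (intro exI[of _ "c(n := a)"]) auto
qed

text \<open>Cancelling the top term of \<open>f\<close> against \<open>g\<close> multiplies
  \<open>f\<close> by the leading coefficient \<open>c\<close>, which stays a denominator because
  \<open>c \<notin> P\<close>.\<close>

lemma poly_below_pseudo_division:
  assumes B: "subring_set B" and P: "prime_id P"
    and g: "g = c * x ^ m + r" "c \<in> B" "c \<notin> P" "r \<in> poly_below B x m"
  shows "f \<in> poly_below B x k \<Longrightarrow>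
    \<exists>s\<in>B - P. \<exists>q\<in>adjoin B x. \<exists>t\<in>poly_below B x m. s * f = q * g + t"
proof (induction k arbitrary: f)
  case 0
  then show ?case
    using subring_set_one[OF B] prime_id_one[OF P] poly_below_zero[OF B]
      subring_set_zero[OF subring_set_adjoin[OF B]]
    by (auto simp: poly_below_0[OF B] intro!: bexI[of _ 1] bexI[of _ 0])
next
  case (Suc k)
  note A = subring_set_adjoin[OF B]
  show ?case
  proof (cases "Suc k \<le> m")
    case True
    then have "f \<in> poly_below B x m" using Suc.prems poly_below_le[OF B] by blast
    then show ?thesis
      using subring_set_one[OF B] prime_id_one[OF P] subring_set_zero[OF A]
      by (intro bexI[of _ 1] bexI[of _ 0] bexI[of _ f]) auto
  next
    case False
    from Suc.prems obtain a f' where f: "a \<in> B" "f' \<in> poly_below B x k" "f = a * x ^ k + f'"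
      by (rule poly_below_SucE[OF B])
    have xk: "x ^ k = x ^ (k - m) * x ^ m" using False by (simp flip: power_add)
    have eq: "c * f - a * x ^ (k - m) * g = c * f' + (- a) * (x ^ (k - m) * r)"
      unfolding f g xk by (simp add: algebra_simps)
    have xr: "x ^ (k - m) * r \<in> poly_below B x k"
      using poly_below_mult_power[OF B g(4), of "k - m"] False by simp
    have "c * f - a * x ^ (k - m) * g \<in> poly_below B x k"
      unfolding eq
      by (rule poly_below_add[OF B poly_below_smult[OF B g(2) f(2)]
            poly_below_smult[OF B subring_set_uminus[OF B f(1)] xr]])
    from Suc.IH[OF this] obtain s q t where sqt: "s \<in> B - P" "q \<in> adjoin B x" "t \<in> poly_below B x m"
      "s * (c * f - a * x ^ (k - m) * g) = q * g + t" by blast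
    have "(s * c) * f = (q + s * a * x ^ (k - m)) * g + t"
      using sqt(4) by (simp add: algebra_simps)
    moreover have "s * c \<in> B - P" using sqt g B by (auto simp: prime_id_mult_iff[OF P] intro: subring_set_mult)
    moreover have "q + s * a * x ^ (k - m) \<in> adjoin B x"
      using sqt f by (intro subring_set_add[OF A] subring_set_mult[OF A] subring_set_power[OF A])
        (auto intro: adjoin_base[OF B] adjoin_var[OF B])
    ultimately show ?thesis using sqt by blast
  qed
qed

text \<open>In characteristic zero this says that, modulo \<open>P\<close>, the variable \<open>v\<close> is algebraic over the
  variables in \<open>V\<close>.\<close>

definition alg_over :: "('v, 'k::field_char_0) mpol set \<Rightarrow> 'v set \<Rightarrow> 'v \<Rightarrow> bool" where
  "alg_over P V v \<longleftrightarrow> (\<exists>g\<in>P \<inter> polys (insert v V). mpol_deriv v g \<notin> P)"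

definition grad_indep :: "('v, 'k::field_char_0) mpol set \<Rightarrow> 'v set \<Rightarrow> ('v, 'k) mpol set \<Rightarrow> bool" where
  "grad_indep P V G \<longleftrightarrow> indep UNIV P V G (\<lambda>p v. mpol_deriv v p)"

lemma grad_indep_mono: "grad_indep P V G \<Longrightarrow> V \<subseteq> W \<Longrightarrow> grad_indep P W G"
  unfolding grad_indep_def by (rule indep_mono)

text \<open>\<open>G\<close> is a regular system of parameters for the local ring of
  \<open>polys V\<close> at \<open>P\<close>; its size is the height of
  \<open>P \<inter> polys V\<close>, that is, the rank over \<kappa> of the gradients of the
  elements of \<open>P \<inter> polys V\<close>.\<close>

definition triangular :: "('v, 'k::field_char_0) mpol set \<Rightarrow> 'v set \<Rightarrow> ('v, 'k) mpol set \<Rightarrow> bool" where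
  "triangular P V G \<longleftrightarrow> finite V \<and> finite G \<and> G \<subseteq> P \<inter> polys V \<and> grad_indep P V G \<and>
    P \<inter> polys V \<subseteq> saturation (polys V) P (gen_ideal (polys V) G)"

context
  fixes P :: "('v, 'k::field_char_0) mpol set"
  assumes P: "prime_id P"
begin

interpretation pv: prime_over_subring "polys V" P for V
  by unfold_locales (rule subring_set_polys, rule P)

lemma triangular_empty: "triangular P {} {}"
proof -
  have "P \<inter> polys {} \<subseteq> {0}"
  proof
    fix p assume p: "p \<in> P \<inter> polys {}"
    then obtain c where "p = mpol_const c" using polys_empty_const by blast
    then show "p \<in> {0}" using p prime_id_const[OF P, of c] by (cases "c = 0") (auto simp: mpol_const_0)
  qed
  moreover have "0 \<in> saturation (polys {}) P (gen_ideal (polys {}) {})"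
    using pv.sat_incl[OF ideal_in_gen[OF subring_set_polys empty_subsetI]] gen_ideal.zero by blast
  ultimately show ?thesis by (auto simp: triangular_def grad_indep_def indep_def)
qed

text \<open>If differentiation by \<open>v\<close> never leaves \<open>P\<close>, then repeated
  differentiation isolates coefficients: in this case the prime is extended from
  \<open>polys V\<close>.\<close>

lemma nonalg_coeffs:
  assumes "v \<notin> V" "\<not> alg_over P V v" "g \<in> P" "g \<in> polys (insert v V)"
  shows "\<exists>n c. (\<forall>d. c d \<in> P \<inter> polys V) \<and> g = (\<Sum>d<n. c d * pvar v ^ d)"
proof -
  obtain n where n: "g \<in> poly_below (polys V) (pvar v) n"
    using assms(4) by (auto simp: polys_insert adjoin_def)
  have "\<exists>c. (\<forall>d. c d \<in> P \<inter> polys V) \<and> g = (\<Sum>d<n. c d * pvar v ^ d)"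
  proof (rule poly_below_coeffs_in_prime[OF subring_set_polys P prime_id_of_nat[OF P] _ _ _ _ assms(3) n])
    show "derivation_on UNIV (mpol_deriv v)" using derivation_on_mpol_deriv[of UNIV] by (simp add: polys_UNIV)
    show "mpol_deriv v b = 0" if "b \<in> polys V" for b using that assms(1) by (rule mpol_deriv_notin)
    show "mpol_deriv v (pvar v) = 1" by (simp add: mpol_deriv_pvar)
    show "mpol_deriv v h \<in> P" if "h \<in> P" "h \<in> poly_below (polys V) (pvar v) n" for h
      using that assms(2) by (auto simp: alg_over_def polys_insert adjoin_def)
  qed
  then show ?thesis by blast
qed

lemma sat_polys_mono:
  assumes "V \<subseteq> W" "G \<subseteq> H"
  shows "saturation (polys V) P (gen_ideal (polys V) G) \<subseteq> saturation (polys W) P (gen_ideal (polys W) H)"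
  using polys_mono[OF assms(1)] gen_mono[OF polys_mono[OF assms(1)] assms(2)] unfolding saturation_def by blast

lemma triangular_sat_coeffs:
  assumes triangular: "triangular P V G" and H: "G \<subseteq> H" "H \<subseteq> polys (insert v V)" and c: "\<forall>d. c d \<in> P \<inter> polys V"
  shows "(\<Sum>d<n. c d * pvar v ^ d) \<in> saturation (polys (insert v V)) P (gen_ideal (polys (insert v V)) H)"
proof -
  have I: "ideal_in (polys (insert v V)) (saturation (polys (insert v V)) P (gen_ideal (polys (insert v V)) H))"
    using pv.saturated_sat[OF ideal_in_gen[OF subring_set_polys H(2)]] by (simp add: saturated_def)
  have "saturation (polys V) P (gen_ideal (polys V) G) \<subseteq> saturation (polys (insert v V)) P (gen_ideal (polys (insert v V)) H)"
    using H by (intro sat_polys_mono) auto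
  moreover have "c d \<in> saturation (polys V) P (gen_ideal (polys V) G)" for d
    using c triangular unfolding triangular_def by blast
  ultimately have "c d \<in> saturation (polys (insert v V)) P (gen_ideal (polys (insert v V)) H)" for d
    by blast
  then show ?thesis
    by (intro ideal_in_sum[OF I] ideal_inD(5)[OF I] subring_set_power[OF subring_set_polys] polys_pvar) auto
qed

lemma triangular_step_nonalg:
  assumes "triangular P V G" "v \<notin> V" "\<not> alg_over P V v"
  shows "triangular P (insert v V) G"
proof -
  have G: "G \<subseteq> polys (insert v V)" using assms(1) polys_mono[of V "insert v V"] by (auto simp: triangular_def)
  have "g \<in> saturation (polys (insert v V)) P (gen_ideal (polys (insert v V)) G)" if g: "g \<in> P \<inter> polys (insert v V)" for g
    using nonalg_coeffs[OF assms(2,3), of g] triangular_sat_coeffs[OF assms(1) subset_refl G] g by blast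
  moreover have "grad_indep P (insert v V) G"
    using assms(1) grad_indep_mono[of P V G "insert v V"] by (auto simp: triangular_def)
  ultimately show ?thesis using assms(1) G by (auto simp: triangular_def)
qed

text \<open>The matrix of gradients is block triangular: no member of \<open>G\<close> involves
  \<open>v\<close>, whereas \<open>g\<close> has an entry outside \<open>P\<close> in that
  column.\<close>

lemma grad_indep_insert:
  assumes "finite G" "G \<subseteq> polys V" "v \<notin> V" "v \<in> W'" "W \<subseteq> W'" "grad_indep P W G" "mpol_deriv v g \<notin> P"
  shows "grad_indep P W' (insert g G)" "g \<notin> G"
proof -
  show gG: "g \<notin> G"
    using assms(2,3,7) mpol_deriv_notin prime_id_zero[OF P] by (metis subsetD)
  show "grad_indep P W' (insert g G)"
    unfolding grad_indep_def indep_def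
  proof (intro allI impI)
    fix c assume c: "\<forall>u\<in>W'. (\<Sum>p\<in>insert g G. c p * mpol_deriv u p) \<in> P"
    have "(\<Sum>p\<in>G. c p * mpol_deriv v p) = 0"
      using assms(2,3) by (intro sum.neutral) (auto simp: mpol_deriv_notin)
    then have "c g * mpol_deriv v g \<in> P" using bspec[OF c assms(4)] assms(1) gG by simp
    then have cg: "c g \<in> P" using assms(7) by (simp add: prime_id_mult_iff[OF P])
    have "(\<Sum>p\<in>G. c p * mpol_deriv u p) \<in> P" if u: "u \<in> W" for u
    proof -
      have "c g * mpol_deriv u g + (\<Sum>p\<in>G. c p * mpol_deriv u p) \<in> P" using c u assms(1,5) gG by auto
      from prime_id_diff[OF P this prime_id_mult_right[OF P cg, of "mpol_deriv u g"]]
      show ?thesis by simp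
    qed
    then have "\<forall>p\<in>G. c p \<in> P" using assms(6) by (simp add: grad_indep_def indep_def)
    then show "\<forall>p\<in>insert g G. c p \<in> P" using cg by blast
  qed
qed

text \<open>The new generator is a substitute for the minimal polynomial of \<open>v\<close>: an
  element of \<open>P\<close> of least degree in \<open>v\<close> whose derivative by
  \<open>v\<close> stays outside \<open>P\<close>. Division by it leaves remainders that
  \<open>G\<close> already controls.\<close>

lemma triangular_step_alg:
  assumes triangular: "triangular P V G" and v: "v \<notin> V" and alg: "alg_over P V v"
  shows "\<exists>g\<in>P \<inter> polys (insert v V). mpol_deriv v g \<notin> P \<and> g \<notin> G \<and> triangular P (insert v V) (insert g G)"
proof -
  let ?B = "polys V" and ?x = "pvar v :: ('v, 'k) mpol" and ?A = "polys (insert v V)"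
  have A: "?A = adjoin ?B ?x" by (rule polys_insert)
  note B = subring_set_polys[where V = V]
  define Q where "Q n \<longleftrightarrow> (\<exists>g. g \<in> P \<and> g \<in> poly_below ?B ?x n \<and> mpol_deriv v g \<notin> P)" for n
  have "\<exists>n. Q n" using alg by (auto simp: Q_def alg_over_def A adjoin_def)
  define n where "n = (LEAST n. Q n)"
  have "Q n" unfolding n_def using \<open>\<exists>n. Q n\<close> by (rule LeastI_ex)
  then obtain g where g: "g \<in> P" "g \<in> poly_below ?B ?x n" "mpol_deriv v g \<notin> P" by (auto simp: Q_def)
  have "n \<noteq> 0"
  proof
    assume "n = 0"
    then have "g = 0" using g(2) by (simp add: poly_below_0[OF B])
    then show False using g(3) prime_id_zero[OF P] derivation_zero[OF derivation_on_mpol_deriv] by metis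
  qed
  then obtain m where m: "n = Suc m" by (cases n) auto
  have "\<not> Q m" using not_less_Least[of m Q] m by (simp add: n_def)
  then have min: "mpol_deriv v h \<in> P" if "h \<in> P" "h \<in> poly_below ?B ?x m" for h
    using that by (auto simp: Q_def)
  obtain c r where cr: "c \<in> ?B" "r \<in> poly_below ?B ?x m" "g = c * ?x ^ m + r"
    using poly_below_SucE[OF B g(2)[unfolded m]] by blast
  \<comment> \<open>Otherwise the top term could be dropped: \<open>r\<close> would lie in
    \<open>P\<close> with smaller degree, so by minimality its derivative would lie in
    \<open>P\<close>, and so would that of \<open>g\<close>.\<close>
  have cP: "c \<notin> P"
  proof
    assume c: "c \<in> P"
    have "r \<in> P" using prime_id_diff[OF P g(1) prime_id_mult_right[OF P c, of "?x ^ m"]] cr(3) by simp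
    then have "mpol_deriv v r \<in> P" using min cr(2) by blast
    moreover have "mpol_deriv v (c * ?x ^ m) \<in> P"
      using mpol_deriv_notin[OF cr(1) v] prime_id_mult_right[OF P c] by (simp add: mpol_deriv_mult)
    ultimately have "mpol_deriv v g \<in> P" by (simp add: cr(3) mpol_deriv_add prime_id_add[OF P])
    then show False using g(3) by contradiction
  qed
  have gA: "g \<in> P \<inter> ?A" using g by (auto simp: A adjoin_def)
  have G: "finite G" "G \<subseteq> P" "G \<subseteq> ?B" "grad_indep P V G" "finite V" using triangular by (auto simp: triangular_def)
  have GA: "insert g G \<subseteq> ?A" using gA G polys_mono[of V "insert v V"] by auto
  let ?S = "saturation ?A P (gen_ideal ?A (insert g G))"
  have Sat: "saturated ?A P ?S" by (rule pv.saturated_sat[OF ideal_in_gen[OF subring_set_polys GA]])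
  then have I: "ideal_in ?A ?S" by (simp add: saturated_def)
  have gS: "g \<in> ?S"
    using gen_incl[OF subring_set_polys, of g "insert g G"] pv.sat_incl[OF ideal_in_gen[OF subring_set_polys GA]] by blast
  have "f \<in> ?S" if f: "f \<in> P \<inter> ?A" for f
  proof -
    obtain k where "f \<in> poly_below ?B ?x k" using f by (auto simp: A adjoin_def)
    from poly_below_pseudo_division[OF B P cr(3,1) cP cr(2) this]
    obtain s q t where sqt: "s \<in> ?B - P" "q \<in> ?A" "t \<in> poly_below ?B ?x m" "s * f = q * g + t"
      unfolding A by blast
    have "t = s * f - q * g" using sqt(4) by simp
    then have tP: "t \<in> P"
      using f g(1) by (auto intro!: prime_id_diff[OF P] prime_id_mult_left[OF P])
    \<comment> \<open>The remainder has degree below that of \<open>g\<close>, where by minimality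
      derivatives by \<open>v\<close> stay in \<open>P\<close>; hence all its coefficients lie in
      \<open>P\<close>.\<close>
    have "\<exists>c. (\<forall>d. c d \<in> P \<inter> ?B) \<and> t = (\<Sum>d<m. c d * ?x ^ d)"
    proof (rule poly_below_coeffs_in_prime[OF B P prime_id_of_nat[OF P] _ _ _ min tP sqt(3)])
      show "derivation_on UNIV (mpol_deriv v)" using derivation_on_mpol_deriv[of UNIV] by (simp add: polys_UNIV)
      show "mpol_deriv v b = 0" if "b \<in> ?B" for b using that v by (rule mpol_deriv_notin)
      show "mpol_deriv v ?x = 1" by (simp add: mpol_deriv_pvar)
    qed
    then have "t \<in> ?S" using triangular_sat_coeffs[OF triangular _ GA] by blast
    then have "s * f \<in> ?S" using ideal_inD(3)[OF I ideal_inD(4)[OF I sqt(2) gS]] sqt(4) by simp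
    then show ?thesis using saturatedD[OF Sat, of f s] f sqt(1) polys_mono[of V "insert v V"] by auto
  qed
  then have "triangular P (insert v V) (insert g G)"
    using G gA GA grad_indep_insert(1)[OF G(1,3) v _ _ G(4) g(3), of "insert v V"]
    unfolding triangular_def by (intro conjI) auto
  then show ?thesis using gA g(3) grad_indep_insert(2)[OF G(1,3) v _ _ G(4) g(3), of "insert v V"] by auto
qed

text \<open>The generators added for \<open>W\<close> have independent gradients already in the
  columns \<open>W\<close>, since each new one brings its own variable. This separates them from
  \<open>G\<close>, which does not involve \<open>W\<close>.\<close>

lemma triangular_extend:
  assumes "finite W" "triangular P V G" "V \<inter> W = {}"
  shows "\<exists>E. finite E \<and> triangular P (V \<union> W) (G \<union> E) \<and> G \<inter> E = {} \<and> grad_indep P W E"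
  using assms
proof (induction W rule: finite_induct)
  case empty
  then show ?case by (intro exI[of _ "{}"]) (auto simp: grad_indep_def indep_def)
next
  case (insert v W)
  then obtain E where E: "finite E" "triangular P (V \<union> W) (G \<union> E)" "G \<inter> E = {}" "grad_indep P W E" by auto
  have v: "v \<notin> V \<union> W" using insert by auto
  show ?case
  proof (cases "alg_over P (V \<union> W) v")
    case True
    from triangular_step_alg[OF E(2) v True]
    obtain g where g: "g \<in> P \<inter> polys (insert v (V \<union> W))" "mpol_deriv v g \<notin> P" "g \<notin> G \<union> E"
      "triangular P (insert v (V \<union> W)) (insert g (G \<union> E))" by blast
    have "grad_indep P (insert v W) (insert g E)"
      using E v g by (intro grad_indep_insert(1)[of E "V \<union> W" v _ W]) (auto simp: triangular_def)
    then show ?thesis using g E by (intro exI[of _ "insert g E"]) auto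
  next
    case False
    have "grad_indep P (insert v W) E"
      using E(4) by (rule grad_indep_mono) auto
    then show ?thesis using triangular_step_nonalg[OF E(2) v False] E by (intro exI[of _ E]) auto
  qed
qed

lemma triangular_exists: "finite V \<Longrightarrow> \<exists>G. triangular P V G"
  using triangular_extend[of V "{}" "{}"] triangular_empty by auto

text \<open>The elements \<open>w t\<close> may involve variables outside \<open>V\<close>, provided
  their gradients vanish there modulo \<open>P\<close>. After extending \<open>G\<close> by
  \<open>E\<close> to all of \<open>V'\<close>, such gradients are spanned by those of
  \<open>G\<close> alone.\<close>

lemma triangular_card_ge:
  assumes G: "triangular P V G" and V': "finite V'" "V \<subseteq> V'" and T: "finite T"
    and w: "\<And>t. t \<in> T \<Longrightarrow> w t \<in> P \<inter> polys V'"
    and ind: "indep UNIV P V' T (\<lambda>t u. mpol_deriv u (w t))"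
    and van: "\<And>t u. t \<in> T \<Longrightarrow> u \<in> V' - V \<Longrightarrow> mpol_deriv u (w t) \<in> P"
  shows "card T \<le> card G"
proof -
  obtain E where E: "finite E" "triangular P (V \<union> (V' - V)) (G \<union> E)" "G \<inter> E = {}" "grad_indep P (V' - V) E"
    using triangular_extend[OF _ G, of "V' - V"] V' by auto
  then have E2: "triangular P V' (G \<union> E)" using V' by (simp add: Un_absorb1)
  have fG: "finite G" "G \<subseteq> polys V" "G \<subseteq> P" using G by (auto simp: triangular_def)
  have GE: "G \<union> E \<subseteq> P" using E2 by (simp add: triangular_def)
  have "\<exists>s C. s \<notin> P \<and> s * w t = (\<Sum>g\<in>G \<union> E. C g * g)" if "t \<in> T" for t
  proof -
    have "w t \<in> saturation (polys V') P (gen_ideal (polys V') (G \<union> E))" using w[OF that] E2 by (auto simp: triangular_def)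
    then obtain s where s: "s \<notin> P" "s * w t \<in> gen_ideal (polys V') ((\<lambda>g. g) ` (G \<union> E))" by (auto simp: saturation_def)
    from gen_image_sum[OF subring_set_polys _ s(2)] fG E(1)
    obtain C where "s * w t = (\<Sum>g\<in>G \<union> E. C g * g)" by auto
    then show ?thesis using s(1) by (intro exI[of _ s] exI[of _ C] conjI)
  qed
  then have "\<forall>t\<in>T. \<exists>s C. s \<notin> P \<and> s * w t = (\<Sum>g\<in>G \<union> E. C g * g)" ..
  from bchoice[OF this] obtain s
    where "\<forall>t\<in>T. \<exists>C. s t \<notin> P \<and> s t * w t = (\<Sum>g\<in>G \<union> E. C g * g)" ..
  from bchoice[OF this] obtain C
    where C: "\<forall>t\<in>T. s t \<notin> P \<and> s t * w t = (\<Sum>g\<in>G \<union> E. C t g * g)" ..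
  have sC: "s t \<notin> P" "s t * w t = (\<Sum>g\<in>G \<union> E. C t g * g)" if "t \<in> T" for t
    using C that by auto
  have grad: "s t * mpol_deriv u (w t) - (\<Sum>g\<in>G \<union> E. C t g * mpol_deriv u g) \<in> P" if t: "t \<in> T" for t u
  proof -
    note d = derivation_on_mpol_deriv[of UNIV u]
    have "mpol_deriv u (s t * w t) = mpol_deriv u (\<Sum>g\<in>G \<union> E. C t g * g)" using sC(2)[OF t] by simp
    then have "s t * mpol_deriv u (w t) + w t * mpol_deriv u (s t)
        = (\<Sum>g\<in>G \<union> E. C t g * mpol_deriv u g) + (\<Sum>g\<in>G \<union> E. g * mpol_deriv u (C t g))"
      by (simp add: mpol_deriv_mult derivation_sum[OF d] sum.distrib)
    then have "s t * mpol_deriv u (w t) - (\<Sum>g\<in>G \<union> E. C t g * mpol_deriv u g)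
        = (\<Sum>g\<in>G \<union> E. g * mpol_deriv u (C t g)) - w t * mpol_deriv u (s t)"
      by (simp add: algebra_simps)
    also have "\<dots> \<in> P"
      using GE w[OF t] by (auto intro!: prime_id_diff[OF P] prime_id_sum[OF P] prime_id_mult_right[OF P])
    finally show ?thesis .
  qed
  have split: "(\<Sum>g\<in>G \<union> E. h g) = (\<Sum>g\<in>G. h g) + (\<Sum>g\<in>E. h g)" for h :: "_ \<Rightarrow> ('v, 'k) mpol"
    using fG E by (intro sum.union_disjoint) auto
  \<comment> \<open>In the columns outside \<open>V\<close> both \<open>w t\<close> and
    \<open>G\<close> contribute nothing modulo \<open>P\<close>, so independence of \<open>E\<close>
    in these columns forces its coefficients into \<open>P\<close>.\<close>
  have CE: "C t e \<in> P" if t: "t \<in> T" and e: "e \<in> E" for t e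
  proof -
    have "(\<Sum>g\<in>E. C t g * mpol_deriv u g) \<in> P" if u: "u \<in> V' - V" for u
    proof -
      have "(\<Sum>g\<in>G. C t g * mpol_deriv u g) = 0"
        using fG u by (intro sum.neutral) (auto simp: mpol_deriv_notin)
      then have "s t * mpol_deriv u (w t) - (\<Sum>g\<in>E. C t g * mpol_deriv u g) \<in> P"
        using grad[OF t, of u] by (simp add: split)
      from prime_id_diff[OF P prime_id_mult_left[OF P van[OF t u], of "s t"] this]
      show ?thesis by simp
    qed
    then show ?thesis using E(4) e by (simp add: grad_indep_def indep_def)
  qed
  show ?thesis
  proof (rule indep_card_le_span[OF P T fG(1) ind, where s = s and C = C and G = "\<lambda>g u. mpol_deriv u g"])
    fix t u assume t: "t \<in> T"
    have "(\<Sum>g\<in>E. C t g * mpol_deriv u g) \<in> P"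
      using CE[OF t] by (auto intro!: prime_id_sum[OF P] prime_id_mult_right[OF P])
    from prime_id_add[OF P grad[OF t, of u] this]
    show "s t * mpol_deriv u (w t) - (\<Sum>g\<in>G. C t g * mpol_deriv u g) \<in> P" by (simp add: split)
  qed (use sC in auto)
qed

lemma triangular_card_unique:
  assumes "triangular P V G" "triangular P V H"
  shows "card G = card H"
proof -
  have "card H \<le> card G" if "triangular P V G" "triangular P V H" for G H
    using that triangular_card_ge[OF that(1), of V H "\<lambda>h. h"] by (auto simp: triangular_def grad_indep_def)
  then show ?thesis using assms by (simp add: le_antisym)
qed

text \<open>The height of \<open>P \<inter> polys V\<close>; the number called \<open>h\<close> in
  the overview is \<open>gdim P (ord_le i)\<close>. The choice is harmless since all triangular
  systems have the same size.\<close>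

definition gdim :: "'v set \<Rightarrow> nat" where
  "gdim V = card (SOME G. triangular P V G)"

lemma gdim_eq:
  assumes "triangular P V G"
  shows "gdim V = card G"
  unfolding gdim_def using someI[of "triangular P V" G] assms triangular_card_unique by blast

lemma gdim_empty: "gdim {} = 0"
  using gdim_eq[OF triangular_empty] by simp

lemma gdim_insert:
  assumes "finite V" "v \<notin> V"
  shows "gdim (insert v V) = gdim V + (if alg_over P V v then 1 else 0)"
proof -
  obtain G where G: "triangular P V G" using triangular_exists assms by blast
  show ?thesis
  proof (cases "alg_over P V v")
    case True
    then obtain g where g: "g \<notin> G" "triangular P (insert v V) (insert g G)" using triangular_step_alg[OF G assms(2)] by blast
    have "finite G" using G by (simp add: triangular_def)
    then show ?thesis using True gdim_eq[OF G] gdim_eq[OF g(2)] g(1) by simp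
  next
    case False
    then show ?thesis using triangular_step_nonalg[OF G assms(2)] gdim_eq G by auto
  qed
qed

text \<open>Supplies assumption \<open>H\<close> of \<open>jacobian_prime\<close>. Differentiating
  \<open>s * p\<close> as a combination of a triangular system gives, modulo \<open>P\<close>, a
  relation among its gradients, so all coefficients lie in \<open>P\<close>.\<close>

lemma square_of_prime:
  assumes "finite V" "p \<in> P \<inter> polys V" "\<And>v. v \<in> V \<Longrightarrow> mpol_deriv v p \<in> P"
  shows "p \<in> saturation (polys V) P (gen_ideal (polys V) {p * q | p q. p \<in> P \<inter> polys V \<and> q \<in> P \<inter> polys V})"
proof -
  obtain G where G: "triangular P V G" using triangular_exists assms by blast
  then have fG: "finite G" "G \<subseteq> P \<inter> polys V" "grad_indep P V G" by (auto simp: triangular_def)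
  have "p \<in> saturation (polys V) P (gen_ideal (polys V) ((\<lambda>g. g) ` G))" using G assms(2) by (auto simp: triangular_def)
  then obtain s where s: "s \<in> polys V - P" "s * p \<in> gen_ideal (polys V) ((\<lambda>g. g) ` G)" by (auto simp: saturation_def)
  from gen_image_sum[OF subring_set_polys fG(1) s(2)]
  obtain c where c: "\<forall>g. c g \<in> polys V" "s * p = (\<Sum>g\<in>G. c g * g)" by blast
  have "(\<Sum>g\<in>G. c g * mpol_deriv v g) \<in> P" if v: "v \<in> V" for v
  proof -
    note d = derivation_on_mpol_deriv[of UNIV v]
    have "mpol_deriv v (s * p) = mpol_deriv v (\<Sum>g\<in>G. c g * g)" using c by simp
    then have "(\<Sum>g\<in>G. c g * mpol_deriv v g)
        = s * mpol_deriv v p + p * mpol_deriv v s - (\<Sum>g\<in>G. g * mpol_deriv v (c g))"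
      by (simp add: mpol_deriv_mult derivation_sum[OF d] sum.distrib algebra_simps)
    also have "\<dots> \<in> P"
      by (intro prime_id_diff[OF P] prime_id_add[OF P] prime_id_sum[OF P]
          prime_id_mult_left[OF P assms(3)[OF v]] prime_id_mult_right[OF P])
        (use assms(2) fG in auto)
    finally show ?thesis .
  qed
  then have cP: "c g \<in> P" if "g \<in> G" for g
    using fG(3) that by (simp add: grad_indep_def indep_def)
  let ?S = "{p * q | p q. p \<in> P \<inter> polys V \<and> q \<in> P \<inter> polys V}"
  have "?S \<subseteq> polys V" by (auto intro: polys_mult)
  moreover have "c g * g \<in> ?S" if "g \<in> G" for g
    by (rule CollectI, rule exI[of _ "c g"], rule exI[of _ g]) (use cP c(1) fG that in auto)
  ultimately have "(\<Sum>g\<in>G. 1 * (c g * g)) \<in> gen_ideal (polys V) ?S"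
    by (intro sum_in_gen[OF subring_set_polys]) (auto simp: polys_1)
  then have "s * p \<in> gen_ideal (polys V) ?S" by (simp add: c(2))
  then show ?thesis using s assms by (auto simp: saturation_def)
qed

theorem mpol_jacobian_prime:
  assumes V: "finite V" and F: "finite F" "F \<subseteq> P \<inter> polys V" "grad_indep P V F"
    and ab: "a \<in> polys V" "b \<in> polys V" "a * b \<in> saturation (polys V) P (gen_ideal (polys V) F)"
  shows "a \<in> saturation (polys V) P (gen_ideal (polys V) F) \<or> b \<in> saturation (polys V) P (gen_ideal (polys V) F)"
proof (rule pv.jacobian_prime[OF noeth_polys[OF V] V _ prime_id_of_nat[OF P] _ F(1,2) _ ab])
  show "derivation_on (polys V) (mpol_deriv v)" for v by (rule derivation_on_mpol_deriv)
  show "indep (polys V) P V F (\<lambda>p v. mpol_deriv v p)"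
    using F(3) indep_coeffs_mono unfolding grad_indep_def by blast
qed (assumption, rule square_of_prime[OF V])

end

section \<open>Substitution of variables and coefficients\<close>

definition mono_map :: "('v \<Rightarrow> 'w) \<Rightarrow> ('v \<Rightarrow>\<^sub>0 nat) \<Rightarrow> ('w \<Rightarrow>\<^sub>0 nat)" where
  "mono_map g m = (\<Sum>v\<in>Poly_Mapping.keys m. Poly_Mapping.single (g v) (Poly_Mapping.lookup m v))"

text \<open>With \<open>shift\<close> this is the endomorphism of the difference polynomial ring;
  with \<open>id\<close> on coefficients it renames variables, possibly identifying some.\<close>

definition mpol_map ::
  "('v \<Rightarrow> 'w) \<Rightarrow> ('k::comm_ring_1 \<Rightarrow> 'k) \<Rightarrow> ('v, 'k) mpol \<Rightarrow> ('w, 'k) mpol" where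
  "mpol_map g \<tau> p = (\<Sum>m\<in>Poly_Mapping.keys p.
     Poly_Mapping.single (mono_map g m) (\<tau> (Poly_Mapping.lookup p m)))"

lemma mono_map_add: "mono_map g (m + n) = mono_map g m + mono_map g n"
proof -
  have sup: "mono_map g m = (\<Sum>v\<in>A. Poly_Mapping.single (g v) (Poly_Mapping.lookup m v))"
    if "finite A" "Poly_Mapping.keys m \<subseteq> A" for A m
    unfolding mono_map_def by (rule sum.mono_neutral_left) (use that in \<open>auto simp: in_keys_iff\<close>)
  let ?A = "Poly_Mapping.keys m \<union> Poly_Mapping.keys n"
  show ?thesis
    using keys_add[of m n] by (simp add: sup[of ?A] sum.distrib[symmetric] single_add lookup_add)
qed

lemma mono_map_single: "mono_map g (Poly_Mapping.single v k) = Poly_Mapping.single (g v) k"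
  by (auto simp: mono_map_def)

definition ring_endo :: "('k::comm_ring_1 \<Rightarrow> 'k) \<Rightarrow> bool" where
  "ring_endo \<tau> \<longleftrightarrow> (\<forall>a b. \<tau> (a + b) = \<tau> a + \<tau> b \<and> \<tau> (a * b) = \<tau> a * \<tau> b) \<and> \<tau> 1 = 1"

lemma endo_zero: "ring_endo \<tau> \<Longrightarrow> \<tau> 0 = 0"
  unfolding ring_endo_def by (metis add_cancel_right_right)

context
  fixes g :: "'v \<Rightarrow> 'w" and \<tau> :: "'k::comm_ring_1 \<Rightarrow> 'k"
  assumes \<tau>: "ring_endo \<tau>"
begin

lemma mpol_map_superset:
  assumes "finite A" "Poly_Mapping.keys p \<subseteq> A"
  shows "mpol_map g \<tau> p = (\<Sum>m\<in>A. Poly_Mapping.single (mono_map g m) (\<tau> (Poly_Mapping.lookup p m)))"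
  unfolding mpol_map_def
  by (rule sum.mono_neutral_left) (use assms in \<open>auto simp: in_keys_iff endo_zero[OF \<tau>]\<close>)

lemma mpol_map_add: "mpol_map g \<tau> (p + q) = mpol_map g \<tau> p + mpol_map g \<tau> q"
proof -
  let ?A = "Poly_Mapping.keys p \<union> Poly_Mapping.keys q"
  show ?thesis
    using keys_add[of p q] \<tau>
    by (simp add: mpol_map_superset[of ?A] sum.distrib[symmetric] single_add[symmetric] lookup_add ring_endo_def)
qed

lemma mpol_map_single: "mpol_map g \<tau> (Poly_Mapping.single m c) = Poly_Mapping.single (mono_map g m) (\<tau> c)"
  by (subst mpol_map_superset[of "{m}"]) auto

lemma mpol_map_mult: "mpol_map g \<tau> (p * q) = mpol_map g \<tau> p * mpol_map g \<tau> q"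
proof (induction p rule: mpol_add_induct)
  case (1 m c)
  show ?case
  proof (induction q rule: mpol_add_induct)
    case (1 n d)
    show ?case using \<tau> by (simp add: mult_single mpol_map_single mono_map_add ring_endo_def)
  next
    case (2 q1 q2)
    then show ?case by (simp add: distrib_left mpol_map_add)
  qed
next
  case (2 p1 p2)
  then show ?case by (simp add: distrib_right mpol_map_add)
qed

lemma mpol_map_const: "mpol_map g \<tau> (mpol_const c) = mpol_const (\<tau> c)"
  by (simp add: mpol_const_def mpol_map_single mono_map_def)

lemma mpol_map_pvar: "mpol_map g \<tau> (pvar v) = pvar (g v)"
  using \<tau> by (simp add: pvar_def mpol_map_single mono_map_single ring_endo_def)

lemma mpol_map_1: "mpol_map g \<tau> 1 = 1"
  using mpol_map_const[of 1] \<tau> by (simp add: mpol_const_1 ring_endo_def)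

lemma mpol_map_0: "mpol_map g \<tau> 0 = 0"
  by (simp add: mpol_map_def)

lemma mpol_map_sum: "mpol_map g \<tau> (sum h A) = (\<Sum>a\<in>A. mpol_map g \<tau> (h a))"
  by (induction A rule: infinite_finite_induct) (auto simp: mpol_map_add mpol_map_0)

lemma mpol_map_polys: "p \<in> polys V \<Longrightarrow> mpol_map g \<tau> p \<in> polys (g ` V)"
  by (induction rule: polys_induct)
    (auto simp: mpol_map_const mpol_map_pvar mpol_map_add mpol_map_mult
      intro: polys_const polys_pvar polys_add polys_mult)

lemma mpol_deriv_map:
  assumes "inj_on g (insert v V)"
  shows "p \<in> polys V \<Longrightarrow> mpol_deriv (g v) (mpol_map g \<tau> p) = mpol_map g \<tau> (mpol_deriv v p)"
proof (induction rule: polys_induct)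
  case (pvar u)
  then have "g u = g v \<longleftrightarrow> u = v" using assms by (auto simp: inj_on_def)
  then show ?case by (simp add: mpol_map_pvar mpol_deriv_pvar mpol_map_1 mpol_map_0)
qed (simp_all add: mpol_map_const mpol_deriv_const mpol_map_0 mpol_map_add mpol_map_mult
  mpol_deriv_add mpol_deriv_mult)

end

lemma endo_id: "ring_endo id"
  by (simp add: ring_endo_def)

lemma mpol_map_inverse:
  "p \<in> polys V \<Longrightarrow> (\<And>v. v \<in> V \<Longrightarrow> h (g v) = v) \<Longrightarrow> mpol_map h id (mpol_map g id p) = p"
  by (induction rule: polys_induct)
    (auto simp: mpol_map_const[OF endo_id] mpol_map_pvar[OF endo_id] mpol_map_add[OF endo_id] mpol_map_mult[OF endo_id])

section \<open>The number of algebraic variables\<close>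

context
  fixes P :: "('v, 'k::field_char_0) mpol set" and \<rho> :: "'v \<Rightarrow> nat"
  assumes P: "prime_id P" and \<rho>: "inj \<rho>"
begin

lemma finite_initial: "finite {u. \<rho> u < k}"
  using finite_vimageI[of "{..<k}" \<rho>] \<rho> by (simp add: vimage_def)

lemma initial_Suc:
  "{u. \<rho> u < Suc k} = {u. \<rho> u < k} \<or> (\<exists>v. \<rho> v = k \<and> {u. \<rho> u < Suc k} = insert v {u. \<rho> u < k})"
proof (cases "\<exists>v. \<rho> v = k")
  case True
  then obtain v where v: "\<rho> v = k" by blast
  have "{u. \<rho> u < Suc k} = insert v {u. \<rho> u < k}"
    using v \<rho> by (auto simp: less_Suc_eq inj_def)
  then show ?thesis using v by blast
next
  case False
  then show ?thesis by (auto simp: less_Suc_eq)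
qed

text \<open>Variables are added in the order given by \<open>\<rho>\<close>, and
  \<open>gdim_insert\<close> counts one for each that is algebraic over its predecessors. Values not
  taken by \<open>\<rho>\<close> leave the initial set unchanged.\<close>

lemma gdim_initial:
  "gdim P {u. \<rho> u < k} = card {v. \<rho> v < k \<and> alg_over P {u. \<rho> u < \<rho> v} v}"
proof (induction k)
  case 0
  then show ?case by (simp add: gdim_empty[OF P])
next
  case (Suc k)
  let ?Z = "\<lambda>k. {v. \<rho> v < k \<and> alg_over P {u. \<rho> u < \<rho> v} v}"
  from initial_Suc[of k] show ?case
  proof
    assume "{u. \<rho> u < Suc k} = {u. \<rho> u < k}"
    moreover from this have "?Z (Suc k) = ?Z k" by blast
    ultimately show ?thesis using Suc by simp
  next
    assume "\<exists>v. \<rho> v = k \<and> {u. \<rho> u < Suc k} = insert v {u. \<rho> u < k}"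
    then obtain v where v: "\<rho> v = k" "{u. \<rho> u < Suc k} = insert v {u. \<rho> u < k}" by blast
    have "?Z (Suc k) = (if alg_over P {u. \<rho> u < k} v then insert v (?Z k) else ?Z k)"
      using v by auto
    moreover have "finite (?Z k)" by (rule finite_subset[OF _ finite_initial[of k]]) auto
    moreover have "v \<notin> ?Z k" using v by simp
    ultimately show ?thesis
      unfolding v(2) using gdim_insert[OF P finite_initial[of k], of v] v Suc by simp
  qed
qed

lemma alg_over_mono: "alg_over P V v \<Longrightarrow> V \<subseteq> W \<Longrightarrow> alg_over P W v"
  unfolding alg_over_def using polys_mono[of "insert v V" "insert v W"] by blast

text \<open>A relation expanded in its last variable has all coefficients in \<open>P\<close>, by
  non-algebraicity of that variable; these coefficients are relations among earlier variables, hence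
  zero.\<close>

lemma nonalg_independent:
  "p \<in> P \<Longrightarrow> p \<in> polys {v. \<rho> v < k \<and> \<not> alg_over P {u. \<rho> u < \<rho> v} v} \<Longrightarrow> p = 0"
proof (induction k arbitrary: p)
  case 0
  then obtain c where "p = mpol_const c" using polys_empty_const[of p] by auto
  then show ?case using prime_id_const[OF P, of c] 0 by (cases "c = 0") (auto simp: mpol_const_0)
next
  case (Suc k)
  let ?U = "\<lambda>k. {v. \<rho> v < k \<and> \<not> alg_over P {u. \<rho> u < \<rho> v} v}"
  from initial_Suc[of k] have "?U (Suc k) = ?U k \<or>
    (\<exists>v. \<rho> v = k \<and> \<not> alg_over P {u. \<rho> u < k} v \<and> ?U (Suc k) = insert v (?U k))"
  proof
    assume "{u. \<rho> u < Suc k} = {u. \<rho> u < k}"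
    then show ?thesis by blast
  next
    assume "\<exists>v. \<rho> v = k \<and> {u. \<rho> u < Suc k} = insert v {u. \<rho> u < k}"
    then obtain v where v: "\<rho> v = k" "{u. \<rho> u < Suc k} = insert v {u. \<rho> u < k}" by blast
    have "?U (Suc k) = (if alg_over P {u. \<rho> u < k} v then ?U k else insert v (?U k))"
      using v by auto
    then show ?thesis using v(1) by auto
  qed
  then show ?case
  proof
    assume "?U (Suc k) = ?U k"
    then show ?thesis using Suc by simp
  next
    assume "\<exists>v. \<rho> v = k \<and> \<not> alg_over P {u. \<rho> u < k} v \<and> ?U (Suc k) = insert v (?U k)"
    then obtain v where v: "\<rho> v = k" "\<not> alg_over P {u. \<rho> u < k} v" "?U (Suc k) = insert v (?U k)" by blast
    have a1: "\<not> alg_over P (?U k) v" using v(2) alg_over_mono[of "?U k" v "{u. \<rho> u < k}"] by blast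
    have a2: "v \<notin> ?U k" using v(1) by simp
    have "p \<in> polys (insert v (?U k))" using Suc.prems(2) unfolding v(3) .
    from nonalg_coeffs[OF P a2 a1 Suc.prems(1) this] obtain n c where c: "\<forall>d. c d \<in> P \<inter> polys (?U k)" "p = (\<Sum>d<n. c d * pvar v ^ d)"
      by (elim exE conjE)
    have "c d = 0" for d using Suc.IH[of "c d"] c(1) by blast
    then show ?thesis using c(2) by simp
  qed
qed

end

section \<open>Row bases\<close>

text \<open>The rows \<open>S\<close> are a basis of the row space over the fraction field of the
  ring modulo \<open>P\<close>; the dependence of every other row on them is stated with
  denominators cleared.\<close>

definition row_basis ::
  "'a::comm_ring_1 set \<Rightarrow> 'j set \<Rightarrow> 'i set \<Rightarrow> 'i set \<Rightarrow> ('i \<Rightarrow> 'j \<Rightarrow> 'a) \<Rightarrow> bool" where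
  "row_basis P J R S M \<longleftrightarrow> S \<subseteq> R \<and> indep UNIV P J S M \<and>
    (\<forall>x\<in>R - S. \<exists>c. c x \<notin> P \<and> (\<forall>j\<in>J. c x * M x j + (\<Sum>s\<in>S. c s * M s j) \<in> P))"

lemma row_basis_exists:
  assumes P: "prime_id P" and "finite R"
  shows "\<exists>S. row_basis P J R S M"
proof -
  define Q where "Q S \<longleftrightarrow> S \<subseteq> R \<and> indep UNIV P J S M" for S
  have "Q {}" by (auto simp: Q_def indep_def)
  moreover have "card S < Suc (card R)" if "Q S" for S
    using that assms(2) card_mono[of R S] by (simp add: Q_def less_Suc_eq_le)
  ultimately have "\<exists>S. Q S \<and> (\<forall>T. Q T \<longrightarrow> card T \<le> card S)"
    by (intro ex_has_greatest_nat[where b = "Suc (card R)"]) auto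
  then obtain S where S: "Q S" "\<And>T. Q T \<Longrightarrow> card T \<le> card S" by blast
  have fS: "finite S" "S \<subseteq> R" "indep UNIV P J S M"
    using S(1) assms(2) by (auto simp: Q_def intro: finite_subset)
  have "\<exists>c. c x \<notin> P \<and> (\<forall>j\<in>J. c x * M x j + (\<Sum>s\<in>S. c s * M s j) \<in> P)" if x: "x \<in> R - S" for x
  proof -
    have "\<not> Q (insert x S)" using S(2)[of "insert x S"] x fS(1) by auto
    then have "\<not> indep UNIV P J (insert x S) M" using x fS by (auto simp: Q_def)
    then show ?thesis using not_indep_insert[OF P fS(1) _ fS(3)] x by blast
  qed
  then show ?thesis using fS by (auto simp: row_basis_def)
qed

section \<open>Dimension growth of a quasi-regular system\<close>

abbreviation shift :: "'n \<times> nat \<Rightarrow> 'n \<times> nat" where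
  "shift \<equiv> \<lambda>(j, l). (j, Suc l)"

lemma inj_shift: "inj_on shift A"
  by (auto simp: inj_on_def)

lemma dpol_sigma_eq_map: "dpol_sigma \<sigma> = mpol_map shift \<sigma>"
  by (rule ext) (simp add: dpol_sigma_def mpol_map_def mono_map_def case_prod_unfold)

text \<open>Prolongations carry indices \<open>(a, l)\<close> of the same shape as the variables
  \<open>(j, l)\<close>, so \<open>shift\<close> moves rows and columns of the Jacobian
  alike.\<close>

definition prolong :: "('k \<Rightarrow> 'k) \<Rightarrow> ('r \<Rightarrow> ('n, 'k::comm_ring_1) dpol) \<Rightarrow> 'r \<times> nat \<Rightarrow> ('n, 'k) dpol" where
  "prolong \<sigma> f x = (dpol_sigma \<sigma> ^^ snd x) (f (fst x))"

lemma prolong_shift: "prolong \<sigma> f (shift x) = dpol_sigma \<sigma> (prolong \<sigma> f x)"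
  by (simp add: prolong_def case_prod_unfold)

definition ord_le :: "nat \<Rightarrow> ('n \<times> nat) set" where
  "ord_le i = {(j, l). l \<le> i}"

lemma ord_le_eq: "ord_le i = UNIV \<times> {..i}"
  by (auto simp: ord_le_def)

lemma finite_ord_le: "finite (ord_le i :: ('n::finite \<times> nat) set)"
  by (simp add: ord_le_eq)

lemma card_ord_le: "card (ord_le i :: ('n::finite \<times> nat) set) = card (UNIV :: 'n set) * (i + 1)"
  by (simp add: ord_le_eq card_cartesian_product)

lemma shift_ord_le: "shift ` ord_le i \<subseteq> ord_le (Suc i)"
  by (auto simp: ord_le_def)

lemma finite_subset_ord_le:
  assumes "finite V"
  shows "\<exists>K. \<forall>k\<ge>K. V \<subseteq> ord_le k"
proof -
  obtain K where "\<forall>v\<in>V. snd v \<le> K"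
    using assms finite_nat_set_iff_bounded_le[of "snd ` V"] by auto
  then show ?thesis by (intro exI[of _ K]) (fastforce simp: ord_le_def)
qed

lemma gen_prolong_bounded:
  assumes "a \<in> gen_ideal B (range F)"
  shows "\<exists>M::nat. \<forall>m\<ge>M. a \<in> gen_ideal B (F ` (UNIV \<times> {..<m}))"
  using assms
proof induction
  case zero
  then show ?case by (auto intro: gen_ideal.zero)
next
  case (step b x a)
  then obtain M where M: "\<And>m. m \<ge> M \<Longrightarrow> a \<in> gen_ideal B (F ` (UNIV \<times> {..<m}))" by blast
  obtain r l where x: "x = F (r, l)" using step by auto
  have "b * x + a \<in> gen_ideal B (F ` (UNIV \<times> {..<m}))" if "m \<ge> max M (Suc l)" for m
    using that M step(1) x by (intro gen_ideal.step) auto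
  then show ?case by blast
qed

lemma prolong_mem:
  assumes "\<And>p. dpol_sigma \<sigma> p \<in> P \<longleftrightarrow> p \<in> P" "\<And>a. f a \<in> P"
  shows "prolong \<sigma> f x \<in> P"
proof -
  have "prolong \<sigma> f (a, l) \<in> P" for a l by (induction l) (simp_all add: prolong_def assms)
  then show ?thesis by (cases x) simp
qed

lemma prolong_polys:
  assumes \<sigma>: "ring_endo \<sigma>" and f: "\<And>a. f a \<in> polys (ord_le e)"
  shows "prolong \<sigma> f (a, l) \<in> polys (ord_le (l + e))"
proof (induction l)
  case (Suc l)
  have "prolong \<sigma> f (a, Suc l) \<in> polys (shift ` ord_le (l + e))"
    using mpol_map_polys[OF \<sigma> Suc, of shift] by (simp add: prolong_def dpol_sigma_eq_map)
  then show ?case using subsetD[OF polys_mono[OF shift_ord_le[of "l + e"]]] by simp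
qed (use f in \<open>simp add: prolong_def\<close>)

text \<open>What the dimension count needs: \<open>f_indep\<close> is the rank part of
  quasi-regularity and \<open>f_gen\<close> expresses that \<open>P\<close> is generated by the
  prolongations up to denominators. The prolongations by \<open>l < m\<close> have order below
  \<open>m + e\<close> in case \<open>e\<close> bounds the order and the bound
  \<open>m - 1 + e\<close> is read as a strict one.\<close>

locale diff_setup =
  fixes \<sigma> :: "'k::field_char_0 \<Rightarrow> 'k" and f :: "'r::finite \<Rightarrow> ('n::finite, 'k) dpol"
    and P :: "('n, 'k) dpol set" and e :: nat
  assumes \<sigma>: "ring_endo \<sigma>" and P: "prime_id P" and sigma_P: "\<And>p. dpol_sigma \<sigma> p \<in> P \<longleftrightarrow> p \<in> P"
    and f_ord: "\<And>a. f a \<in> polys (ord_le e)"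
    and f_indep: "\<And>m. indep UNIV P {(j, l). l < m + e} (UNIV \<times> {..<m}) (\<lambda>x v. mpol_deriv v (prolong \<sigma> f x))"
    and f_P: "\<And>a. f a \<in> P"
    and f_gen: "\<And>p. p \<in> P \<Longrightarrow> \<exists>s. s \<notin> P \<and> s * p \<in> gen_ideal UNIV (range (prolong \<sigma> f))"
begin

abbreviation S where "S \<equiv> dpol_sigma \<sigma>"
abbreviation F where "F \<equiv> prolong \<sigma> f"

lemmas S_simps =
  mpol_map_add[OF \<sigma>, of shift, folded dpol_sigma_eq_map]
  mpol_map_mult[OF \<sigma>, of shift, folded dpol_sigma_eq_map]
  mpol_map_sum[OF \<sigma>, of shift, folded dpol_sigma_eq_map]
  mpol_map_0[OF \<sigma>, of shift, folded dpol_sigma_eq_map]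
  mpol_map_pvar[OF \<sigma>, of shift, folded dpol_sigma_eq_map]
lemmas S_polys = mpol_map_polys[OF \<sigma>, of _ _ shift, folded dpol_sigma_eq_map]

lemma S_deriv: "mpol_deriv (shift v) (S p) = S (mpol_deriv v p)"
  unfolding dpol_sigma_eq_map by (rule mpol_deriv_map[OF \<sigma> inj_shift, of _ UNIV]) (simp add: polys_UNIV)

lemmas F_P = prolong_mem[OF sigma_P, where f = f, OF f_P]
lemmas F_polys = prolong_polys[OF \<sigma>, where f = f, OF f_ord]

lemma F_deriv_zero: "l + e < q \<Longrightarrow> mpol_deriv (j, q) (F (a, l)) = 0"
  using mpol_deriv_notin[OF F_polys[of a l], of "(j, q)"] by (auto simp: ord_le_def)

abbreviation rows :: "nat \<Rightarrow> ('r \<times> nat) set" where "rows m \<equiv> UNIV \<times> {..<m}"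
abbreviation cols :: "nat \<Rightarrow> nat \<Rightarrow> ('n \<times> nat) set" where "cols m i \<equiv> {(j, l). i < l \<and> l < m + e}"

lemma finite_cols: "finite (cols m i)"
  by (rule finite_subset[OF _ finite_ord_le[of "m + e"]]) (auto simp: ord_le_def)

text \<open>For large \<open>m\<close> the gradients of a triangular system \<open>G\<close> are, up
  to denominators, combinations of the rows of the Jacobian, and they vanish in columns of order
  above \<open>i\<close>. The rows \<open>T m\<close> are independent in just these columns, so
  \<open>G\<close> and \<open>T m\<close> together are independent in the row space.\<close>

lemma gdim_upper:
  assumes basis: "\<And>m. row_basis P (cols m i) (rows m) (T m) (\<lambda>x v. mpol_deriv v (F x))"
  shows "\<exists>M. \<forall>m\<ge>M. gdim P (ord_le i) + card (T m) \<le> card (UNIV :: 'r set) * m"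
proof -
  obtain G where G: "triangular P (ord_le i) G" using triangular_exists[OF P finite_ord_le] by blast
  then have fG: "finite G" "G \<subseteq> P" "G \<subseteq> polys (ord_le i)" "grad_indep P (ord_le i) G"
    by (auto simp: triangular_def)
  have "\<exists>s M. s \<notin> P \<and> (\<forall>m\<ge>M. s * g \<in> gen_ideal UNIV (F ` rows m))" if "g \<in> G" for g
    using f_gen[of g] gen_prolong_bounded fG that by blast
  then have "\<forall>g\<in>G. \<exists>s M. s \<notin> P \<and> (\<forall>m\<ge>M. s * g \<in> gen_ideal UNIV (F ` rows m))" ..
  from bchoice[OF this] obtain s
    where "\<forall>g\<in>G. \<exists>M. s g \<notin> P \<and> (\<forall>m\<ge>M. s g * g \<in> gen_ideal UNIV (F ` rows m))" ..
  from bchoice[OF this] obtain M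
    where M: "\<forall>g\<in>G. s g \<notin> P \<and> (\<forall>m\<ge>M g. s g * g \<in> gen_ideal UNIV (F ` rows m))" ..
  have sM: "s g \<notin> P" "m \<ge> M g \<Longrightarrow> s g * g \<in> gen_ideal UNIV (F ` rows m)" if "g \<in> G" for g m
    using M that by auto
  have "gdim P (ord_le i) + card (T m) \<le> card (UNIV :: 'r set) * m" if m: "m \<ge> Max (insert 0 (M ` G))" for m
  proof -
    have "\<exists>c. s g * g = (\<Sum>x\<in>rows m. c x * F x)" if g: "g \<in> G" for g
    proof -
      have "M g \<le> m" using m g fG by simp
      from gen_image_sum[OF subring_set_UNIV _ sM(2)[OF g this]] show ?thesis by auto
    qed
    then have "\<forall>g\<in>G. \<exists>c. s g * g = (\<Sum>x\<in>rows m. c x * F x)" ..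
    from bchoice[OF this] obtain c where "\<forall>g\<in>G. s g * g = (\<Sum>x\<in>rows m. c g x * F x)" ..
    then have c: "s g * g = (\<Sum>x\<in>rows m. c g x * F x)" if "g \<in> G" for g using that by blast
    have Tm: "T m \<subseteq> rows m" "indep UNIV P (cols m i) (T m) (\<lambda>x v. mpol_deriv v (F x))"
      using basis by (auto simp: row_basis_def)
    then have fT: "finite (T m)" by (rule_tac finite_subset[OF Tm(1)]) auto
    have grad: "s g * mpol_deriv u g - (\<Sum>x\<in>rows m. c g x * mpol_deriv u (F x)) \<in> P"
      if g: "g \<in> G" for g u
    proof -
      note d = derivation_on_mpol_deriv[of UNIV u]
      have "mpol_deriv u (s g * g) = mpol_deriv u (\<Sum>x\<in>rows m. c g x * F x)" using c[OF g] by simp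
      then have "s g * mpol_deriv u g - (\<Sum>x\<in>rows m. c g x * mpol_deriv u (F x))
          = (\<Sum>x\<in>rows m. F x * mpol_deriv u (c g x)) - g * mpol_deriv u (s g)"
        by (simp add: mpol_deriv_mult derivation_sum[OF d] sum.distrib algebra_simps)
      also have "\<dots> \<in> P"
        using F_P g fG by (intro prime_id_diff[OF P] prime_id_sum[OF P] prime_id_mult_right[OF P]) auto
      finally show ?thesis .
    qed
    \<comment> \<open>The coefficient vectors of \<open>G\<close> and of the chosen rows with
      respect to all rows of the Jacobian; their independence bounds their number by the number of
      rows.\<close>
    define N where "N y x = (case y of Inl g \<Rightarrow> c g x | Inr t \<Rightarrow> if x = t then 1 else 0)" for y x
    have "indep UNIV P (rows m) (G <+> T m) N"
      unfolding indep_def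
    proof (intro allI impI)
      fix d assume d: "\<forall>x\<in>rows m. (\<Sum>y\<in>G <+> T m. d y * N y x) \<in> P"
      have split: "(\<Sum>y\<in>G <+> T m. d y * N y x)
          = (\<Sum>g\<in>G. d (Inl g) * c g x) + (if x \<in> T m then d (Inr x) else 0)" for x
      proof -
        have "(\<Sum>t\<in>T m. d (Inr t) * (if x = t then 1 else 0)) = (\<Sum>t\<in>T m. if t = x then d (Inr x) else 0)"
          by (intro sum.cong) auto
        then show ?thesis using fG fT by (simp add: sum.Plus N_def)
      qed
      have comb: "(\<Sum>g\<in>G. d (Inl g) * (s g * mpol_deriv u g)) + (\<Sum>t\<in>T m. d (Inr t) * mpol_deriv u (F t)) \<in> P" for u
      proof -
        have a: "(\<Sum>x\<in>rows m. (\<Sum>y\<in>G <+> T m. d y * N y x) * mpol_deriv u (F x)) \<in> P"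
          by (rule prime_id_sum[OF P], rule prime_id_mult_right[OF P], rule bspec[OF d])
        have "(\<Sum>x\<in>rows m. (\<Sum>y\<in>G <+> T m. d y * N y x) * mpol_deriv u (F x))
            = (\<Sum>x\<in>rows m. \<Sum>g\<in>G. d (Inl g) * c g x * mpol_deriv u (F x))
              + (\<Sum>x\<in>rows m. if x \<in> T m then d (Inr x) * mpol_deriv u (F x) else 0)"
          unfolding split distrib_right sum.distrib sum_distrib_right
          by (intro arg_cong2[of _ _ _ _ "(+)"] sum.cong) auto
        also have "(\<Sum>x\<in>rows m. if x \<in> T m then d (Inr x) * mpol_deriv u (F x) else 0)
            = (\<Sum>t\<in>T m. d (Inr t) * mpol_deriv u (F t))"
          using Tm(1) by (subst sum.inter_restrict[symmetric]) (auto simp: Int_absorb1)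
        also have "(\<Sum>x\<in>rows m. \<Sum>g\<in>G. d (Inl g) * c g x * mpol_deriv u (F x))
            = (\<Sum>g\<in>G. d (Inl g) * (\<Sum>x\<in>rows m. c g x * mpol_deriv u (F x)))"
          by (subst sum.swap) (simp only: sum_distrib_left mult.assoc)
        finally have eq: "(\<Sum>x\<in>rows m. (\<Sum>y\<in>G <+> T m. d y * N y x) * mpol_deriv u (F x))
          = (\<Sum>g\<in>G. d (Inl g) * (\<Sum>x\<in>rows m. c g x * mpol_deriv u (F x)))
            + (\<Sum>t\<in>T m. d (Inr t) * mpol_deriv u (F t))" .
        have b: "(\<Sum>g\<in>G. d (Inl g) * (s g * mpol_deriv u g - (\<Sum>x\<in>rows m. c g x * mpol_deriv u (F x)))) \<in> P"
          using grad by (intro prime_id_sum[OF P] prime_id_mult_left[OF P])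
        from prime_id_add[OF P a[unfolded eq] b] show ?thesis
          by (simp add: right_diff_distrib sum_subtractf add.commute)
      qed
      \<comment> \<open>In columns of order above \<open>i\<close> the part coming from
        \<open>G\<close> disappears, and \<open>T m\<close> is independent there.\<close>
      have dT: "d (Inr t) \<in> P" if t: "t \<in> T m" for t
      proof -
        have eq: "(\<Sum>t\<in>T m. d (Inr t) * mpol_deriv u (F t)) \<in> P" if u: "u \<in> cols m i" for u
        proof -
          have "(\<Sum>g\<in>G. d (Inl g) * (s g * mpol_deriv u g)) = 0"
            using fG u by (intro sum.neutral) (auto simp: mpol_deriv_notin ord_le_def)
          then show ?thesis using comb[of u] by simp
        qed
        show ?thesis
          by (rule indepD[OF Tm(2), where c = "\<lambda>t. d (Inr t)"], rule UNIV_I, erule eq, rule t)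
      qed
      have dG: "d (Inl g) \<in> P" if g: "g \<in> G" for g
      proof -
        have eq: "(\<Sum>g\<in>G. (d (Inl g) * s g) * mpol_deriv u g) \<in> P" for u
        proof -
          have "(\<Sum>t\<in>T m. d (Inr t) * mpol_deriv u (F t)) \<in> P"
            using dT by (intro prime_id_sum[OF P] prime_id_mult_right[OF P])
          from prime_id_diff[OF P comb[of u] this] show ?thesis by (simp add: mult.assoc)
        qed
        have "d (Inl g) * s g \<in> P"
          by (rule indepD[OF fG(4)[unfolded grad_indep_def], where c = "\<lambda>g. d (Inl g) * s g"],
              rule UNIV_I, rule eq, rule g)
        then show ?thesis using sM(1)[OF g] by (simp add: prime_id_mult_iff[OF P])
      qed
      show "\<forall>y\<in>G <+> T m. d y \<in> P" using dT dG by auto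
    qed
    from indep_card_le[OF P _ _ this] have "card (G <+> T m) \<le> card (rows m)" using fG fT by simp
    then show ?thesis using fG fT gdim_eq[OF P G] by (simp add: card_Plus card_cartesian_product)
  qed
  then show ?thesis by blast
qed

text \<open>Each row outside \<open>T\<close> can be corrected by \<open>T\<close> to have no
  entries in columns of order above \<open>i\<close> modulo \<open>P\<close>. This gives
  \<open>r * m - card T\<close> elements of \<open>P\<close> with independent gradients supported on
  order at most \<open>i\<close>, although they may involve higher variables.\<close>

lemma gdim_lower:
  assumes T: "row_basis P (cols m i) (rows m) T (\<lambda>x v. mpol_deriv v (F x))"
  shows "card (UNIV :: 'r set) * m \<le> gdim P (ord_le i) + card T"
proof -
  obtain G where G: "triangular P (ord_le i) G" using triangular_exists[OF P finite_ord_le] by blast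
  have "\<forall>x\<in>rows m - T. \<exists>c. c x \<notin> P \<and> (\<forall>j\<in>cols m i. c x * mpol_deriv j (F x) + (\<Sum>s\<in>T. c s * mpol_deriv j (F s)) \<in> P)"
    using T by (auto simp: row_basis_def)
  from bchoice[OF this] obtain c where cc: "\<forall>x\<in>rows m - T. c x x \<notin> P \<and>
    (\<forall>j\<in>cols m i. c x x * mpol_deriv j (F x) + (\<Sum>s\<in>T. c x s * mpol_deriv j (F s)) \<in> P)" ..
  have c: "c x x \<notin> P"
    "j \<in> cols m i \<Longrightarrow> c x x * mpol_deriv j (F x) + (\<Sum>s\<in>T. c x s * mpol_deriv j (F s)) \<in> P"
    if "x \<in> rows m - T" for x j
    using bspec[OF cc that] by auto
  have Tm: "T \<subseteq> rows m" using T by (simp add: row_basis_def)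
  then have fT: "finite T" by (rule finite_subset) auto
  define w where "w x = c x x * F x + (\<Sum>s\<in>T. c x s * F s)" for x
  have wP: "w x \<in> P" for x
    unfolding w_def using F_P by (intro prime_id_add[OF P] prime_id_sum[OF P] prime_id_mult_left[OF P])
  have "finite (\<Union>x\<in>rows m. mpol_vars (w x))" by (simp add: finite_mpol_vars)
  from finite_subset_ord_le[OF this] obtain K where K: "\<And>k. k \<ge> K \<Longrightarrow> (\<Union>x\<in>rows m. mpol_vars (w x)) \<subseteq> ord_le k"
    by blast
  \<comment> \<open>Large enough for the variables in the coefficients of \<open>w\<close>, for all
    columns below \<open>m + e\<close>, and for \<open>ord_le i\<close>.\<close>
  define L where "L = K + m + e + i"
  have wL: "w x \<in> polys (ord_le L)" if "x \<in> rows m" for x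
    using K[of L] that by (auto simp: polys_def L_def)
  have dw: "mpol_deriv u (w x) - (c x x * mpol_deriv u (F x) + (\<Sum>s\<in>T. c x s * mpol_deriv u (F s))) \<in> P" for x u
  proof -
    note d = derivation_on_mpol_deriv[of UNIV u]
    have "mpol_deriv u (w x) - (c x x * mpol_deriv u (F x) + (\<Sum>s\<in>T. c x s * mpol_deriv u (F s)))
      = F x * mpol_deriv u (c x x) + (\<Sum>s\<in>T. F s * mpol_deriv u (c x s))"
      by (simp add: w_def mpol_deriv_add mpol_deriv_mult derivation_sum[OF d] sum.distrib algebra_simps)
    also have "\<dots> \<in> P" using F_P by (intro prime_id_add[OF P] prime_id_sum[OF P] prime_id_mult_right[OF P])
    finally show ?thesis .
  qed
  have "card (rows m - T) \<le> card G"
  proof (rule triangular_card_ge[OF P G, where w = w and V' = "ord_le L"])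
    show "ord_le i \<subseteq> ord_le L" by (auto simp: ord_le_def L_def)
    show "w x \<in> P \<inter> polys (ord_le L)" if "x \<in> rows m - T" for x using wP wL that by auto
    show "mpol_deriv u (w x) \<in> P" if x: "x \<in> rows m - T" and u: "u \<in> ord_le L - ord_le i" for x u
    proof -
      have "c x x * mpol_deriv u (F x) + (\<Sum>s\<in>T. c x s * mpol_deriv u (F s)) \<in> P"
      proof (cases "u \<in> cols m i")
        case True
        then show ?thesis using c(2) x by blast
      next
        case False
        have "mpol_deriv u (F y) = 0" if "y \<in> rows m" for y
        proof -
          have "snd y < m" "m + e \<le> snd u" using that False u by (auto simp: ord_le_def)
          then show ?thesis using F_deriv_zero[of "snd y" "snd u" "fst u" "fst y"] by simp
        qed
        then have "mpol_deriv u (F x) = 0" "\<And>s. s \<in> T \<Longrightarrow> mpol_deriv u (F s) = 0" using x Tm by blast+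
        then show ?thesis using prime_id_zero[OF P] by simp
      qed
      from prime_id_add[OF P dw[of u x] this] show ?thesis by simp
    qed
    show "indep UNIV P (ord_le L) (rows m - T) (\<lambda>x u. mpol_deriv u (w x))"
      unfolding indep_def
    proof (intro allI impI ballI)
      fix d x assume d: "\<forall>u\<in>ord_le L. (\<Sum>x\<in>rows m - T. d x * mpol_deriv u (w x)) \<in> P" and x: "x \<in> rows m - T"
      \<comment> \<open>Substituting the definition of \<open>w\<close> turns a relation among the
        \<open>w x\<close> into one among all rows; outside \<open>T\<close> each coefficient is
        only multiplied by a denominator.\<close>
      let ?d = "\<lambda>y. if y \<in> T then (\<Sum>x\<in>rows m - T. d x * c x y) else d y * c y y"
      have "(\<Sum>y\<in>rows m. ?d y * mpol_deriv u (F y)) \<in> P" if u: "u \<in> {(j, l). l < m + e}" for u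
      proof -
        have "u \<in> ord_le L" using u by (auto simp: ord_le_def L_def)
        then have a: "(\<Sum>x\<in>rows m - T. d x * mpol_deriv u (w x)) \<in> P" using d by blast
        have b: "(\<Sum>x\<in>rows m - T. d x * (mpol_deriv u (w x)
            - (c x x * mpol_deriv u (F x) + (\<Sum>s\<in>T. c x s * mpol_deriv u (F s))))) \<in> P"
          using dw by (intro prime_id_sum[OF P] prime_id_mult_left[OF P])
        have "(\<Sum>y\<in>rows m. ?d y * mpol_deriv u (F y))
          = (\<Sum>y\<in>rows m - T. ?d y * mpol_deriv u (F y)) + (\<Sum>y\<in>T. ?d y * mpol_deriv u (F y))"
          using Tm by (intro sum.subset_diff) auto
        also have "(\<Sum>y\<in>rows m - T. ?d y * mpol_deriv u (F y)) = (\<Sum>x\<in>rows m - T. d x * (c x x * mpol_deriv u (F x)))"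
          by (intro sum.cong) auto
        also have "(\<Sum>y\<in>T. ?d y * mpol_deriv u (F y)) = (\<Sum>y\<in>T. \<Sum>x\<in>rows m - T. d x * c x y * mpol_deriv u (F y))"
          by (intro sum.cong) (auto simp: sum_distrib_right)
        also have "\<dots> = (\<Sum>x\<in>rows m - T. d x * (\<Sum>s\<in>T. c x s * mpol_deriv u (F s)))"
          by (subst sum.swap) (simp only: sum_distrib_left mult.assoc)
        also have "(\<Sum>x\<in>rows m - T. d x * (c x x * mpol_deriv u (F x))) + \<dots>
            = (\<Sum>x\<in>rows m - T. d x * mpol_deriv u (w x)) - (\<Sum>x\<in>rows m - T. d x * (mpol_deriv u (w x)
            - (c x x * mpol_deriv u (F x) + (\<Sum>s\<in>T. c x s * mpol_deriv u (F s)))))"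
          by (simp only: right_diff_distrib distrib_left sum_subtractf sum.distrib) simp
        also have "\<dots> \<in> P" by (rule prime_id_diff[OF P a b])
        finally show ?thesis .
      qed
      then have "?d x \<in> P" using f_indep[of m] x by (rule_tac indepD[OF f_indep[of m], where c = ?d]) auto
      then show "d x \<in> P" using x c(1)[OF x] by (simp add: prime_id_mult_iff[OF P])
    qed
  qed (auto simp: finite_ord_le)
  moreover have "card (rows m - T) = card (UNIV :: 'r set) * m - card T"
    using Tm fT by (simp add: card_Diff_subset card_cartesian_product)
  ultimately show ?thesis using gdim_eq[OF P G] by simp
qed

text \<open>Both halves of being a basis are carried over by applying \<open>S\<close> to witnesses:
  a pseudo-inverse for independence, dependence coefficients for spanning. Here
  \<open>sigma_P\<close> keeps denominators outside \<open>P\<close> and relations inside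
  it.\<close>

lemma row_basis_shift:
  assumes T: "row_basis P (cols m i) (rows m) T (\<lambda>x v. mpol_deriv v (F x))" and i: "e \<le> Suc i"
  shows "row_basis P (cols (Suc m) (Suc i)) (rows (Suc m)) (shift ` T) (\<lambda>x v. mpol_deriv v (F x))"
proof -
  interpret pu: prime_over_subring "UNIV :: ('n, 'k) dpol set" P
    by unfold_locales (rule subring_set_UNIV, rule P)
  have Tm: "T \<subseteq> rows m" "indep UNIV P (cols m i) T (\<lambda>x v. mpol_deriv v (F x))"
    using T by (auto simp: row_basis_def)
  then have fT: "finite T" by (rule_tac finite_subset[OF Tm(1)]) auto
  have cols: "cols (Suc m) (Suc i) = shift ` cols m i"
  proof -
    have "(j, l) \<in> shift ` cols m i" if "Suc i < l" "l < Suc m + e" for j l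
      using that by (intro image_eqI[of _ _ "(j, l - 1)"]) auto
    then show ?thesis by auto
  qed
  have sd: "mpol_deriv (shift u) (F (shift x)) = S (mpol_deriv u (F x))" for u x
    by (simp only: prolong_shift S_deriv)
  from pu.indep_pseudo_inverse[where M = "\<lambda>x v. mpol_deriv v (F x)", OF finite_cols fT UNIV_I Tm(2)]
  obtain N \<delta> where N: "\<delta> \<notin> P" "\<And>x y. x \<in> T \<Longrightarrow> y \<in> T \<Longrightarrow>
    (\<Sum>v\<in>cols m i. mpol_deriv v (F x) * N v y) = (if x = y then \<delta> else 0)" by blast
  \<comment> \<open>In the witness the subtraction of one from the order undoes
    \<open>shift\<close>; all columns concerned have positive order.\<close>
  have "indep UNIV P (shift ` cols m i) T (\<lambda>x v. mpol_deriv v (F (shift x)))"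
  proof (rule pu.pseudo_inverse_indep[OF fT, where \<delta> = "S \<delta>" and N = "\<lambda>v y. S (N (fst v, snd v - 1) y)"])
    show "S \<delta> \<notin> P" using N sigma_P by simp
    fix x y assume xy: "x \<in> T" "y \<in> T"
    have "(\<Sum>v\<in>shift ` cols m i. mpol_deriv v (F (shift x)) * S (N (fst v, snd v - 1) y))
        = (\<Sum>v\<in>cols m i. S (mpol_deriv v (F x) * N v y))"
      unfolding sum.reindex[OF inj_shift] comp_def sd S_simps by (intro sum.cong) auto
    also have "\<dots> = S (if x = y then \<delta> else 0)"
      unfolding S_simps(3)[symmetric] N(2)[OF xy] ..
    finally show "(\<Sum>v\<in>shift ` cols m i. mpol_deriv v (F (shift x)) * S (N (fst v, snd v - 1) y))
        = (if x = y then S \<delta> else 0)" by (simp add: S_simps)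
  qed
  then have ind: "indep UNIV P (shift ` cols m i) (shift ` T) (\<lambda>x v. mpol_deriv v (F x))"
    by (simp only: indep_reindex[OF inj_shift])
  have "\<exists>c. c x \<notin> P \<and> (\<forall>j\<in>shift ` cols m i. c x * mpol_deriv j (F x) + (\<Sum>s\<in>shift ` T. c s * mpol_deriv j (F s)) \<in> P)"
    if x: "x \<in> rows (Suc m) - shift ` T" for x
  proof (cases "snd x")
    case 0
    \<comment> \<open>An unprolonged equation has order at most \<open>e\<close>, and the shifted
      columns start above \<open>Suc i\<close>, so its row is zero and depends on nothing.\<close>
    let ?c = "\<lambda>y. if y = x then 1 else 0 :: ('n, 'k) dpol"
    have "?c x * mpol_deriv u (F x) + (\<Sum>s\<in>shift ` T. ?c s * mpol_deriv u (F s)) = 0"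
      if "u \<in> shift ` cols m i" for u
    proof -
      have "snd u > e" using that i by auto
      moreover have "F x = F (fst x, 0)" using 0 by (simp add: prolong_def)
      ultimately have "mpol_deriv u (F x) = 0"
        using F_deriv_zero[of 0 "snd u" "fst u" "fst x"] by simp
      moreover have "(\<Sum>s\<in>shift ` T. ?c s * mpol_deriv u (F s)) = 0"
        using x by (intro sum.neutral) auto
      ultimately show ?thesis by simp
    qed
    then show ?thesis using prime_id_one[OF P] prime_id_zero[OF P] by (intro exI[of _ ?c]) simp
  next
    case (Suc l)
    define y where "y = (fst x, l)"
    have xy: "x = shift y" using Suc by (auto simp: y_def prod_eq_iff)
    have "snd x < Suc m" using x by auto
    then have "y \<in> rows m" using Suc by (simp add: y_def)
    moreover have "y \<notin> T"
    proof
      assume "y \<in> T"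
      then have "x \<in> shift ` T" unfolding xy by (rule imageI)
      then show False using x by blast
    qed
    ultimately have y: "y \<in> rows m - T" by (rule DiffI)
    have "\<forall>y\<in>rows m - T. \<exists>c. c y \<notin> P \<and>
        (\<forall>j\<in>cols m i. c y * mpol_deriv j (F y) + (\<Sum>s\<in>T. c s * mpol_deriv j (F s)) \<in> P)"
      using T unfolding row_basis_def by (elim conjE)
    from bspec[OF this y] obtain c where cc: "c y \<notin> P \<and>
        (\<forall>j\<in>cols m i. c y * mpol_deriv j (F y) + (\<Sum>s\<in>T. c s * mpol_deriv j (F s)) \<in> P)" ..
    then have c: "c y \<notin> P"
      "\<And>j. j \<in> cols m i \<Longrightarrow> c y * mpol_deriv j (F y) + (\<Sum>s\<in>T. c s * mpol_deriv j (F s)) \<in> P"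
      by auto
    let ?c = "\<lambda>z. S (c (fst z, snd z - 1))"
    have cs: "?c (shift z) = S (c z)" for z by (simp add: case_prod_unfold)
    show ?thesis
    proof (intro exI[of _ ?c] conjI ballI)
      show "?c x \<notin> P" unfolding xy cs using c(1) sigma_P by simp
      fix u assume "u \<in> shift ` cols m i"
      then obtain j where j: "j \<in> cols m i" "u = shift j" by blast
      have "?c x * mpol_deriv u (F x) + (\<Sum>s\<in>shift ` T. ?c s * mpol_deriv u (F s))
          = S (c y * mpol_deriv j (F y) + (\<Sum>s\<in>T. c s * mpol_deriv j (F s)))"
        unfolding sum.reindex[OF inj_shift] comp_def j(2) xy sd cs S_simps ..
      then show "?c x * mpol_deriv u (F x) + (\<Sum>s\<in>shift ` T. ?c s * mpol_deriv u (F s)) \<in> P"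
        using c(2)[OF j(1)] sigma_P by simp
    qed
  qed
  moreover have "shift ` T \<subseteq> rows (Suc m)" using Tm(1) by auto
  ultimately show ?thesis unfolding row_basis_def cols using ind by blast
qed

text \<open>The upper and lower bounds pin down \<open>gdim\<close> at \<open>i\<close> and at
  \<open>Suc i\<close> for large numbers of rows; comparing \<open>m\<close> rows with
  \<open>Suc m\<close> rows leaves one block of \<open>r\<close> rows, because the row bases have
  equal size.\<close>

lemma gdim_Suc:
  assumes i: "e \<le> Suc i"
  shows "gdim P (ord_le (Suc i)) = gdim P (ord_le i) + card (UNIV :: 'r set)"
proof -
  have ex: "\<exists>T. row_basis P (cols m j) (rows m) T (\<lambda>x v. mpol_deriv v (F x))" for m j
    by (rule row_basis_exists[OF P]) auto
  have "\<forall>m. \<exists>T. row_basis P (cols m i) (rows m) T (\<lambda>x v. mpol_deriv v (F x))" using ex by blast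
  from choice[OF this] obtain T where T: "\<And>m. row_basis P (cols m i) (rows m) (T m) (\<lambda>x v. mpol_deriv v (F x))"
    by blast
  \<comment> \<open>The bases for \<open>Suc i\<close> are chosen as shifts of those for
    \<open>i\<close>; the case of no rows has no predecessor and takes any basis.\<close>
  have "\<exists>T'. row_basis P (cols m (Suc i)) (rows m) T' (\<lambda>x v. mpol_deriv v (F x)) \<and> (\<forall>k. m = Suc k \<longrightarrow> T' = shift ` T k)" for m
    using ex[of "Suc i" 0] row_basis_shift[OF T i] by (cases m) auto
  then have "\<forall>m. \<exists>T'. row_basis P (cols m (Suc i)) (rows m) T' (\<lambda>x v. mpol_deriv v (F x)) \<and> (\<forall>k. m = Suc k \<longrightarrow> T' = shift ` T k)" ..
  from choice[OF this] obtain T' where T': "\<And>m. row_basis P (cols m (Suc i)) (rows m) (T' m) (\<lambda>x v. mpol_deriv v (F x))"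
    "\<And>k. T' (Suc k) = shift ` T k" by blast
  obtain M where M: "\<And>m. m \<ge> M \<Longrightarrow> gdim P (ord_le i) + card (T m) \<le> card (UNIV :: 'r set) * m"
    using gdim_upper[OF T] by blast
  obtain M' where M': "\<And>m. m \<ge> M' \<Longrightarrow> gdim P (ord_le (Suc i)) + card (T' m) \<le> card (UNIV :: 'r set) * m"
    using gdim_upper[OF T'(1)] by blast
  let ?m = "max M M'"
  have m': "M' \<le> Suc ?m" by (rule le_SucI) simp
  have "card (T' (Suc ?m)) = card (T ?m)" unfolding T'(2) by (rule card_image[OF inj_shift])
  then show ?thesis
    using M[of ?m] M'[OF m'] gdim_lower[OF T, of ?m] gdim_lower[OF T'(1), of "Suc ?m"] by simp
qed

lemma dimension_growth:
  assumes e: "e \<ge> 1"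
  shows "\<exists>T C. card T + card (UNIV :: 'r set) = card (UNIV :: 'n set) \<and> (\<forall>i\<ge>e - 1. gdim P (ord_le i) + C = card (UNIV :: 'r set) * (i + 1))
    \<and> (\<forall>p\<in>P \<inter> polys (T \<times> UNIV). p = 0)
    \<and> (\<forall>i. \<exists>U\<subseteq>ord_le i. card U + gdim P (ord_le i) = card (UNIV :: 'n set) * (i + 1) \<and> (\<forall>p\<in>P \<inter> polys U. p = 0))"
proof -
  let ?n = "card (UNIV :: 'n set)"
  obtain idx :: "'n \<Rightarrow> nat" where idx: "bij_betw idx UNIV {..<?n}"
    using ex_bij_betw_finite_nat[OF finite_UNIV] by (metis atLeast0LessThan)
  then have idx_less: "idx j < ?n" for j by (auto simp: bij_betw_def)
  have idx_inj: "idx j = idx k \<longleftrightarrow> j = k" for j k using idx by (auto simp: bij_betw_def inj_eq)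
  \<comment> \<open>Variables are ordered first by order, then by index. Each
    \<open>ord_le i\<close> is then an initial segment, and \<open>shift\<close> adds the constant
    \<open>?n\<close> to the position.\<close>
  define \<rho> where "\<rho> v = snd v * ?n + idx (fst v)" for v :: "'n \<times> nat"
  have \<rho>_div: "\<rho> v div ?n = snd v" "\<rho> v mod ?n = idx (fst v)" for v
    using idx_less[of "fst v"] by (simp_all add: \<rho>_def)
  have \<rho>: "inj \<rho>"
    by (rule injI) (metis \<rho>_div idx_inj prod_eq_iff)
  have init: "ord_le i = {u. \<rho> u < Suc i * ?n}" for i
  proof -
    have "\<rho> u < Suc i * ?n \<longleftrightarrow> snd u \<le> i" for u
      using div_less_iff_less_mult[of ?n "\<rho> u" "Suc i"] \<rho>_div(1)[of u]
      by (simp add: less_Suc_eq_le card_gt_0_iff)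
    then show ?thesis by (auto simp: ord_le_def)
  qed
  define alg where "alg v \<longleftrightarrow> alg_over P {u. \<rho> u < \<rho> v} v" for v
  have gd: "gdim P (ord_le i) = card {v \<in> ord_le i. alg v}" for i
    unfolding init gdim_initial[OF P \<rho>] alg_def by simp
  have indep_nonalg: "p = 0" if "p \<in> P" "p \<in> polys {v \<in> ord_le i. \<not> alg v}" for p i
    using nonalg_independent[OF P \<rho>, of p "Suc i * ?n"] that by (simp add: init alg_def)
  \<comment> \<open>\<open>S\<close> carries a witness of algebraicity to one for the shifted
    variable: it commutes with the derivatives, respects the order of variables, and preserves
    membership in \<open>P\<close> both ways.\<close>
  have alg_shift: "alg (shift v)" if "alg v" for v
  proof -
    from that obtain g where g: "g \<in> P" "g \<in> polys (insert v {u. \<rho> u < \<rho> v})" "mpol_deriv v g \<notin> P"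
      by (auto simp: alg_def alg_over_def)
    have "\<rho> (shift u) = \<rho> u + ?n" for u by (simp add: \<rho>_def case_prod_unfold)
    then have "shift ` insert v {u. \<rho> u < \<rho> v} \<subseteq> insert (shift v) {u. \<rho> u < \<rho> (shift v)}" by auto
    then have "S g \<in> polys (insert (shift v) {u. \<rho> u < \<rho> (shift v)})"
      using S_polys[OF g(2)] polys_mono by blast
    moreover have "mpol_deriv (shift v) (S g) \<notin> P" unfolding S_deriv sigma_P by (rule g(3))
    ultimately show ?thesis using g(1) sigma_P unfolding alg_def alg_over_def by blast
  qed
  \<comment> \<open>The indices algebraic at order \<open>l\<close>. They increase with
    \<open>l\<close>, and from \<open>l = e\<close> on there are exactly \<open>r\<close> of them,
    so the set is constant from there.\<close>
  define A where "A l = {j. alg (j, l)}" for l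
  have A_mono: "A l \<subseteq> A k" if "l \<le> k" for l k
    using lift_Suc_mono_le[of A, OF _ that] alg_shift unfolding A_def by fastforce
  have count: "gdim P (ord_le i) = (\<Sum>l\<le>i. card (A l))" for i
  proof -
    have "{v \<in> ord_le i. alg v} = (\<lambda>(l, j). (j, l)) ` (SIGMA l:{..i}. A l)"
      by (auto simp: ord_le_def A_def)
    then have "gdim P (ord_le i) = card (SIGMA l:{..i}. A l)"
      unfolding gd by (simp add: card_image inj_on_def)
    then show ?thesis by simp
  qed
  have cardA: "card (A l) = card (UNIV :: 'r set)" if "l \<ge> e" for l
    using that gdim_Suc[of "l - 1"] count[of l] count[of "l - 1"] e by (cases l) auto
  \<comment> \<open>Indices whose variables stay non-algebraic in every order: all their transforms
    together are algebraically independent modulo \<open>P\<close>.\<close>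
  define T where "T = - A e"
  have "card T + card (A e) = ?n"
    unfolding T_def using card_Un_disjoint[of "- A e" "A e"] by simp
  then have cT: "card T + card (UNIV :: 'r set) = ?n" using cardA by simp
  have T_nonalg: "\<not> alg (j, l)" if j: "j \<in> T" for j l
  proof
    assume "alg (j, l)"
    then have "j \<in> A (max l e)" using A_mono[of l "max l e"] by (auto simp: A_def)
    moreover have "A e = A (max l e)"
      using A_mono[of e "max l e"] cardA[of e] cardA[of "max l e"] by (intro card_subset_eq) auto
    ultimately show False using j by (simp add: T_def)
  qed
  have A_le: "card (A l) \<le> card (UNIV :: 'r set)" for l
    using card_mono[OF _ A_mono[of l "max l e"]] cardA[of "max l e"] by simp
  have le: "gdim P (ord_le i) \<le> card (UNIV :: 'r set) * (i + 1)" for i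
    unfolding count using sum_bounded_above[of "{..i}" "\<lambda>l. card (A l)" "card (UNIV :: 'r set)"] A_le by (simp add: mult.commute)
  \<comment> \<open>Chosen to make the formula hold at \<open>i = e - 1\<close>; it will turn out to
    be the order of \<open>P\<close>. The subtraction is a true one by \<open>le\<close>.\<close>
  define C where "C = card (UNIV :: 'r set) * e - gdim P (ord_le (e - 1))"
  have C: "gdim P (ord_le i) + C = card (UNIV :: 'r set) * (i + 1)" if "i \<ge> e - 1" for i
    using that
  proof (induction rule: nat_induct_at_least)
    case base
    then show ?case using le[of "e - 1"] e by (simp add: C_def)
  next
    case (Suc i)
    then show ?case using gdim_Suc[of i] e by simp
  qed
  have ind: "p = 0" if p: "p \<in> P \<inter> polys (T \<times> UNIV)" for p
  proof -
    obtain K where "mpol_vars p \<subseteq> ord_le K" using finite_subset_ord_le[OF finite_mpol_vars[of p]] by blast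
    then have "p \<in> polys {v \<in> ord_le K. \<not> alg v}"
      using p T_nonalg by (fastforce simp: polys_def)
    then show ?thesis using indep_nonalg p by blast
  qed
  have U: "\<exists>U\<subseteq>ord_le i. card U + gdim P (ord_le i) = ?n * (i + 1) \<and> (\<forall>p\<in>P \<inter> polys U. p = 0)" for i
  proof (intro exI[of _ "{v \<in> ord_le i. \<not> alg v}"] conjI ballI)
    have "card {v \<in> ord_le i. \<not> alg v} + card {v \<in> ord_le i. alg v} = card (ord_le i :: ('n \<times> nat) set)"
      using finite_ord_le[where 'n = 'n]
      by (subst card_Un_disjoint[symmetric]) (auto intro!: arg_cong[of _ _ card])
    then show "card {v \<in> ord_le i. \<not> alg v} + gdim P (ord_le i) = ?n * (i + 1)"
      by (simp only: gd card_ord_le)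
  qed (use indep_nonalg in auto)
  show ?thesis using cT C ind U by blast
qed

end

section \<open>Localizations through numerators and denominators\<close>

text \<open>The ring \<open>R\<close> is presented as the image under \<open>\<pi>\<close> of a subring \<open>B\<close> of a commutative ring type,
  with kernel \<open>K\<close>; \<open>D\<close> is a set of representatives of the denominators.\<close>

locale presented_localization = R?: cring R
  for R :: "('c, 'm) ring_scheme" (structure) +
  fixes \<pi> :: "'a::comm_ring_1 \<Rightarrow> 'c" and B D K :: "'a set"
  assumes B: "subring_set B" and D_subset: "D \<subseteq> B" and D_one: "1 \<in> D"
    and D_mult: "\<And>s t. s \<in> D \<Longrightarrow> t \<in> D \<Longrightarrow> s * t \<in> D" and K: "ideal_in B K"
    and carrier_R: "carrier R = \<pi> ` B"
    and pi_mult: "\<And>a b. a \<in> B \<Longrightarrow> b \<in> B \<Longrightarrow> \<pi> (a * b) = \<pi> a \<otimes> \<pi> b"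
    and pi_add: "\<And>a b. a \<in> B \<Longrightarrow> b \<in> B \<Longrightarrow> \<pi> (a + b) = \<pi> a \<oplus> \<pi> b"
    and pi_one: "\<pi> 1 = \<one>"
    and pi_zero_iff: "\<And>a. a \<in> B \<Longrightarrow> \<pi> a = \<zero> \<longleftrightarrow> a \<in> K"
begin

abbreviation L where "L \<equiv> localization R (\<pi> ` D)"

definition frac :: "'a \<Rightarrow> 'a \<Rightarrow> ('c \<times> 'c) set" where
  "frac a s = loc_frac R (\<pi> ` D) (\<pi> a) (\<pi> s)"

lemma pi_closed: "a \<in> B \<Longrightarrow> \<pi> a \<in> carrier R"
  by (simp add: carrier_R)

lemma D_B: "s \<in> D \<Longrightarrow> s \<in> B"
  using D_subset by blast

lemmas B_intros = subring_set_mult[OF B] subring_set_add[OF B] subring_set_diff[OF B]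
  subring_set_uminus[OF B] subring_set_one[OF B] subring_set_zero[OF B] D_mult D_one
lemmas B_simps = B_intros D_B

lemma K_comb: "p \<in> B \<Longrightarrow> x \<in> K \<Longrightarrow> q \<in> B \<Longrightarrow> y \<in> K \<Longrightarrow> p * x + q * y \<in> K"
  using ideal_inD(3,4)[OF K] by blast

lemma pi_minus:
  assumes "a \<in> B" "b \<in> B"
  shows "\<pi> (a - b) = \<pi> a \<ominus> \<pi> b"
proof -
  have ab: "a - b \<in> B" using assms by (auto intro!: B_intros)
  have "\<pi> a = \<pi> (a - b) \<oplus> \<pi> b" using pi_add[OF ab assms(2)] by simp
  then show ?thesis
    using pi_closed[OF ab] pi_closed[OF assms(2)] by (simp add: a_minus_def a_assoc r_neg)
qed

lemma loc_rel_iff: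
  assumes "a \<in> B" "s \<in> D" "b \<in> B" "t \<in> D"
  shows "((\<pi> a, \<pi> s), (\<pi> b, \<pi> t)) \<in> loc_rel R (\<pi> ` D) \<longleftrightarrow> (\<exists>u\<in>D. u * (a * t - b * s) \<in> K)"
proof -
  have "\<pi> u \<otimes> (\<pi> a \<otimes> \<pi> t \<ominus> \<pi> b \<otimes> \<pi> s) = \<pi> (u * (a * t - b * s))" if "u \<in> D" for u
    using assms that by (simp add: pi_mult pi_minus B_simps)
  moreover have "u * (a * t - b * s) \<in> B" if "u \<in> D" for u
    using assms that by (auto intro!: B_intros simp: D_B)
  ultimately show ?thesis
    using assms by (auto simp: loc_rel_def pi_closed pi_zero_iff D_B)
qed

lemma loc_rel_cases:
  assumes "(x, y) \<in> loc_rel R (\<pi> ` D)"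
  obtains a s b t u where "a \<in> B" "s \<in> D" "b \<in> B" "t \<in> D" "x = (\<pi> a, \<pi> s)" "y = (\<pi> b, \<pi> t)"
    "u \<in> D" "u * (a * t - b * s) \<in> K"
proof -
  from assms obtain a s b t where ab: "a \<in> B" "s \<in> D" "b \<in> B" "t \<in> D" "x = (\<pi> a, \<pi> s)" "y = (\<pi> b, \<pi> t)"
    by (auto simp: loc_rel_def carrier_R)
  then show ?thesis using that assms loc_rel_iff[OF ab(1-4)] by blast
qed

lemma equiv_loc_rel: "equiv (carrier R \<times> \<pi> ` D) (loc_rel R (\<pi> ` D))"
proof (rule equivI)
  show "loc_rel R (\<pi> ` D) \<subseteq> (carrier R \<times> \<pi> ` D) \<times> (carrier R \<times> \<pi> ` D)"
    by (auto simp: loc_rel_def)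
  show "refl_on (carrier R \<times> \<pi> ` D) (loc_rel R (\<pi> ` D))"
    using D_one ideal_inD(2)[OF K] by (auto simp: refl_on_def carrier_R loc_rel_iff)
  show "sym (loc_rel R (\<pi> ` D))"
  proof (rule symI)
    fix x y assume "(x, y) \<in> loc_rel R (\<pi> ` D)"
    then obtain a s b t u where h: "a \<in> B" "s \<in> D" "b \<in> B" "t \<in> D" "x = (\<pi> a, \<pi> s)" "y = (\<pi> b, \<pi> t)"
      "u \<in> D" "u * (a * t - b * s) \<in> K" by (rule loc_rel_cases)
    have "u * (b * s - a * t) = - (u * (a * t - b * s))" by (simp add: algebra_simps)
    then have "u * (b * s - a * t) \<in> K" using h ideal_in_uminus[OF B K] by simp
    then show "(y, x) \<in> loc_rel R (\<pi> ` D)" using h loc_rel_iff by blast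
  qed
  show "trans (loc_rel R (\<pi> ` D))"
  proof (rule transI)
    fix x y z assume "(x, y) \<in> loc_rel R (\<pi> ` D)" and yz: "(y, z) \<in> loc_rel R (\<pi> ` D)"
    then obtain a s b t u where h: "a \<in> B" "s \<in> D" "b \<in> B" "t \<in> D" "x = (\<pi> a, \<pi> s)" "y = (\<pi> b, \<pi> t)"
      "u \<in> D" "u * (a * t - b * s) \<in> K" by (elim loc_rel_cases)
    from yz obtain c w where cw: "c \<in> B" "w \<in> D" "z = (\<pi> c, \<pi> w)"
      by (auto simp: loc_rel_def carrier_R)
    then obtain v where v: "v \<in> D" "v * (b * w - c * t) \<in> K" using yz h loc_rel_iff by blast
    \<comment> \<open>The middle denominator \<open>t\<close> enters the multiplier, because
      elements of \<open>D\<close> need not be cancellable.\<close>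
    have "(u * v * t) * (a * w - c * s) = (v * w) * (u * (a * t - b * s)) + (u * s) * (v * (b * w - c * t))"
      by (simp add: algebra_simps)
    also have "\<dots> \<in> K" by (rule K_comb) (use h cw v in \<open>auto intro!: B_intros simp: D_B\<close>)
    finally have "(u * v * t) * (a * w - c * s) \<in> K" .
    then show "(x, z) \<in> loc_rel R (\<pi> ` D)" using h cw v D_mult loc_rel_iff[of a s c w] by blast
  qed
qed

lemma frac_eq_iff:
  assumes "a \<in> B" "s \<in> D" "b \<in> B" "t \<in> D"
  shows "frac a s = frac b t \<longleftrightarrow> (\<exists>u\<in>D. u * (a * t - b * s) \<in> K)"
  unfolding frac_def loc_frac_def loc_rel_iff[OF assms, symmetric]
  by (rule eq_equiv_class_iff[OF equiv_loc_rel]) (use assms in \<open>auto simp: pi_closed\<close>)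

lemma frac_eqI: "a \<in> B \<Longrightarrow> s \<in> D \<Longrightarrow> b \<in> B \<Longrightarrow> t \<in> D \<Longrightarrow> a * t = b * s \<Longrightarrow> frac a s = frac b t"
  using D_one ideal_inD(2)[OF K] by (subst frac_eq_iff) auto

lemma carrier_L: "carrier L = {frac a s | a s. a \<in> B \<and> s \<in> D}"
  unfolding localization_def frac_def loc_frac_def by (auto simp: quotient_def carrier_R)

lemma frac_closed: "a \<in> B \<Longrightarrow> s \<in> D \<Longrightarrow> frac a s \<in> carrier L"
  unfolding carrier_L by blast

lemma frac_cases:
  assumes "x \<in> carrier L"
  obtains a s where "a \<in> B" "s \<in> D" "x = frac a s"
  using assms unfolding carrier_L by blast

lemma frac_one: "\<one>\<^bsub>L\<^esub> = frac 1 1"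
  by (simp add: localization_def frac_def pi_one)

lemma frac_zero: "\<zero>\<^bsub>L\<^esub> = frac 0 1"
  using pi_zero_iff[of 0] ideal_inD(2)[OF K] B_intros by (simp add: localization_def frac_def pi_one)

lemma frac_mult:
  assumes "a \<in> B" "s \<in> D" "b \<in> B" "t \<in> D"
  shows "frac a s \<otimes>\<^bsub>L\<^esub> frac b t = frac (a * b) (s * t)"
proof -
  let ?h = "\<lambda>x y. loc_frac R (\<pi> ` D) (fst x \<otimes> fst y) (snd x \<otimes> snd y)"
  have cong: "congruent2 (loc_rel R (\<pi> ` D)) (loc_rel R (\<pi> ` D)) ?h"
  proof (rule congruent2I')
    fix x x' y y' assume "(x, x') \<in> loc_rel R (\<pi> ` D)" and yy: "(y, y') \<in> loc_rel R (\<pi> ` D)"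
    then obtain a s a' s' u where h: "a \<in> B" "s \<in> D" "a' \<in> B" "s' \<in> D" "x = (\<pi> a, \<pi> s)" "x' = (\<pi> a', \<pi> s')"
      "u \<in> D" "u * (a * s' - a' * s) \<in> K" by (elim loc_rel_cases)
    from yy obtain b t b' t' v where k: "b \<in> B" "t \<in> D" "b' \<in> B" "t' \<in> D" "y = (\<pi> b, \<pi> t)" "y' = (\<pi> b', \<pi> t')"
      "v \<in> D" "v * (b * t' - b' * t) \<in> K" by (elim loc_rel_cases)
    have "(u * v) * ((a * b) * (s' * t') - (a' * b') * (s * t))
      = (v * b * t') * (u * (a * s' - a' * s)) + (u * a' * s) * (v * (b * t' - b' * t))"
      by (simp add: algebra_simps)
    also have "\<dots> \<in> K" by (rule K_comb) (use h k in \<open>auto intro!: B_intros simp: D_B\<close>)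
    finally have "(u * v) * ((a * b) * (s' * t') - (a' * b') * (s * t)) \<in> K" .
    then have "frac (a * b) (s * t) = frac (a' * b') (s' * t')"
      using h k by (subst frac_eq_iff) (auto intro!: B_intros simp: D_B)
    then show "?h x y = ?h x' y'" using h k by (simp add: frac_def pi_mult D_B)
  qed
  have "frac a s \<otimes>\<^bsub>L\<^esub> frac b t = (\<Union>x\<in>frac a s. \<Union>y\<in>frac b t. ?h x y)"
    by (simp add: localization_def case_prod_unfold)
  also have "\<dots> = ?h (\<pi> a, \<pi> s) (\<pi> b, \<pi> t)"
    unfolding frac_def loc_frac_def[of _ _ "\<pi> a"] loc_frac_def[of _ _ "\<pi> b"]
    using assms by (intro UN_equiv_class2[OF equiv_loc_rel equiv_loc_rel cong]) (auto simp: pi_closed)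
  also have "\<dots> = frac (a * b) (s * t)" using assms by (simp add: frac_def pi_mult D_B)
  finally show ?thesis .
qed

lemma frac_add:
  assumes "a \<in> B" "s \<in> D" "b \<in> B" "t \<in> D"
  shows "frac a s \<oplus>\<^bsub>L\<^esub> frac b t = frac (a * t + b * s) (s * t)"
proof -
  let ?h = "\<lambda>x y. loc_frac R (\<pi> ` D) (fst x \<otimes> snd y \<oplus> fst y \<otimes> snd x) (snd x \<otimes> snd y)"
  have cong: "congruent2 (loc_rel R (\<pi> ` D)) (loc_rel R (\<pi> ` D)) ?h"
  proof (rule congruent2I')
    fix x x' y y' assume "(x, x') \<in> loc_rel R (\<pi> ` D)" and yy: "(y, y') \<in> loc_rel R (\<pi> ` D)"
    then obtain a s a' s' u where h: "a \<in> B" "s \<in> D" "a' \<in> B" "s' \<in> D" "x = (\<pi> a, \<pi> s)" "x' = (\<pi> a', \<pi> s')"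
      "u \<in> D" "u * (a * s' - a' * s) \<in> K" by (elim loc_rel_cases)
    from yy obtain b t b' t' v where k: "b \<in> B" "t \<in> D" "b' \<in> B" "t' \<in> D" "y = (\<pi> b, \<pi> t)" "y' = (\<pi> b', \<pi> t')"
      "v \<in> D" "v * (b * t' - b' * t) \<in> K" by (elim loc_rel_cases)
    have "(u * v) * ((a * t + b * s) * (s' * t') - (a' * t' + b' * s') * (s * t))
      = (v * t * t') * (u * (a * s' - a' * s)) + (u * s * s') * (v * (b * t' - b' * t))"
      by (simp add: algebra_simps)
    also have "\<dots> \<in> K" by (rule K_comb) (use h k in \<open>auto intro!: B_intros simp: D_B\<close>)
    finally have "(u * v) * ((a * t + b * s) * (s' * t') - (a' * t' + b' * s') * (s * t)) \<in> K" .
    then have "frac (a * t + b * s) (s * t) = frac (a' * t' + b' * s') (s' * t')"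
      using h k by (subst frac_eq_iff) (auto intro!: B_intros simp: D_B)
    then show "?h x y = ?h x' y'" using h k by (simp add: frac_def pi_mult pi_add B_simps)
  qed
  have "frac a s \<oplus>\<^bsub>L\<^esub> frac b t = (\<Union>x\<in>frac a s. \<Union>y\<in>frac b t. ?h x y)"
    by (simp add: localization_def case_prod_unfold)
  also have "\<dots> = ?h (\<pi> a, \<pi> s) (\<pi> b, \<pi> t)"
    unfolding frac_def loc_frac_def[of _ _ "\<pi> a"] loc_frac_def[of _ _ "\<pi> b"]
    using assms by (intro UN_equiv_class2[OF equiv_loc_rel equiv_loc_rel cong]) (auto simp: pi_closed)
  also have "\<dots> = frac (a * t + b * s) (s * t)" using assms by (simp add: frac_def pi_mult pi_add B_simps)
  finally show ?thesis .
qed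

text \<open>Independence of the chosen fraction holds because \<open>\<tau>\<close> maps
  denominators to denominators and relations in \<open>K\<close> to relations in
  \<open>K\<close>.\<close>

lemma loc_endo_frac:
  assumes \<tau>: "\<And>x. x \<in> B \<Longrightarrow> \<tau> x \<in> B" "\<And>x. x \<in> D \<Longrightarrow> \<tau> x \<in> D" "\<And>x. x \<in> K \<Longrightarrow> \<tau> x \<in> K"
      "\<And>x y. \<tau> (x * y) = \<tau> x * \<tau> y" "\<And>x y. \<tau> (x - y) = \<tau> x - \<tau> y"
    and \<theta>: "\<And>x. x \<in> B \<Longrightarrow> \<theta> (\<pi> x) = \<pi> (\<tau> x)" and as: "a \<in> B" "s \<in> D"
  shows "loc_endo R (\<pi> ` D) \<theta> (frac a s) = frac (\<tau> a) (\<tau> s)"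
proof -
  let ?h = "\<lambda>x. loc_frac R (\<pi> ` D) (\<theta> (fst x)) (\<theta> (snd x))"
  have "congruent (loc_rel R (\<pi> ` D)) ?h"
  proof (rule congruentI)
    fix x x' assume "(x, x') \<in> loc_rel R (\<pi> ` D)"
    then obtain a s a' s' u where h: "a \<in> B" "s \<in> D" "a' \<in> B" "s' \<in> D" "x = (\<pi> a, \<pi> s)" "x' = (\<pi> a', \<pi> s')"
      "u \<in> D" "u * (a * s' - a' * s) \<in> K" by (elim loc_rel_cases)
    have "\<tau> u * (\<tau> a * \<tau> s' - \<tau> a' * \<tau> s) \<in> K" using \<tau>(3)[OF h(8)] by (simp add: \<tau>(4,5))
    then have "frac (\<tau> a) (\<tau> s) = frac (\<tau> a') (\<tau> s')"
      using h \<tau>(1,2) by (subst frac_eq_iff) auto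
    then show "?h x = ?h x'" using h by (simp add: frac_def \<theta> D_B)
  qed
  from UN_equiv_class[OF equiv_loc_rel this, of "(\<pi> a, \<pi> s)"]
  show ?thesis using as by (simp add: loc_endo_def case_prod_unfold frac_def loc_frac_def[of _ _ "\<pi> a"] pi_closed \<theta> D_B)
qed

lemma cring_L: "cring L"
proof (rule cringI)
  show "abelian_group L"
  proof (rule abelian_groupI)
    fix x y z assume "x \<in> carrier L" "y \<in> carrier L" "z \<in> carrier L"
    then obtain a s b t c u where h: "a \<in> B" "s \<in> D" "x = frac a s" "b \<in> B" "t \<in> D" "y = frac b t"
      "c \<in> B" "u \<in> D" "z = frac c u" by (elim frac_cases)
    have "x \<oplus>\<^bsub>L\<^esub> y \<oplus>\<^bsub>L\<^esub> z = frac ((a * t + b * s) * u + c * (s * t)) ((s * t) * u)"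
      unfolding h(3,6,9) frac_add[OF h(1,2,4,5)]
      by (rule frac_add) (use h in \<open>auto intro!: B_intros simp: D_B\<close>)
    also have "\<dots> = frac (a * (t * u) + (b * u + c * t) * s) (s * (t * u))"
      by (rule arg_cong2[of _ _ _ _ frac]) (simp_all add: algebra_simps)
    also have "\<dots> = x \<oplus>\<^bsub>L\<^esub> (y \<oplus>\<^bsub>L\<^esub> z)"
      unfolding h(3,6,9) frac_add[OF h(4,5,7,8)]
      by (rule frac_add[symmetric]) (use h in \<open>auto intro!: B_intros simp: D_B\<close>)
    finally show "x \<oplus>\<^bsub>L\<^esub> y \<oplus>\<^bsub>L\<^esub> z = x \<oplus>\<^bsub>L\<^esub> (y \<oplus>\<^bsub>L\<^esub> z)" .
  next
    fix x y assume "x \<in> carrier L" "y \<in> carrier L"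
    then obtain a s b t where h: "a \<in> B" "s \<in> D" "x = frac a s" "b \<in> B" "t \<in> D" "y = frac b t"
      by (elim frac_cases)
    show "x \<oplus>\<^bsub>L\<^esub> y \<in> carrier L" using h by (simp add: frac_add frac_closed B_simps)
    show "x \<oplus>\<^bsub>L\<^esub> y = y \<oplus>\<^bsub>L\<^esub> x"
      unfolding h(3,6) frac_add[OF h(1,2,4,5)] frac_add[OF h(4,5,1,2)]
      by (rule arg_cong2[of _ _ _ _ frac]) (simp_all add: algebra_simps)
  next
    show "\<zero>\<^bsub>L\<^esub> \<in> carrier L" unfolding frac_zero by (intro frac_closed B_intros)
  next
    fix x assume "x \<in> carrier L"
    then obtain a s where h: "a \<in> B" "s \<in> D" "x = frac a s" by (elim frac_cases)
    show "\<zero>\<^bsub>L\<^esub> \<oplus>\<^bsub>L\<^esub> x = x"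
      using h unfolding frac_zero by (simp add: frac_add B_simps)
    have ma: "- a \<in> B" using h(1) by (rule subring_set_uminus[OF B])
    have "frac (- a) s \<oplus>\<^bsub>L\<^esub> x = \<zero>\<^bsub>L\<^esub>"
      unfolding h(3) frac_zero frac_add[OF ma h(2,1,2)]
      by (rule frac_eqI) (use h in \<open>auto intro!: B_intros simp: D_B\<close>)
    then show "\<exists>y\<in>carrier L. y \<oplus>\<^bsub>L\<^esub> x = \<zero>\<^bsub>L\<^esub>" using frac_closed[OF ma h(2)] by (rule bexI)
  qed
  show "comm_monoid L"
  proof (rule comm_monoidI)
    fix x y z assume "x \<in> carrier L" "y \<in> carrier L" "z \<in> carrier L"
    then obtain a s b t c u where h: "a \<in> B" "s \<in> D" "x = frac a s" "b \<in> B" "t \<in> D" "y = frac b t"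
      "c \<in> B" "u \<in> D" "z = frac c u" by (elim frac_cases)
    show "x \<otimes>\<^bsub>L\<^esub> y \<otimes>\<^bsub>L\<^esub> z = x \<otimes>\<^bsub>L\<^esub> (y \<otimes>\<^bsub>L\<^esub> z)"
      using h by (simp add: frac_mult B_simps mult.assoc)
  next
    fix x y assume "x \<in> carrier L" "y \<in> carrier L"
    then obtain a s b t where h: "a \<in> B" "s \<in> D" "x = frac a s" "b \<in> B" "t \<in> D" "y = frac b t"
      by (elim frac_cases)
    show "x \<otimes>\<^bsub>L\<^esub> y \<in> carrier L" using h by (simp add: frac_mult frac_closed B_simps)
    show "x \<otimes>\<^bsub>L\<^esub> y = y \<otimes>\<^bsub>L\<^esub> x" using h by (simp add: frac_mult mult.commute)
  next
    show "\<one>\<^bsub>L\<^esub> \<in> carrier L" unfolding frac_one by (intro frac_closed B_intros)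
    fix x assume "x \<in> carrier L"
    then obtain a s where h: "a \<in> B" "s \<in> D" "x = frac a s" by (elim frac_cases)
    show "\<one>\<^bsub>L\<^esub> \<otimes>\<^bsub>L\<^esub> x = x" using h unfolding frac_one by (simp add: frac_mult B_simps)
  qed
  fix x y z assume "x \<in> carrier L" "y \<in> carrier L" "z \<in> carrier L"
  then obtain a s b t c u where h: "a \<in> B" "s \<in> D" "x = frac a s" "b \<in> B" "t \<in> D" "y = frac b t"
    "c \<in> B" "u \<in> D" "z = frac c u" by (elim frac_cases)
  have "(x \<oplus>\<^bsub>L\<^esub> y) \<otimes>\<^bsub>L\<^esub> z = frac ((a * t + b * s) * c) ((s * t) * u)"
    unfolding h(3,6,9) frac_add[OF h(1,2,4,5)]
    by (rule frac_mult) (use h in \<open>auto intro!: B_intros simp: D_B\<close>)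
  also have "\<dots> = frac ((a * c) * (t * u) + (b * c) * (s * u)) ((s * u) * (t * u))"
  proof (rule frac_eqI)
    show "((a * t + b * s) * c) * ((s * u) * (t * u)) = ((a * c) * (t * u) + (b * c) * (s * u)) * ((s * t) * u)"
      by (simp add: algebra_simps)
  qed (use h in \<open>auto intro!: B_intros simp: D_B\<close>)
  also have "\<dots> = x \<otimes>\<^bsub>L\<^esub> z \<oplus>\<^bsub>L\<^esub> y \<otimes>\<^bsub>L\<^esub> z"
    unfolding h(3,6,9) frac_mult[OF h(1,2,7,8)] frac_mult[OF h(4,5,7,8)]
    by (rule frac_add[symmetric]) (use h in \<open>auto intro!: B_intros simp: D_B\<close>)
  finally show "(x \<oplus>\<^bsub>L\<^esub> y) \<otimes>\<^bsub>L\<^esub> z = x \<otimes>\<^bsub>L\<^esub> z \<oplus>\<^bsub>L\<^esub> y \<otimes>\<^bsub>L\<^esub> z" .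
qed

end

text \<open>Common form of the rings of the statement: \<open>UNIV\<close> gives the difference
  polynomial ring, and polynomials of bounded order give the rings \<open>A_ring\<close>.\<close>

definition type_subring :: "'a::comm_ring_1 set \<Rightarrow> 'a ring" where
  "type_subring B = ring_of_type_algebra\<lparr>carrier := B\<rparr>"

lemma type_subring_simps:
  "carrier (type_subring B) = B" "x \<otimes>\<^bsub>type_subring B\<^esub> y = x * y" "x \<oplus>\<^bsub>type_subring B\<^esub> y = x + y"
  "\<one>\<^bsub>type_subring B\<^esub> = 1" "\<zero>\<^bsub>type_subring B\<^esub> = 0"
  by (simp_all add: type_subring_def ring_of_type_algebra_def)

lemma type_subring_UNIV: "type_subring UNIV = ring_of_type_algebra"
  by (simp add: type_subring_def ring_of_type_algebra_def)

lemma cring_type_subring: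
  assumes B: "subring_set B"
  shows "cring (type_subring B)"
proof (rule cringI)
  show "abelian_group (type_subring B)"
  proof (rule abelian_groupI)
    fix x assume "x \<in> carrier (type_subring B)"
    then show "\<exists>y\<in>carrier (type_subring B). y \<oplus>\<^bsub>type_subring B\<^esub> x = \<zero>\<^bsub>type_subring B\<^esub>"
      by (intro bexI[of _ "- x"]) (auto simp: type_subring_simps intro: subring_set_uminus[OF B])
  qed (auto simp: type_subring_simps algebra_simps intro: subring_set_add[OF B] subring_set_zero[OF B])
  show "comm_monoid (type_subring B)"
    by (rule comm_monoidI)
      (auto simp: type_subring_simps algebra_simps intro: subring_set_mult[OF B] subring_set_one[OF B])
qed (auto simp: type_subring_simps distrib_right)

lemma ideal_type_subring:
  assumes B: "subring_set B" and I: "ideal_in B I"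
  shows "ideal I (type_subring B)"
proof -
  interpret cring "type_subring B" by (rule cring_type_subring[OF B])
  show ?thesis
  proof (rule idealI[OF ring_axioms])
    show "subgroup I (add_monoid (type_subring B))"
    proof (rule add.subgroupI)
      show "I \<subseteq> carrier (type_subring B)" using ideal_inD(1)[OF I] by (simp add: type_subring_simps)
      show "I \<noteq> {}" using ideal_inD(2)[OF I] by blast
      fix a assume a: "a \<in> I"
      then have aB: "a \<in> B" using ideal_inD(1)[OF I] by blast
      have "\<ominus>\<^bsub>type_subring B\<^esub> a = - a"
        using aB subring_set_uminus[OF B] by (intro minus_equality) (auto simp: type_subring_simps)
      then show "\<ominus>\<^bsub>type_subring B\<^esub> a \<in> I" using ideal_in_uminus[OF B I a] by simp
    qed (use ideal_inD(3)[OF I] in \<open>auto simp: type_subring_simps\<close>)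
  qed (use ideal_inD(4,5)[OF I] in \<open>auto simp: type_subring_simps\<close>)
qed

lemma ideal_in_of_ideal:
  assumes "ideal I (type_subring UNIV)"
  shows "ideal_in UNIV I"
proof -
  interpret ideal I "type_subring UNIV" by fact
  show ?thesis
    using add.subgroupE(4)[OF a_subgroup] I_l_closed additive_subgroup.zero_closed[OF additive_subgroup_axioms]
    by (auto simp: ideal_in_def type_subring_simps)
qed

text \<open>The localization that contains \<open>Delta_infinity\<close>: elements represent
  themselves, and the kernel is zero.\<close>

lemma presented_localization_type:
  assumes P: "prime_id P"
  shows "presented_localization (type_subring UNIV) (\<lambda>x. x) UNIV (- P) {0}"
proof -
  interpret cring "type_subring UNIV" by (rule cring_type_subring[OF subring_set_UNIV])
  show ?thesis
    by unfold_locales (auto simp: type_subring_simps subring_set_UNIV prime_id_one[OF P]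
        prime_id_mult_iff[OF P] ideal_in_def)
qed

section \<open>The residue class field of the contracted prime\<close>

context prime_over_subring
begin

abbreviation coset where "coset a \<equiv> (P \<inter> B) +>\<^bsub>type_subring B\<^esub> a"

lemma coset_eq_iff:
  assumes "a \<in> B" "b \<in> B"
  shows "coset a = coset b \<longleftrightarrow> a - b \<in> P"
proof -
  interpret cring "type_subring B" by (rule cring_type_subring[OF sub])
  have "\<ominus>\<^bsub>type_subring B\<^esub> b = - b"
    using assms subring_set_uminus[OF sub] by (intro minus_equality) (auto simp: type_subring_simps)
  then have "a \<ominus>\<^bsub>type_subring B\<^esub> b = a - b" by (simp add: a_minus_def type_subring_simps)
  then show ?thesis
    using quotient_eq_iff_same_a_r_cos[OF ideal_type_subring[OF sub prime_id_ideal[OF prime sub]], of a b]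
      assms subring_set_diff[OF sub] by (simp add: type_subring_simps)
qed

lemma presented_localization_quotient:
  "presented_localization (type_subring B Quot (P \<inter> B)) coset B (B - P) (P \<inter> B)"
proof -
  let ?R = "type_subring B" and ?I = "P \<inter> B"
  interpret R: cring ?R by (rule cring_type_subring[OF sub])
  interpret I: ideal ?I ?R by (rule ideal_type_subring[OF sub prime_id_ideal[OF prime sub]])
  interpret Q: cring "?R Quot ?I" by (rule I.quotient_is_cring[OF R.cring_axioms])
  have h: "(\<lambda>a. coset a) \<in> ring_hom ?R (?R Quot ?I)" by (rule I.rcos_ring_hom)
  have zero: "\<zero>\<^bsub>?R Quot ?I\<^esub> = coset 0"
    using ring_hom_zero[OF h R.ring_axioms Q.ring_axioms] by (simp add: type_subring_simps)
  show ?thesis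
  proof (unfold_locales)
    show "carrier (?R Quot ?I) = (\<lambda>a. coset a) ` B"
      by (auto simp: FactRing_def A_RCOSETS_def' type_subring_simps)
    show "coset a = \<zero>\<^bsub>?R Quot ?I\<^esub> \<longleftrightarrow> a \<in> ?I" if "a \<in> B" for a
      using coset_eq_iff[OF that subring_set_zero[OF sub]] that by (simp add: zero)
    show "coset (a * b) = coset a \<otimes>\<^bsub>?R Quot ?I\<^esub> coset b"
      "coset (a + b) = coset a \<oplus>\<^bsub>?R Quot ?I\<^esub> coset b" if "a \<in> B" "b \<in> B" for a b
      using ring_hom_mult[OF h, of a b] ring_hom_add[OF h, of a b] that by (simp_all add: type_subring_simps)
    show "coset 1 = \<one>\<^bsub>?R Quot ?I\<^esub>" using ring_hom_one[OF h] by (simp add: type_subring_simps)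
    show "s * t \<in> B - P" if "s \<in> B - P" "t \<in> B - P" for s t using that by (rule denominators_mult)
  qed (use sub denominators_one prime_id_ideal[OF prime sub] in auto)
qed

lemma nonzeros_quotient: "nonzeros (type_subring B Quot (P \<inter> B)) = (\<lambda>a. coset a) ` (B - P)"
proof -
  interpret pl: presented_localization "type_subring B Quot (P \<inter> B)" "\<lambda>a. coset a" B "B - P" "P \<inter> B"
    by (rule presented_localization_quotient)
  show ?thesis unfolding nonzeros_def pl.carrier_R using pl.pi_zero_iff by auto
qed

definition kappa where "kappa = residue_field (type_subring B) (P \<inter> B)"

definition kfrac where
  "kfrac a s = loc_frac (type_subring B Quot (P \<inter> B)) (nonzeros (type_subring B Quot (P \<inter> B))) (coset a) (coset s)"

text \<open>Fractions of cosets are handled through representatives in \<open>B\<close>. Primality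
  of \<open>P\<close> cancels the multiplier in the equality of fractions, which becomes plain
  cross-multiplication.\<close>

lemma kfrac_facts:
  shows kappa_cring: "cring kappa"
    and kappa_carrier: "carrier kappa = {kfrac a s | a s. a \<in> B \<and> s \<in> B - P}"
    and kfrac_eq_iff: "a \<in> B \<Longrightarrow> s \<in> B - P \<Longrightarrow> b \<in> B \<Longrightarrow> t \<in> B - P \<Longrightarrow>
      kfrac a s = kfrac b t \<longleftrightarrow> a * t - b * s \<in> P"
    and kfrac_mult: "a \<in> B \<Longrightarrow> s \<in> B - P \<Longrightarrow> b \<in> B \<Longrightarrow> t \<in> B - P \<Longrightarrow>
      kfrac a s \<otimes>\<^bsub>kappa\<^esub> kfrac b t = kfrac (a * b) (s * t)"
    and kfrac_add: "a \<in> B \<Longrightarrow> s \<in> B - P \<Longrightarrow> b \<in> B \<Longrightarrow> t \<in> B - P \<Longrightarrow>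
      kfrac a s \<oplus>\<^bsub>kappa\<^esub> kfrac b t = kfrac (a * t + b * s) (s * t)"
    and kappa_one: "\<one>\<^bsub>kappa\<^esub> = kfrac 1 1"
    and kappa_zero: "\<zero>\<^bsub>kappa\<^esub> = kfrac 0 1"
proof -
  interpret pl: presented_localization "type_subring B Quot (P \<inter> B)" "\<lambda>a. coset a" B "B - P" "P \<inter> B"
    by (rule presented_localization_quotient)
  have L: "kappa = pl.L" by (simp add: kappa_def residue_field_def nonzeros_quotient)
  have k: "kfrac = pl.frac" by (intro ext) (simp add: kfrac_def pl.frac_def nonzeros_quotient)
  show "cring kappa" unfolding L by (rule pl.cring_L)
  show "carrier kappa = {kfrac a s | a s. a \<in> B \<and> s \<in> B - P}" unfolding L k by (rule pl.carrier_L)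
  show "\<one>\<^bsub>kappa\<^esub> = kfrac 1 1" "\<zero>\<^bsub>kappa\<^esub> = kfrac 0 1" unfolding L k by (rule pl.frac_one pl.frac_zero)+
  assume h: "a \<in> B" "s \<in> B - P" "b \<in> B" "t \<in> B - P"
  show "kfrac a s \<otimes>\<^bsub>kappa\<^esub> kfrac b t = kfrac (a * b) (s * t)" unfolding L k by (rule pl.frac_mult[OF h])
  show "kfrac a s \<oplus>\<^bsub>kappa\<^esub> kfrac b t = kfrac (a * t + b * s) (s * t)" unfolding L k by (rule pl.frac_add[OF h])
  have atB: "a * t - b * s \<in> B" using h by (intro pl.B_intros) auto
  show "kfrac a s = kfrac b t \<longleftrightarrow> a * t - b * s \<in> P"
    unfolding k pl.frac_eq_iff[OF h]
    using atB denominators_one subring_set_mult[OF sub]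
    by (auto simp: prime_id_mult_iff[OF prime] intro!: bexI[of _ 1])
qed

lemma kfrac_closed: "a \<in> B \<Longrightarrow> s \<in> B - P \<Longrightarrow> kfrac a s \<in> carrier kappa"
  unfolding kappa_carrier by blast

lemma kappa_domain: "domain kappa"
proof -
  interpret cring kappa by (rule kappa_cring)
  show ?thesis
  proof (rule domainI[OF kappa_cring])
    show "\<one>\<^bsub>kappa\<^esub> \<noteq> \<zero>\<^bsub>kappa\<^esub>"
      unfolding kappa_one kappa_zero
      using kfrac_eq_iff[OF subring_set_one[OF sub] denominators_one subring_set_zero[OF sub] denominators_one]
        prime_id_one[OF prime] by simp
    fix x y assume xy: "x \<otimes>\<^bsub>kappa\<^esub> y = \<zero>\<^bsub>kappa\<^esub>" "x \<in> carrier kappa" "y \<in> carrier kappa"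
    then obtain a s b t where h: "a \<in> B" "s \<in> B - P" "x = kfrac a s" "b \<in> B" "t \<in> B - P" "y = kfrac b t"
      unfolding kappa_carrier by blast
    have z: "kfrac c u = \<zero>\<^bsub>kappa\<^esub> \<longleftrightarrow> c \<in> P" if "c \<in> B" "u \<in> B - P" for c u
      unfolding kappa_zero
      using kfrac_eq_iff[OF that subring_set_zero[OF sub] denominators_one] by simp
    have "a * b \<in> P"
      using xy(1) h z[OF subring_set_mult[OF sub h(1,4)] denominators_mult[OF h(2,5)]] kfrac_mult by simp
    then show "x = \<zero>\<^bsub>kappa\<^esub> \<or> y = \<zero>\<^bsub>kappa\<^esub>" using z h by (auto simp: prime_id_mult_iff[OF prime])
  qed
qed

lemma kfrac_zero_iff: "a \<in> B \<Longrightarrow> s \<in> B - P \<Longrightarrow> kfrac a s = \<zero>\<^bsub>kappa\<^esub> \<longleftrightarrow> a \<in> P"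
  unfolding kappa_zero using kfrac_eq_iff[OF _ _ subring_set_zero[OF sub] denominators_one] by simp

lemma residue_map_eq: "residue_map (type_subring B) (P \<inter> B) a = kfrac a 1"
proof -
  interpret pl: presented_localization "type_subring B Quot (P \<inter> B)" "\<lambda>a. coset a" B "B - P" "P \<inter> B"
    by (rule presented_localization_quotient)
  show ?thesis by (simp add: residue_map_def loc_map_def kfrac_def pl.pi_one)
qed

text \<open>Membership in \<open>P\<close> is assumed in both directions: one makes
  \<open>\<tau>\<close> act on cosets, the other, reflexivity, keeps denominators nonzero.\<close>

lemma residue_endo_kfrac:
  assumes \<tau>: "\<And>x. x \<in> B \<Longrightarrow> \<tau> x \<in> B" "\<And>x. \<tau> x \<in> P \<longleftrightarrow> x \<in> P"
      "\<And>x y. \<tau> (x * y) = \<tau> x * \<tau> y" "\<And>x y. \<tau> (x - y) = \<tau> x - \<tau> y" and as: "a \<in> B" "s \<in> B - P"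
  shows "residue_endo (type_subring B) (P \<inter> B) \<tau> (kfrac a s) = kfrac (\<tau> a) (\<tau> s)"
proof -
  let ?R = "type_subring B" and ?I = "P \<inter> B"
  interpret pl: presented_localization "?R Quot ?I" "\<lambda>a. coset a" B "B - P" "P \<inter> B"
    by (rule presented_localization_quotient)
  interpret R: cring ?R by (rule cring_type_subring[OF sub])
  interpret I: ideal ?I ?R by (rule ideal_type_subring[OF sub prime_id_ideal[OF prime sub]])
  have qe: "quot_endo ?R ?I \<tau> (coset x) = coset (\<tau> x)" if x: "x \<in> B" for x
  proof -
    have "coset (\<tau> y) = coset (\<tau> x)" if "y \<in> coset x" for y
    proof -
      have y: "y \<in> B" using that x R.a_r_coset_subset_G[OF I.a_subset, of x] by (auto simp: type_subring_simps)
      have "coset y = coset x"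
        using R.a_repr_independence[OF that _ I.a_subgroup] x by (simp add: type_subring_simps)
      then have "\<tau> y - \<tau> x \<in> P" using coset_eq_iff[OF y x] \<tau>(2)[of "y - x"] \<tau>(4)[of y x] by simp
      then show ?thesis using coset_eq_iff \<tau>(1) x y by simp
    qed
    moreover have "x \<in> coset x" using I.a_rcos_self[of x] x by (simp add: type_subring_simps)
    ultimately show ?thesis unfolding quot_endo_def by blast
  qed
  have k: "kfrac = pl.frac" by (intro ext) (simp add: kfrac_def pl.frac_def nonzeros_quotient)
  show ?thesis
    unfolding residue_endo_def nonzeros_quotient k
    by (rule pl.loc_endo_frac) (use \<tau> as qe in auto)
qed

end

section \<open>Transcendence degree\<close>

lemma mpol_map_const_id: "mpol_map g id (mpol_const c) = mpol_const c"
  unfolding mpol_map_const[OF endo_id] by simp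

lemma mpol_deriv_diff: "mpol_deriv v (p - q) = mpol_deriv v p - mpol_deriv v q"
  using derivation_diff[OF derivation_on_mpol_deriv[of UNIV v]] .

locale mpol_evaluation = L?: domain L for L :: "('a, 'm) ring_scheme" (structure) +
  fixes \<iota> :: "'k::field_char_0 \<Rightarrow> 'a"
  assumes iota_closed: "\<And>c. \<iota> c \<in> carrier L" and iota_add: "\<And>a b. \<iota> (a + b) = \<iota> a \<oplus> \<iota> b"
    and iota_mult: "\<And>a b. \<iota> (a * b) = \<iota> a \<otimes> \<iota> b" and iota_one: "\<iota> 1 = \<one>"
begin

lemma iota_zero: "\<iota> 0 = \<zero>"
proof -
  have "\<iota> 0 \<oplus> \<iota> 0 = \<iota> 0" using iota_add[of 0 0] by simp
  then show ?thesis using add.l_cancel_one[OF iota_closed iota_closed] by blast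
qed

context
  fixes x :: "'v \<Rightarrow> 'a" assumes x: "\<And>v. x v \<in> carrier L"
begin

definition eval_mono :: "('v \<Rightarrow>\<^sub>0 nat) \<Rightarrow> 'a" where
  "eval_mono m = (\<Otimes>v\<in>Poly_Mapping.keys m. x v [^] Poly_Mapping.lookup m v)"

lemma eval_mono_closed: "eval_mono m \<in> carrier L"
  unfolding eval_mono_def using x by (intro finprod_closed) auto

lemma eval_mono_superset:
  assumes "finite A" "Poly_Mapping.keys m \<subseteq> A"
  shows "eval_mono m = (\<Otimes>v\<in>A. x v [^] Poly_Mapping.lookup m v)"
  unfolding eval_mono_def
  using assms x by (intro finprod_mono_neutral_cong_left) (auto simp: in_keys_iff)

lemma eval_mono_add: "eval_mono (m + n) = eval_mono m \<otimes> eval_mono n"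
proof -
  let ?A = "Poly_Mapping.keys m \<union> Poly_Mapping.keys n"
  have "eval_mono m \<otimes> eval_mono n
      = (\<Otimes>v\<in>?A. x v [^] Poly_Mapping.lookup m v \<otimes> x v [^] Poly_Mapping.lookup n v)"
    using x by (simp add: eval_mono_superset[of ?A] finprod_multf Pi_def)
  also have "\<dots> = (\<Otimes>v\<in>?A. x v [^] Poly_Mapping.lookup (m + n) v)"
    using x by (intro finprod_cong') (auto simp: lookup_add nat_pow_mult)
  also have "\<dots> = eval_mono (m + n)"
    using keys_add[of m n] by (simp add: eval_mono_superset[of ?A])
  finally show ?thesis ..
qed

lemma eval_superset:
  assumes "finite A" "Poly_Mapping.keys p \<subseteq> A"
  shows "mpol_eval L \<iota> x p = (\<Oplus>m\<in>A. \<iota> (Poly_Mapping.lookup p m) \<otimes> eval_mono m)"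
  unfolding mpol_eval_def eval_mono_def[symmetric]
  using assms by (intro add.finprod_mono_neutral_cong_left)
    (auto simp: in_keys_iff iota_zero eval_mono_closed iota_closed)

lemma eval_closed: "mpol_eval L \<iota> x p \<in> carrier L"
  unfolding mpol_eval_def eval_mono_def[symmetric]
  by (intro finsum_closed) (auto simp: eval_mono_closed iota_closed)

lemma eval_add: "mpol_eval L \<iota> x (p + q) = mpol_eval L \<iota> x p \<oplus> mpol_eval L \<iota> x q"
proof -
  let ?A = "Poly_Mapping.keys p \<union> Poly_Mapping.keys q"
  have "mpol_eval L \<iota> x p \<oplus> mpol_eval L \<iota> x q
    = (\<Oplus>m\<in>?A. \<iota> (Poly_Mapping.lookup p m) \<otimes> eval_mono m \<oplus> \<iota> (Poly_Mapping.lookup q m) \<otimes> eval_mono m)"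
    by (simp add: eval_superset[of ?A] finsum_addf Pi_def eval_mono_closed iota_closed)
  also have "\<dots> = (\<Oplus>m\<in>?A. \<iota> (Poly_Mapping.lookup (p + q) m) \<otimes> eval_mono m)"
    by (intro finsum_cong') (auto simp: lookup_add iota_add l_distr eval_mono_closed iota_closed)
  also have "\<dots> = mpol_eval L \<iota> x (p + q)"
    using keys_add[of p q] by (simp add: eval_superset[of ?A])
  finally show ?thesis ..
qed

lemma eval_single: "mpol_eval L \<iota> x (Poly_Mapping.single m c) = \<iota> c \<otimes> eval_mono m"
  by (subst eval_superset[of "{m}"]) (auto simp: eval_mono_closed iota_closed)

lemma eval_mult: "mpol_eval L \<iota> x (p * q) = mpol_eval L \<iota> x p \<otimes> mpol_eval L \<iota> x q"
proof (induction p rule: mpol_add_induct)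
  case (1 m c)
  show ?case
  proof (induction q rule: mpol_add_induct)
    case (1 n d)
    show ?case
      by (simp add: mult_single eval_single eval_mono_add iota_mult eval_mono_closed iota_closed m_ac)
  next
    case (2 q1 q2)
    then show ?case by (simp add: distrib_left eval_add r_distr eval_closed)
  qed
next
  case (2 p1 p2)
  then show ?case by (simp add: distrib_right eval_add l_distr eval_closed)
qed

lemma eval_const: "mpol_eval L \<iota> x (mpol_const c) = \<iota> c"
  by (simp add: mpol_const_def eval_single eval_mono_def iota_closed)

lemma eval_pvar: "mpol_eval L \<iota> x (pvar v) = x v"
  using x by (simp add: pvar_def eval_single eval_mono_def iota_one)

lemma eval_unique:
  assumes "\<And>c. h (mpol_const c) = \<iota> c" "\<And>v. v \<in> V \<Longrightarrow> h (pvar v) = x v"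
    and "\<And>p q. p \<in> polys V \<Longrightarrow> q \<in> polys V \<Longrightarrow> h (p + q) = h p \<oplus> h q"
    and "\<And>p q. p \<in> polys V \<Longrightarrow> q \<in> polys V \<Longrightarrow> h (p * q) = h p \<otimes> h q"
  shows "p \<in> polys V \<Longrightarrow> mpol_eval L \<iota> x p = h p"
  by (induction rule: polys_induct) (auto simp: assms eval_const eval_pvar eval_add eval_mult)

lemma eval_diff: "mpol_eval L \<iota> x (p - q) = mpol_eval L \<iota> x p \<ominus> mpol_eval L \<iota> x q"
proof -
  have "mpol_eval L \<iota> x (p - q) \<oplus> mpol_eval L \<iota> x q = mpol_eval L \<iota> x p"
    by (simp add: eval_add[symmetric])
  then show ?thesis using eval_closed[of "p - q"] eval_closed[of q] eval_closed[of p]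
    by (metis a_minus_def a_assoc a_inv_closed r_neg r_zero)
qed

lemma eval_zero: "mpol_eval L \<iota> x 0 = \<zero>"
  using eval_const[of 0] by (simp add: mpol_const_0 iota_zero)

text \<open>The target is a domain, so the relations among given elements form a prime and
  \<open>gdim\<close> applies to them.\<close>

lemma eval_kernel_prime: "prime_id {p. mpol_eval L \<iota> x p = \<zero>}"
proof -
  have "mpol_eval L \<iota> x 1 = \<one>" using eval_const[of 1] by (simp add: mpol_const_1 iota_one)
  then show ?thesis
    by (auto simp: prime_id_def ideal_in_def eval_zero eval_add eval_mult eval_closed integral_iff)
qed

end

lemma eval_cong:
  assumes "\<And>v. x v \<in> carrier L" "\<And>v. v \<in> V \<Longrightarrow> y v = x v" "p \<in> polys V"
  shows "mpol_eval L \<iota> y p = mpol_eval L \<iota> x p"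
proof -
  have "(\<Otimes>v\<in>Poly_Mapping.keys m. y v [^] Poly_Mapping.lookup m v)
      = (\<Otimes>v\<in>Poly_Mapping.keys m. x v [^] Poly_Mapping.lookup m v)"
    if "m \<in> Poly_Mapping.keys p" for m
    using that assms by (intro finprod_cong') (auto simp: polys_def mpol_vars_def)
  then show ?thesis
    unfolding mpol_eval_def using assms(1)
    by (intro finsum_cong') (auto intro!: finprod_closed simp: iota_closed)
qed

lemma eval_map:
  assumes "\<And>w. y w \<in> carrier L"
  shows "mpol_eval L \<iota> y (mpol_map g id p) = mpol_eval L \<iota> (\<lambda>v. y (g v)) p"
proof -
  have "p \<in> polys UNIV" by (simp add: polys_UNIV)
  then show ?thesis
    by (induction rule: polys_induct)
      (simp_all only: mpol_map_const_id mpol_map_pvar[OF endo_id] mpol_map_add[OF endo_id]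
        mpol_map_mult[OF endo_id] eval_const[OF assms] eval_pvar[OF assms] eval_add[OF assms]
        eval_mult[OF assms])
qed

lemma gdim_Un_le:
  fixes P :: "('v, 'k) mpol set"
  assumes P: "prime_id P" and V: "finite V" and A: "finite A"
  shows "gdim P (V \<union> A) \<le> gdim P V + card A"
  using A
proof (induction A rule: finite_induct)
  case (insert v A)
  then show ?case
    using gdim_insert[OF P, of "V \<union> A" v] V by (cases "v \<in> V \<union> A") (auto simp: insert_absorb)
qed simp

text \<open>The relations among the coordinates and the \<open>z t\<close> are counted in two ways. With the coordinates
  first, each \<open>z t\<close> contributes one; with the independent \<open>z t\<close> first, only the coordinates can
  contribute.\<close>

lemma alg_independent_card:
  fixes x :: "'v \<Rightarrow> 'a" and z :: "'t \<Rightarrow> 'a"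
  assumes x: "\<And>v. x v \<in> carrier L" and V: "finite V" and T: "finite T"
    and z: "\<And>t. t \<in> T \<Longrightarrow> z t \<in> carrier L" and ind: "alg_independent L \<iota> T z"
    and frac: "\<And>t. t \<in> T \<Longrightarrow> \<exists>a\<in>polys V. \<exists>b\<in>polys V. mpol_eval L \<iota> x b \<noteq> \<zero> \<and>
      mpol_eval L \<iota> x b \<otimes> z t = mpol_eval L \<iota> x a"
  shows "card T + gdim {p. mpol_eval L \<iota> x p = \<zero>} V \<le> card V"
proof -
  let ?P = "{p. mpol_eval L \<iota> x p = \<zero>}"
  \<comment> \<open>The joint family of coordinates and of the \<open>z t\<close>, extended by zero
    to indices outside \<open>T\<close> so that all values lie in the field.\<close>
  define y where "y w = (case w of Inl v \<Rightarrow> x v | Inr t \<Rightarrow> if t \<in> T then z t else \<zero>)" for w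
  have y: "y w \<in> carrier L" for w using x z by (auto simp: y_def split: sum.split)
  let ?Q = "{p. mpol_eval L \<iota> y p = \<zero>}"
  note P = eval_kernel_prime[of x, OF x] and Q = eval_kernel_prime[of y, OF y]
  let ?l = "mpol_map Inl id :: ('v, 'k) mpol \<Rightarrow> ('v + 't, 'k) mpol"
  have eval_l: "mpol_eval L \<iota> y (?l p) = mpol_eval L \<iota> x p" for p
    by (simp add: eval_map[OF y]) (simp add: y_def)
  have l_polys: "?l p \<in> polys (Inl ` W)" if "p \<in> polys W" for p W
    by (rule mpol_map_polys[OF endo_id that])
  let ?W = "Inl ` V \<union> Inr ` T :: ('v + 't) set"
  have finW: "finite ?W" using V T by simp
  from frac have "\<forall>t\<in>T. \<exists>a b. a \<in> polys V \<and> b \<in> polys V \<and> mpol_eval L \<iota> x b \<noteq> \<zero> \<and>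
      mpol_eval L \<iota> x b \<otimes> z t = mpol_eval L \<iota> x a" by blast
  from bchoice[OF this] obtain a where "\<forall>t\<in>T. \<exists>b. a t \<in> polys V \<and> b \<in> polys V \<and> mpol_eval L \<iota> x b \<noteq> \<zero> \<and>
      mpol_eval L \<iota> x b \<otimes> z t = mpol_eval L \<iota> x (a t)" ..
  from bchoice[OF this] obtain b where ab: "\<forall>t\<in>T. a t \<in> polys V \<and> b t \<in> polys V \<and> mpol_eval L \<iota> x (b t) \<noteq> \<zero> \<and>
      mpol_eval L \<iota> x (b t) \<otimes> z t = mpol_eval L \<iota> x (a t)" ..
  obtain G where G: "triangular ?P V G" using triangular_exists[OF P V] by blast
  then have fG: "finite G" "G \<subseteq> ?P" "G \<subseteq> polys V" "grad_indep ?P V G" by (auto simp: triangular_def)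
  obtain G' where G': "triangular ?Q ?W G'" using triangular_exists[OF Q finW] by blast
  \<comment> \<open>Relations of two kinds: those among the coordinates, and for each
    \<open>t\<close> the equation that writes \<open>z t\<close> as a fraction in the
    coordinates.\<close>
  define w where "w i = (case i of Inl g \<Rightarrow> ?l g | Inr t \<Rightarrow> ?l (b t) * pvar (Inr t) - ?l (a t))" for i
  have dInr: "mpol_deriv (Inr t) (?l p) = 0" if "p \<in> polys V" for p t
    by (rule mpol_deriv_notin[OF l_polys[OF that]]) auto
  have dInl: "mpol_deriv (Inl v) (?l p) = ?l (mpol_deriv v p)" for p v
    using mpol_deriv_map[OF endo_id, of Inl v UNIV p] by (simp add: polys_UNIV)
  interpret pv: prime_over_subring "UNIV :: ('v, 'k) mpol set" ?P
    by unfold_locales (rule subring_set_UNIV, rule P)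
  interpret qv: prime_over_subring "UNIV :: ('v + 't, 'k) mpol set" ?Q
    by unfold_locales (rule subring_set_UNIV, rule Q)
  have lower: "card (G <+> T) \<le> card G'"
  proof (rule triangular_card_ge[OF Q G' finW subset_refl, where w = w])
    show "finite (G <+> T)" using fG T by simp
    show "w i \<in> ?Q \<inter> polys ?W" if "i \<in> G <+> T" for i
    proof (cases i)
      case (Inl g)
      then show ?thesis
        using that fG l_polys[of g V] polys_mono[of "Inl ` V" ?W] by (auto simp: w_def eval_l)
    next
      case (Inr t)
      then have t: "t \<in> T" using that by auto
      have "?l (b t) \<in> polys ?W" "?l (a t) \<in> polys ?W" "pvar (Inr t) \<in> polys ?W"
        using ab t l_polys[of _ V] polys_mono[of "Inl ` V" ?W] by (auto intro: polys_pvar)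
      then have "w i \<in> polys ?W"
        unfolding Inr w_def sum.case by (intro subring_set_diff[OF subring_set_polys] polys_mult)
      moreover have "mpol_eval L \<iota> y (w i) = \<zero>"
        using ab t by (simp add: Inr w_def eval_diff[OF y] eval_mult[OF y] eval_l eval_pvar[OF y])
          (simp add: y_def eval_closed[OF x] r_right_minus_eq)
      ultimately show ?thesis by simp
    qed
    show "indep UNIV ?Q ?W (G <+> T) (\<lambda>i u. mpol_deriv u (w i))"
      unfolding indep_def
    proof (intro allI impI)
      fix d assume d: "\<forall>u\<in>?W. (\<Sum>i\<in>G <+> T. d i * mpol_deriv u (w i)) \<in> ?Q"
      have split: "(\<Sum>i\<in>G <+> T. d i * mpol_deriv u (w i))
        = (\<Sum>g\<in>G. d (Inl g) * mpol_deriv u (?l g)) + (\<Sum>t\<in>T. d (Inr t) * mpol_deriv u (w (Inr t)))" for u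
        using fG T by (simp add: sum.Plus w_def)
      have dT: "d (Inr t) \<in> ?Q" if t: "t \<in> T" for t
      proof -
        have "(\<Sum>g\<in>G. d (Inl g) * mpol_deriv (Inr t) (?l g)) = 0"
          by (rule sum.neutral) (use fG dInr in auto)
        moreover have "(\<Sum>s\<in>T. d (Inr s) * mpol_deriv (Inr t) (w (Inr s))) = (\<Sum>s\<in>T. if s = t then d (Inr t) * ?l (b t) else 0)"
        proof (rule sum.cong[OF refl])
          fix s assume s: "s \<in> T"
          have "mpol_deriv (Inr t) (w (Inr s)) = (if s = t then ?l (b t) else 0)"
            using ab s by (auto simp: w_def mpol_deriv_diff mpol_deriv_mult mpol_deriv_pvar dInr)
          then show "d (Inr s) * mpol_deriv (Inr t) (w (Inr s)) = (if s = t then d (Inr t) * ?l (b t) else 0)" by auto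
        qed
        moreover have "(\<Sum>i\<in>G <+> T. d i * mpol_deriv (Inr t) (w i)) \<in> ?Q" using d t by blast
        ultimately have "d (Inr t) * ?l (b t) \<in> ?Q" using t T unfolding split by simp
        moreover have "?l (b t) \<notin> ?Q" using ab t by (simp add: eval_l)
        ultimately show ?thesis unfolding prime_id_mult_iff[OF Q] by blast
      qed
      have dG: "d (Inl g) \<in> ?Q" if g: "g \<in> G" for g
      proof -
        from pv.indep_pseudo_inverse[where M = "\<lambda>p v. mpol_deriv v p", OF V fG(1) UNIV_I fG(4)[unfolded grad_indep_def]]
        obtain N \<delta> where N: "\<delta> \<notin> ?P" "\<And>g k. g \<in> G \<Longrightarrow> k \<in> G \<Longrightarrow>
          (\<Sum>v\<in>V. mpol_deriv v g * N v k) = (if g = k then \<delta> else 0)" by blast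
        \<comment> \<open>Independence of the gradients of \<open>G\<close> passes to the larger
          polynomial ring by carrying the pseudo-inverse along the renaming.\<close>
        have "indep UNIV ?Q V G (\<lambda>g v. ?l (mpol_deriv v g))"
        proof (rule qv.pseudo_inverse_indep[OF fG(1), where \<delta> = "?l \<delta>" and N = "\<lambda>v k. ?l (N v k)"])
          show "?l \<delta> \<notin> ?Q" using N(1) by (simp add: eval_l)
          fix g k assume "g \<in> G" "k \<in> G"
          from N(2)[OF this] have "?l (\<Sum>v\<in>V. mpol_deriv v g * N v k) = ?l (if g = k then \<delta> else 0)" by simp
          then show "(\<Sum>v\<in>V. ?l (mpol_deriv v g) * ?l (N v k)) = (if g = k then ?l \<delta> else 0)"
            by (simp add: mpol_map_sum[OF endo_id] mpol_map_mult[OF endo_id] mpol_map_0[OF endo_id] split: if_splits)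
        qed
        then show ?thesis
        proof (rule indepD[where c = "\<lambda>g. d (Inl g)"])
          fix v assume v: "v \<in> V"
          have a: "(\<Sum>i\<in>G <+> T. d i * mpol_deriv (Inl v) (w i)) \<in> ?Q" using d v by blast
          have b: "(\<Sum>t\<in>T. d (Inr t) * mpol_deriv (Inl v) (w (Inr t))) \<in> ?Q"
            using dT by (intro prime_id_sum[OF Q] prime_id_mult_right[OF Q])
          from prime_id_diff[OF Q a b] show "(\<Sum>g\<in>G. d (Inl g) * ?l (mpol_deriv v g)) \<in> ?Q"
            unfolding split by (simp add: dInl)
        qed (use g in auto)
      qed
      show "\<forall>i\<in>G <+> T. d i \<in> ?Q" using dT dG by auto
    qed
  qed auto
  have "p = 0" if p: "p \<in> ?Q" "p \<in> polys (Inr ` T)" for p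
  proof -
    let ?r = "mpol_map projr id p"
    have r: "?r \<in> polys T" using mpol_map_polys[OF endo_id p(2), of projr] by (simp add: image_image)
    have inverse: "mpol_map Inr id ?r = p" by (rule mpol_map_inverse[OF p(2)]) auto
    have "mpol_eval L \<iota> z ?r = mpol_eval L \<iota> (\<lambda>t. y (Inr t)) ?r"
    proof (rule eval_cong[OF _ _ r])
      show "y (Inr t) \<in> carrier L" for t by (rule y)
      show "z t = y (Inr t)" if "t \<in> T" for t using that by (simp add: y_def)
    qed
    also have "\<dots> = mpol_eval L \<iota> y (mpol_map Inr id ?r)" by (rule eval_map[OF y, symmetric])
    also have "\<dots> = mpol_eval L \<iota> y p" unfolding inverse ..
    finally have "?r = 0" using ind r p(1) by (auto simp: alg_independent_def polys_def)
    then show ?thesis using inverse by (simp add: mpol_map_0[OF endo_id])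
  qed
  then have "?Q \<inter> polys (Inr ` T) \<subseteq> {0}" by blast
  moreover have "0 \<in> saturation (polys (Inr ` T)) ?Q (gen_ideal (polys (Inr ` T)) {})"
    using gen_ideal.zero polys_0 polys_1 prime_id_one[OF Q] unfolding saturation_def by fastforce
  ultimately have "triangular ?Q (Inr ` T) {}"
    using T by (auto simp: triangular_def grad_indep_def indep_def)
  then have "gdim ?Q (Inr ` T) = 0" using gdim_eq[OF Q] by fastforce
  then have "gdim ?Q (Inr ` T \<union> Inl ` V) \<le> card V"
    using gdim_Un_le[OF Q, of "Inr ` T" "Inl ` V"] T V by (simp add: card_image)
  then have "card G' \<le> card V" using gdim_eq[OF Q G'] by (simp add: Un_commute)
  then show ?thesis using lower fG T gdim_eq[OF P G] by (simp add: card_Plus add.commute)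
qed

text \<open>\<open>trdeg\<close> speaks of independent sets, whereas coordinates form an indexed
  family; equal coordinates would already be a relation.\<close>

lemma alg_independent_image:
  fixes x :: "'v \<Rightarrow> 'a"
  assumes x: "\<And>v. x v \<in> carrier L" and U: "\<And>p. p \<in> polys U \<Longrightarrow> mpol_eval L \<iota> x p = \<zero> \<Longrightarrow> p = 0"
  shows "inj_on x U" "alg_independent L \<iota> (x ` U) (\<lambda>s. s)"
proof -
  show inj: "inj_on x U"
  proof (rule inj_onI)
    fix u v assume uv: "u \<in> U" "v \<in> U" "x u = x v"
    have "pvar u - pvar v \<in> polys U" using uv by (intro subring_set_diff[OF subring_set_polys] polys_pvar)
    moreover have "mpol_eval L \<iota> x (pvar u - pvar v) = \<zero>"
      using uv x by (simp add: eval_diff[OF x] eval_pvar[OF x] r_right_minus_eq)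
    ultimately have eq: "(pvar u :: ('v, 'k) mpol) = pvar v" using U by fastforce
    have "mpol_deriv u (pvar v :: ('v, 'k) mpol) = 1" unfolding eq[symmetric] by (simp add: mpol_deriv_pvar)
    then show "u = v" by (simp add: mpol_deriv_pvar split: if_splits)
  qed
  show "alg_independent L \<iota> (x ` U) (\<lambda>s. s)"
    unfolding alg_independent_def
  proof (intro allI impI)
    fix p :: "('a, 'k) mpol" assume "mpol_vars p \<subseteq> x ` U" and z: "mpol_eval L \<iota> (\<lambda>s. s) p = \<zero>"
    then have p: "p \<in> polys (x ` U)" by (simp add: polys_def)
    let ?q = "mpol_map (inv_into U x) id p"
    have q: "?q \<in> polys U"
      using mpol_map_polys[OF endo_id p, of "inv_into U x"] inj by (simp add: image_inv_into_cancel image_image)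
    have inverse: "mpol_map x id ?q = p" by (rule mpol_map_inverse[OF p]) (auto simp: f_inv_into_f)
    have "mpol_eval L \<iota> x ?q = mpol_eval L \<iota> (\<lambda>s. x (inv_into U x s)) p" by (rule eval_map[OF x])
    also have "\<dots> = mpol_eval L \<iota> (\<lambda>s. s) p"
      by (rule eval_cong[symmetric, OF _ _ p]) (use x in \<open>auto simp: f_inv_into_f\<close>)
    finally have "?q = 0" using U[OF q] z by simp
    then show "p = 0" using inverse by (simp add: mpol_map_0[OF endo_id])
  qed
qed

end

text \<open>The kernel of evaluation at the coordinates agrees with \<open>P\<close> only on the
  polynomials in question. Independence is therefore compared for coefficients in
  \<open>polys V\<close> first and enlarged afterwards.\<close>

lemma gdim_cong:
  assumes P: "prime_id P" and Q: "prime_id Q" and V: "finite V" and eq: "P \<inter> polys V = Q \<inter> polys V"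
  shows "gdim P V = gdim Q V"
proof -
  obtain G where G: "triangular P V G" using triangular_exists[OF P V] by blast
  have mem: "p \<in> P \<longleftrightarrow> p \<in> Q" if "p \<in> polys V" for p using eq that by blast
  have fG: "finite G" "G \<subseteq> polys V" "grad_indep P V G" using G by (auto simp: triangular_def)
  interpret qv: prime_over_subring "polys V" Q by unfold_locales (rule subring_set_polys, rule Q)
  have "indep (polys V) Q V G (\<lambda>p v. mpol_deriv v p)"
    unfolding indep_def
  proof (intro allI impI)
    fix c assume c: "\<forall>i\<in>G. c i \<in> polys V" "\<forall>j\<in>V. (\<Sum>i\<in>G. c i * mpol_deriv j i) \<in> Q"
    have "(\<Sum>i\<in>G. c i * mpol_deriv j i) \<in> polys V" for j
      using c fG by (intro subring_set_sum[OF subring_set_polys] polys_mult mpol_deriv_polys) auto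
    then have "\<forall>j\<in>V. (\<Sum>i\<in>G. c i * mpol_deriv j i) \<in> P" using c mem by blast
    then have "\<forall>i\<in>G. c i \<in> P" using fG(3) by (simp add: grad_indep_def indep_def)
    then show "\<forall>i\<in>G. c i \<in> Q" using c mem by blast
  qed
  then have "grad_indep Q V G"
    unfolding grad_indep_def using fG by (intro qv.indep_coeffs_UNIV[OF V fG(1)]) (auto intro: mpol_deriv_polys)
  moreover have "saturation (polys V) P I = saturation (polys V) Q I" for I
    using mem by (auto simp: saturation_def)
  ultimately have "triangular Q V G" using G eq by (auto simp: triangular_def)
  then show ?thesis using gdim_eq[OF P G] gdim_eq[OF Q] by simp
qed

locale residue_polys =
  fixes P :: "('v, 'k::field_char_0) mpol set" and V :: "'v set"
  assumes P: "prime_id P"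
begin

sublocale prime_over_subring "polys V" P
  by unfold_locales (rule subring_set_polys, rule P)

definition const_kappa :: "'k \<Rightarrow> (('v, 'k) mpol set \<times> ('v, 'k) mpol set) set" where
  "const_kappa c = kfrac (mpol_const c) 1"

sublocale mpol_evaluation kappa const_kappa
proof -
  interpret domain kappa by (rule kappa_domain)
  show "mpol_evaluation kappa const_kappa"
    by unfold_locales
      (simp_all add: const_kappa_def kfrac_closed kfrac_add kfrac_mult kappa_one polys_const denominators_one[simplified]
        mpol_const_add mpol_const_mult mpol_const_1 polys_1 prime_id_one[OF P])
qed

text \<open>The value outside \<open>V\<close> is a default that keeps all coordinates in the field,
  as evaluation requires.\<close>

definition coord where "coord v = (if v \<in> V then kfrac (pvar v) 1 else \<zero>\<^bsub>kappa\<^esub>)"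

lemma coord_closed: "coord v \<in> carrier kappa"
  using denominators_one by (auto simp: coord_def kfrac_closed polys_pvar)

lemma eval_coord: "p \<in> polys V \<Longrightarrow> mpol_eval kappa const_kappa coord p = kfrac p 1"
  by (rule eval_unique[where V = V])
    (use denominators_one in \<open>auto simp: coord_closed const_kappa_def coord_def kfrac_add kfrac_mult
      kfrac_closed polys_pvar\<close>)

lemma eval_coord_zero_iff: "p \<in> polys V \<Longrightarrow> mpol_eval kappa const_kappa coord p = \<zero>\<^bsub>kappa\<^esub> \<longleftrightarrow> p \<in> P"
  using eval_coord kfrac_zero_iff[OF _ denominators_one] by simp

text \<open>Here \<open>W\<close> may be smaller than \<open>V\<close>: inside one large residue
  field this bounds the families that are fractions in few variables.\<close>

lemma alg_independent_kappa_card: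
  assumes W: "finite W" "W \<subseteq> V" and T: "finite T" and ind: "alg_independent kappa const_kappa T z"
    and z: "\<And>t. t \<in> T \<Longrightarrow> \<exists>a\<in>polys W. \<exists>b\<in>polys W. b \<notin> P \<and> z t = kfrac a b"
  shows "card T + gdim P W \<le> card W"
proof -
  let ?Q = "{p. mpol_eval kappa const_kappa coord p = \<zero>\<^bsub>kappa\<^esub>}"
  have WV: "p \<in> polys V" if "p \<in> polys W" for p using polys_mono[OF W(2)] that by blast
  have "P \<inter> polys W = ?Q \<inter> polys W" using eval_coord_zero_iff WV by blast
  then have "gdim P W = gdim ?Q W"
    by (rule gdim_cong[OF P eval_kernel_prime[of coord, OF coord_closed] W(1)])
  moreover have "card T + gdim ?Q W \<le> card W"
  proof (rule alg_independent_card[OF coord_closed W(1) T _ ind])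
    fix t assume "t \<in> T"
    then obtain a b where ab: "a \<in> polys W" "b \<in> polys W" "b \<notin> P" "z t = kfrac a b" using z by blast
    then have abV: "a \<in> polys V" "b \<in> polys V - P" using WV by auto
    show "z t \<in> carrier kappa" using kfrac_closed[OF abV] ab by simp
    have "kfrac b 1 \<otimes>\<^bsub>kappa\<^esub> kfrac a b = kfrac (b * a) (1 * b)"
      using abV denominators_one by (intro kfrac_mult) auto
    also have "\<dots> = kfrac a 1"
    proof (subst kfrac_eq_iff)
      show "b * a * 1 - a * (1 * b) \<in> P" using prime_id_zero[OF P] by (simp add: mult.commute)
    qed (use abV denominators_one in \<open>auto intro: polys_mult\<close>)
    finally have "mpol_eval kappa const_kappa coord b \<otimes>\<^bsub>kappa\<^esub> z t = mpol_eval kappa const_kappa coord a"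
      using abV ab(4) by (simp add: eval_coord)
    moreover have "mpol_eval kappa const_kappa coord b \<noteq> \<zero>\<^bsub>kappa\<^esub>" using abV by (simp add: eval_coord_zero_iff)
    ultimately show "\<exists>a\<in>polys W. \<exists>b\<in>polys W. mpol_eval kappa const_kappa coord b \<noteq> \<zero>\<^bsub>kappa\<^esub> \<and>
      mpol_eval kappa const_kappa coord b \<otimes>\<^bsub>kappa\<^esub> z t = mpol_eval kappa const_kappa coord a"
      using ab by blast
  qed
  ultimately show ?thesis by simp
qed

lemma alg_independent_coords:
  assumes "U \<subseteq> V" "\<And>p. p \<in> P \<Longrightarrow> p \<in> polys U \<Longrightarrow> p = 0"
  shows "inj_on coord U" "alg_independent kappa const_kappa (coord ` U) (\<lambda>s. s)"
  using alg_independent_image[of coord U, OF coord_closed] assms(2) eval_coord_zero_iff polys_mono[OF assms(1)]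
  by blast+

end

section \<open>Transcendence degrees of the truncations\<close>

lemma A_set_eq: "A_set k = polys (ord_le k)"
  by (auto simp: A_set_def polys_def ord_le_def)

lemma A_ring_eq: "A_ring k = type_subring (polys (ord_le k))"
  by (simp add: A_ring_def type_subring_def A_set_eq)

text \<open>The coordinates of \<open>U\<close> are independent and attain the general upper bound,
  the number of variables minus \<open>gdim\<close>.\<close>

lemma trdeg_A_eq:
  fixes P :: "('n::finite, 'k::field_char_0) dpol set"
  assumes P: "prime_id P" and U: "U \<subseteq> ord_le i" "card U + gdim P (ord_le i) = N" "\<And>p. p \<in> P \<inter> polys U \<Longrightarrow> p = 0"
    and N: "N = card (UNIV :: 'n set) * (i + 1)"
  shows "trdeg_A P i = enat (card U)"
proof -
  interpret rp: residue_polys P "ord_le i" by unfold_locales (rule P)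
  let ?S = "{S. S \<subseteq> carrier rp.kappa \<and> finite S \<and> alg_independent rp.kappa rp.const_kappa S (\<lambda>s. s)}"
  have eq: "trdeg_A P i = (SUP S\<in>?S. enat (card S))"
    by (simp add: trdeg_A_def trdeg_def A_ring_eq A_set_eq Int_commute[of _ P] rp.kappa_def[symmetric]
        rp.residue_map_eq rp.const_kappa_def[abs_def])
  have "card S \<le> card U" if S: "S \<in> ?S" for S
  proof -
    have "card S + gdim P (ord_le i) \<le> card (ord_le i :: ('n \<times> nat) set)"
    proof (rule rp.alg_independent_kappa_card[OF finite_ord_le subset_refl])
      show "\<exists>a\<in>polys (ord_le i). \<exists>b\<in>polys (ord_le i). b \<notin> P \<and> s = rp.kfrac a b" if "s \<in> S" for s
        using S that unfolding rp.kappa_carrier by blast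
    qed (use S in auto)
    then show ?thesis using U(2) N by (simp add: card_ord_le)
  qed
  then have "(SUP S\<in>?S. enat (card S)) \<le> enat (card U)" by (intro SUP_least) simp
  moreover have "enat (card U) \<le> (SUP S\<in>?S. enat (card S))"
  proof (rule SUP_upper2)
    have U3: "p = 0" if "p \<in> P" "p \<in> polys U" for p using U(3) that by blast
    show "rp.coord ` U \<in> ?S"
      using rp.alg_independent_coords(2)[OF U(1) U3] rp.coord_closed finite_subset[OF U(1) finite_ord_le] by auto
    show "enat (card U) \<le> enat (card (rp.coord ` U))"
      using card_image[OF rp.alg_independent_coords(1)[OF U(1) U3]] by simp
  qed
  ultimately show ?thesis unfolding eq by (rule antisym)
qed

section \<open>The difference transcendence degree and the regularity bound\<close>

context diff_setup
begin

interpretation rp: residue_polys P UNIV by unfold_locales (rule P)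

lemma sigma_dim_eq_kappa:
  "sigma_dim \<sigma> P = diff_trdeg rp.kappa (residue_endo dpol_ring P S) rp.const_kappa"
proof -
  have r: "(dpol_ring :: ('n, 'k) dpol ring) = type_subring (polys UNIV)" by (simp add: polys_UNIV type_subring_UNIV)
  have p: "P = P \<inter> polys UNIV" by (simp add: polys_UNIV)
  show ?thesis
    unfolding sigma_dim_def rp.kappa_def rp.const_kappa_def[abs_def] rp.residue_map_eq[symmetric]
    unfolding r p[symmetric] ..
qed

lemma S_iter_P: "(S ^^ l) p \<in> P \<longleftrightarrow> p \<in> P"
  by (induction l) (simp_all add: sigma_P)

lemma S_iter_polys: "p \<in> polys (ord_le q) \<Longrightarrow> (S ^^ l) p \<in> polys (ord_le (q + l))"
proof (induction l)
  case (Suc l)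
  then show ?case using subsetD[OF polys_mono[OF shift_ord_le] S_polys[OF Suc.IH]] by simp
qed simp

lemma S_diff: "S (p - q) = S p - S q"
proof -
  have "S (p - q) + S q = S p" by (simp add: S_simps(1)[symmetric])
  then show ?thesis by (simp add: eq_diff_eq)
qed

lemma S_1: "S 1 = 1"
  unfolding dpol_sigma_eq_map by (rule mpol_map_1[OF \<sigma>])

lemma endo_kfrac: "b \<notin> P \<Longrightarrow> residue_endo dpol_ring P S (rp.kfrac a b) = rp.kfrac (S a) (S b)"
  using rp.residue_endo_kfrac[of S a b] by (simp add: polys_UNIV type_subring_UNIV sigma_P S_simps S_diff)

lemma endo_iter_kfrac: "b \<notin> P \<Longrightarrow> (residue_endo dpol_ring P S ^^ l) (rp.kfrac a b) = rp.kfrac ((S ^^ l) a) ((S ^^ l) b)"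
  by (induction l) (simp_all add: endo_kfrac S_iter_P)

lemma S_iter_pvar: "(S ^^ l) (pvar (j, q)) = pvar (j, q + l)"
  by (induction l) (simp_all add: S_simps)

text \<open>The coordinates of order zero with index in \<open>T\<close> are difference independent.
  For the upper bound, transforms up to order \<open>M\<close> of a difference independent family of
  fractions of order at most \<open>q\<close> have order at most \<open>q + M\<close>, and
  comparison of growth in \<open>M\<close> limits the size of the family.\<close>

lemma sigma_dim_eq:
  assumes T: "card T + card (UNIV :: 'r set) = card (UNIV :: 'n set)" "\<And>p. p \<in> P \<inter> polys (T \<times> UNIV) \<Longrightarrow> p = 0"
    and C: "\<And>i. i \<ge> e - 1 \<Longrightarrow> gdim P (ord_le i) + C = card (UNIV :: 'r set) * (i + 1)"
  shows "sigma_dim \<sigma> P = enat (card T)"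
proof -
  let ?E = "residue_endo dpol_ring P S" and ?\<iota> = rp.const_kappa
  let ?S = "{W. W \<subseteq> carrier rp.kappa \<and> finite W \<and> diff_independent rp.kappa ?E ?\<iota> W}"
  have eq: "sigma_dim \<sigma> P = (SUP W\<in>?S. enat (card W))"
    unfolding sigma_dim_eq_kappa diff_trdeg_def ..
  have "card W \<le> card T" if W: "W \<in> ?S" for W
  proof -
    have "\<forall>s\<in>W. \<exists>a b. b \<notin> P \<and> s = rp.kfrac a b"
      using W unfolding rp.kappa_carrier by blast
    from bchoice[OF this] obtain a where "\<forall>s\<in>W. \<exists>b. b \<notin> P \<and> s = rp.kfrac (a s) b" ..
    from bchoice[OF this] obtain b where ab: "\<forall>s\<in>W. b s \<notin> P \<and> s = rp.kfrac (a s) (b s)" ..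
    have "finite (\<Union>s\<in>W. mpol_vars (a s) \<union> mpol_vars (b s))" using W by (simp add: finite_mpol_vars)
    from finite_subset_ord_le[OF this] obtain q where "(\<Union>s\<in>W. mpol_vars (a s) \<union> mpol_vars (b s)) \<subseteq> ord_le q" by blast
    then have q: "a s \<in> polys (ord_le q)" "b s \<in> polys (ord_le q)" if "s \<in> W" for s
      using that by (auto simp: polys_def)
    have main: "card W * (M + 1) + gdim P (ord_le (q + M)) \<le> card (UNIV :: 'n set) * (q + M + 1)" for M
    proof -
      have "card (W \<times> {..M}) + gdim P (ord_le (q + M)) \<le> card (ord_le (q + M) :: ('n \<times> nat) set)"
      proof (rule rp.alg_independent_kappa_card[OF finite_ord_le subset_UNIV, where z = "\<lambda>(s, l). (?E ^^ l) s"])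
        show "finite (W \<times> {..M})" using W by simp
        show "alg_independent rp.kappa ?\<iota> (W \<times> {..M}) (\<lambda>(s, l). (?E ^^ l) s)"
          using W unfolding diff_independent_def alg_independent_def by blast
        fix t assume "t \<in> W \<times> {..M}"
        then obtain s l where t: "t = (s, l)" "s \<in> W" "l \<le> M" by auto
        have sub: "polys (ord_le (q + l)) \<subseteq> (polys (ord_le (q + M)) :: ('n, 'k) dpol set)"
          using t(3) by (intro polys_mono) (auto simp: ord_le_def)
        have A: "(S ^^ l) (a s) \<in> polys (ord_le (q + M))" using S_iter_polys[OF q(1)[OF t(2)], of l] sub by blast
        have B: "(S ^^ l) (b s) \<in> polys (ord_le (q + M))" using S_iter_polys[OF q(2)[OF t(2)], of l] sub by blast
        have bs: "b s \<notin> P" "s = rp.kfrac (a s) (b s)" using ab t(2) by blast+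
        have "(?E ^^ l) s = rp.kfrac ((S ^^ l) (a s)) ((S ^^ l) (b s))"
          using endo_iter_kfrac[OF bs(1), of l "a s"] unfolding bs(2)[symmetric] .
        then show "\<exists>a\<in>polys (ord_le (q + M)). \<exists>b\<in>polys (ord_le (q + M)). b \<notin> P \<and>
            (case t of (s, l) \<Rightarrow> (?E ^^ l) s) = rp.kfrac a b"
          using bexI[OF _ A] bexI[OF _ B] bs(1) S_iter_P t(1) by simp
      qed
      then show ?thesis by (simp add: card_cartesian_product card_ord_le)
    qed
    show ?thesis
    proof (rule ccontr)
      assume neg: "\<not> ?thesis"
      \<comment> \<open>Large enough that one excess element beats the bounded terms
        \<open>card T * q + C\<close>; the summand \<open>e\<close> puts \<open>q + M\<close> in the
        range where \<open>C\<close> is valid.\<close>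
      define M where "M = card T * q + C + e"
      have "e - 1 \<le> q + M" by (simp add: M_def)
      from C[OF this] have "card W * (M + 1) + card (UNIV :: 'r set) * (q + M + 1) \<le> card (UNIV :: 'n set) * (q + M + 1) + C"
        using main[of M] by linarith
      then have "card W * (M + 1) \<le> card T * (q + M + 1) + C"
        unfolding T(1)[symmetric] by (simp add: algebra_simps)
      moreover have "(card T + 1) * (M + 1) \<le> card W * (M + 1)" using neg by (intro mult_right_mono) auto
      ultimately have "(card T + 1) * (M + 1) \<le> card T * (q + M + 1) + C" by linarith
      then show False by (simp add: M_def algebra_simps)
    qed
  qed
  then have "(SUP W\<in>?S. enat (card W)) \<le> enat (card T)" by (intro SUP_least) simp
  moreover have "enat (card T) \<le> (SUP W\<in>?S. enat (card W))"
  proof (rule SUP_upper2)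
    let ?y = "\<lambda>j. rp.coord (j, 0::nat)"
    have coord: "rp.coord (j, l) = (?E ^^ l) (?y j)" for j l
    proof -
      have "(S ^^ l) (1 :: ('n, 'k) dpol) = 1" by (induction l) (simp_all add: S_1)
      then show ?thesis
        using endo_iter_kfrac[OF prime_id_one[OF P], of l "pvar (j, 0)"]
        by (simp add: rp.coord_def S_iter_pvar)
    qed
    have T2: "p = 0" if "p \<in> P" "p \<in> polys (T \<times> UNIV)" for p using T(2) that by blast
    have inj: "inj_on ?y T"
      using rp.alg_independent_coords(1)[OF subset_UNIV T2] by (auto simp: inj_on_def)
    have "diff_independent rp.kappa ?E ?\<iota> (?y ` T)"
      unfolding diff_independent_def alg_independent_def
    proof (intro allI impI)
      fix p assume "mpol_vars p \<subseteq> ?y ` T \<times> (UNIV :: nat set)" and z: "mpol_eval rp.kappa ?\<iota> (\<lambda>(s, l). (?E ^^ l) s) p = \<zero>\<^bsub>rp.kappa\<^esub>"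
      then have p: "p \<in> polys (?y ` T \<times> UNIV)" by (simp add: polys_def)
      \<comment> \<open>Difference independence is indexed by the values themselves, the coordinates
        by indices \<open>j\<close>; these maps translate between the two.\<close>
      let ?g = "\<lambda>(s, l). (inv_into T ?y s, l)" and ?h = "\<lambda>(j, l). (?y j, l)"
      let ?q = "mpol_map ?g id p"
      have "?g ` (?y ` T \<times> (UNIV :: nat set)) \<subseteq> T \<times> UNIV"
      proof (rule image_subsetI)
        fix v assume "v \<in> ?y ` T \<times> (UNIV :: nat set)"
        then have "fst v \<in> ?y ` T" by (simp add: mem_Times_iff)
        then have "inv_into T ?y (fst v) \<in> T" by (rule inv_into_into)
        then show "?g v \<in> T \<times> UNIV" by (simp add: case_prod_unfold)
      qed
      from subsetD[OF polys_mono[OF this] mpol_map_polys[OF endo_id p]]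
      have q: "?q \<in> polys (T \<times> UNIV)" .
      have inverse: "mpol_map ?h id ?q = p"
      proof (rule mpol_map_inverse[OF p])
        fix v assume "v \<in> ?y ` T \<times> (UNIV :: nat set)"
        then have "fst v \<in> ?y ` T" by (simp add: mem_Times_iff)
        from f_inv_into_f[OF this] show "?h (?g v) = v" by (simp add: case_prod_unfold)
      qed
      have "mpol_eval rp.kappa ?\<iota> rp.coord ?q = mpol_eval rp.kappa ?\<iota> (\<lambda>v. rp.coord (?g v)) p"
        by (rule rp.eval_map[OF rp.coord_closed])
      also have "\<dots> = mpol_eval rp.kappa ?\<iota> (\<lambda>(s, l). (?E ^^ l) s) p"
      proof (rule rp.eval_cong[symmetric, OF _ _ p])
        show "rp.coord (?g v) \<in> carrier rp.kappa" for v by (rule rp.coord_closed)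
        show "(\<lambda>(s, l). (?E ^^ l) s) v = rp.coord (?g v)" if "v \<in> ?y ` T \<times> UNIV" for v
        proof -
          have "fst v \<in> ?y ` T" using that by (simp add: mem_Times_iff)
          from f_inv_into_f[OF this] have "rp.coord (inv_into T ?y (fst v), snd v) = (?E ^^ snd v) (fst v)"
            unfolding coord[of "inv_into T ?y (fst v)" "snd v"] by (rule arg_cong)
          then show ?thesis by (simp add: case_prod_unfold)
        qed
      qed
      finally have "?q \<in> P" using z rp.eval_coord_zero_iff by (simp add: polys_UNIV)
      then have "?q = 0" using T2 q by blast
      then show "p = 0" using inverse by (simp add: mpol_map_0[OF endo_id])
    qed
    then show "?y ` T \<in> ?S" using rp.coord_closed by auto
    show "enat (card T) \<le> enat (card (?y ` T))" using card_image[OF inj] by simp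
  qed
  ultimately show ?thesis unfolding eq by (rule antisym)
qed

text \<open>The transcendence degree is \<open>card T * (i + 1) + C\<close> from
  \<open>e - 1\<close> on. The factor is the difference dimension, and a single large
  \<open>i\<close> then determines the order as \<open>C\<close>.\<close>

theorem regularity_bound:
  assumes e: "e \<ge> 1"
  shows "hilbert_levin_regularity \<sigma> P \<le> e - 1"
proof -
  from dimension_growth[OF e] obtain T C where TC: "card T + card (UNIV :: 'r set) = card (UNIV :: 'n set)"
    "\<forall>i\<ge>e - 1. gdim P (ord_le i) + C = card (UNIV :: 'r set) * (i + 1)" "\<forall>p\<in>P \<inter> polys (T \<times> UNIV). p = 0"
    "\<forall>i. \<exists>U\<subseteq>ord_le i. card U + gdim P (ord_le i) = card (UNIV :: 'n set) * (i + 1) \<and> (\<forall>p\<in>P \<inter> polys U. p = 0)"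
    by blast
  have sd: "sigma_dim \<sigma> P = enat (card T)"
    by (rule sigma_dim_eq[OF TC(1), where C = C]) (use TC in auto)
  have tr: "trdeg_A P i = enat (card T * (i + 1) + C)" if i: "i \<ge> e - 1" for i
  proof -
    obtain U where U: "U \<subseteq> ord_le i" "card U + gdim P (ord_le i) = card (UNIV :: 'n set) * (i + 1)"
      "\<forall>p\<in>P \<inter> polys U. p = 0" using TC(4) by blast
    have "card U + card (UNIV :: 'r set) * (i + 1) = (card T + card (UNIV :: 'r set)) * (i + 1) + C"
      using U(2) TC(2) i unfolding TC(1)[symmetric] by fastforce
    then have "card U = card T * (i + 1) + C" by (simp add: algebra_simps)
    then show ?thesis using trdeg_A_eq[OF P U(1,2) _ refl] U(3) by simp
  qed
  have order: "diff_ideal_order \<sigma> P = C"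
    unfolding diff_ideal_order_def sd
  proof (rule the_equality)
    show "\<exists>i0. \<forall>i\<ge>i0. enat (card T) * enat (i + 1) + enat C = trdeg_A P i"
      using tr by (intro exI[of _ "e - 1"]) auto
    fix h assume "\<exists>i0. \<forall>i\<ge>i0. enat (card T) * enat (i + 1) + enat h = trdeg_A P i"
    then obtain i0 where i0: "\<And>i. i \<ge> i0 \<Longrightarrow> enat (card T) * enat (i + 1) + enat h = trdeg_A P i" by blast
    show "h = C" using i0[of "max i0 (e - 1)"] tr[of "max i0 (e - 1)"] by simp
  qed
  show ?thesis
    unfolding hilbert_levin_regularity_def
    by (rule Least_le) (use tr in \<open>simp add: dimension_polynomial_def sd order\<close>)
qed

end

section \<open>The prime as a localized system ideal\<close>

lemma gen_sigma:
  assumes \<sigma>: "ring_endo \<sigma>" and "p \<in> gen_ideal UNIV (range (prolong \<sigma> f))"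
  shows "dpol_sigma \<sigma> p \<in> gen_ideal UNIV (range (prolong \<sigma> f))"
  using assms(2)
proof induction
  case zero
  show ?case unfolding dpol_sigma_eq_map mpol_map_0[OF \<sigma>] by (rule gen_ideal.zero)
next
  case (step b x a)
  then obtain y where x: "x = prolong \<sigma> f y" by blast
  have "dpol_sigma \<sigma> (b * x + a) = dpol_sigma \<sigma> b * prolong \<sigma> f (shift y) + dpol_sigma \<sigma> a"
    unfolding x prolong_shift by (simp add: dpol_sigma_eq_map mpol_map_add[OF \<sigma>] mpol_map_mult[OF \<sigma>])
  then show ?case using gen_ideal.step[OF UNIV_I _ step.IH, of "prolong \<sigma> f (shift y)"] by simp
qed

text \<open>This will be the contraction of \<open>Delta_infinity\<close> to the difference
  polynomial ring, described by prolongations and denominators outside \<open>P\<close>.\<close>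

definition system_ideal ::
  "('k \<Rightarrow> 'k) \<Rightarrow> ('r \<Rightarrow> ('n, 'k::comm_ring_1) dpol) \<Rightarrow> ('n, 'k) dpol set \<Rightarrow> ('n, 'k) dpol set" where
  "system_ideal \<sigma> f P = saturation UNIV P (gen_ideal UNIV (range (prolong \<sigma> f)))"

context
  fixes \<sigma> :: "'k::field_char_0 \<Rightarrow> 'k" and f :: "'r::finite \<Rightarrow> ('n::finite, 'k) dpol" and P :: "('n, 'k) dpol set"
  assumes \<sigma>: "ring_endo \<sigma>" and P: "prime_id P" and sigma_P: "\<And>p. dpol_sigma \<sigma> p \<in> P \<longleftrightarrow> p \<in> P"
    and f_P: "\<And>a. f a \<in> P"
begin

interpretation pu: prime_over_subring "UNIV :: ('n, 'k) dpol set" P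
  by unfold_locales (rule subring_set_UNIV, rule P)

lemma saturated_system_ideal: "saturated UNIV P (system_ideal \<sigma> f P)"
  unfolding system_ideal_def by (rule pu.saturated_sat[OF ideal_in_gen[OF subring_set_UNIV subset_UNIV]])

lemma ideal_system_ideal: "ideal_in UNIV (system_ideal \<sigma> f P)"
  using saturated_system_ideal by (simp add: saturated_def)

lemmas prolong_P = prolong_mem[OF sigma_P, where f = f, OF f_P]

lemma system_ideal_subset: "system_ideal \<sigma> f P \<subseteq> P"
proof -
  have s: "saturated UNIV P P" using pu.saturated_prime by simp
  then have "ideal_in UNIV P" by (simp add: saturated_def)
  then have "gen_ideal UNIV (range (prolong \<sigma> f)) \<subseteq> P" using prolong_P by (intro gen_least) auto
  then show ?thesis unfolding system_ideal_def by (rule sat_least[OF s])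
qed

lemma f_system_ideal: "f a \<in> system_ideal \<sigma> f P"
proof -
  have "prolong \<sigma> f (a, 0) \<in> gen_ideal UNIV (range (prolong \<sigma> f))" by (rule gen_incl[OF subring_set_UNIV]) simp
  then show ?thesis
    using pu.sat_incl[OF ideal_in_gen[OF subring_set_UNIV subset_UNIV]] by (auto simp: system_ideal_def prolong_def)
qed

lemma system_ideal_sigma: "p \<in> system_ideal \<sigma> f P \<Longrightarrow> dpol_sigma \<sigma> p \<in> system_ideal \<sigma> f P"
proof -
  assume "p \<in> system_ideal \<sigma> f P"
  then obtain s where s: "s \<notin> P" "s * p \<in> gen_ideal UNIV (range (prolong \<sigma> f))" by (auto simp: system_ideal_def saturation_def)
  from gen_sigma[OF \<sigma> s(2)] have "dpol_sigma \<sigma> s * dpol_sigma \<sigma> p \<in> gen_ideal UNIV (range (prolong \<sigma> f))"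
    by (simp add: dpol_sigma_eq_map mpol_map_mult[OF \<sigma>])
  then show ?thesis using s(1) sigma_P[of s] unfolding system_ideal_def saturation_def by blast
qed

text \<open>One membership in the ideal involves finitely many prolongations and variables, so the
  question descends to a polynomial ring in a finite set \<open>V\<close>, where the Jacobian
  criterion applies.\<close>

lemma system_ideal_prime:
  assumes ind: "\<And>m. indep UNIV P {(j, l). l < m + e} (UNIV \<times> {..<m}) (\<lambda>x v. mpol_deriv v (prolong \<sigma> f x))"
    and ab: "a * b \<in> system_ideal \<sigma> f P"
  shows "a \<in> system_ideal \<sigma> f P \<or> b \<in> system_ideal \<sigma> f P"
proof -
  let ?F = "prolong \<sigma> f"
  from ab obtain s where s: "s \<notin> P" "s * (a * b) \<in> gen_ideal UNIV (range ?F)" by (auto simp: system_ideal_def saturation_def)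
  from gen_prolong_bounded[OF s(2)] obtain m where m: "s * (a * b) \<in> gen_ideal UNIV (?F ` (UNIV \<times> {..<m}))" by blast
  let ?X = "UNIV \<times> {..<m} :: ('r \<times> nat) set"
  have fX: "finite ?X" by simp
  from gen_image_sum[OF subring_set_UNIV fX m] obtain c where c: "s * (a * b) = (\<Sum>x\<in>?X. c x * ?F x)" by blast
  let ?Z = "mpol_vars s \<union> mpol_vars a \<union> mpol_vars b \<union> (\<Union>x\<in>?X. mpol_vars (c x) \<union> mpol_vars (?F x))"
  have "finite ?Z" using fX by (simp add: finite_mpol_vars)
  from finite_subset_ord_le[OF this] obtain K where K: "\<And>k. k \<ge> K \<Longrightarrow> ?Z \<subseteq> ord_le k" by blast
  define V where "V = (ord_le (K + m + e) :: ('n \<times> nat) set)"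
  have V: "finite V" by (simp add: V_def finite_ord_le)
  have ZV: "?Z \<subseteq> V" unfolding V_def by (rule K) simp
  have pB: "s \<in> polys V" "a \<in> polys V" "b \<in> polys V" "\<And>x. x \<in> ?X \<Longrightarrow> c x \<in> polys V" "\<And>x. x \<in> ?X \<Longrightarrow> ?F x \<in> polys V"
    using ZV unfolding polys_def by blast+
  have indV: "indep UNIV P V ?X (\<lambda>x v. mpol_deriv v (?F x))"
    by (rule indep_mono[OF ind]) (auto simp: V_def ord_le_def)
  \<comment> \<open>Two equal prolongations would have equal gradients, contradicting independence;
    hence the prolongations may be treated as a set.\<close>
  have inj: "inj_on ?F ?X"
  proof (rule inj_onI, rule ccontr)
    fix x y assume xy: "x \<in> ?X" "y \<in> ?X" "?F x = ?F y" "x \<noteq> y"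
    let ?c = "\<lambda>z. (if z = x then 1 else 0) - (if z = y then 1 else 0) :: ('n, 'k) dpol"
    have "(\<Sum>z\<in>?X. ?c z * mpol_deriv v (?F z)) = 0" for v
    proof -
      have "(\<Sum>z\<in>?X. ?c z * mpol_deriv v (?F z))
        = (\<Sum>z\<in>?X. if z = x then mpol_deriv v (?F x) else 0) - (\<Sum>z\<in>?X. if z = y then mpol_deriv v (?F y) else 0)"
        unfolding sum_subtractf[symmetric] by (intro sum.cong) auto
      also have "\<dots> = 0" using xy fX by (simp only: sum.delta if_True diff_self)
      finally show ?thesis .
    qed
    then have "?c x \<in> P"
      by (intro indepD[OF indV, where c = ?c and i = x]) (use xy prime_id_zero[OF P] in simp_all)
    then show False using xy(4) prime_id_one[OF P] by simp
  qed
  have gi: "grad_indep P V (?F ` ?X)"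
    unfolding grad_indep_def indep_reindex[OF inj] by (rule indV)
  have ab': "a * b \<in> saturation (polys V) P (gen_ideal (polys V) (?F ` ?X))"
  proof -
    have "(\<Sum>x\<in>?X. c x * ?F x) \<in> gen_ideal (polys V) (?F ` ?X)"
      by (rule sum_in_gen[OF subring_set_polys]) (use pB in auto)
    then show ?thesis using s(1) pB polys_mult[of a V b] unfolding c[symmetric] saturation_def by blast
  qed
  have FX: "?F ` ?X \<subseteq> P \<inter> polys V" using prolong_P pB(5) by blast
  have "a \<in> saturation (polys V) P (gen_ideal (polys V) (?F ` ?X)) \<or> b \<in> saturation (polys V) P (gen_ideal (polys V) (?F ` ?X))"
    by (rule mpol_jacobian_prime[OF P V finite_imageI[OF fX] FX gi pB(2,3) ab'])
  moreover have "saturation (polys V) P (gen_ideal (polys V) (?F ` ?X)) \<subseteq> system_ideal \<sigma> f P"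
    using gen_mono[of "polys V" UNIV "?F ` ?X" "range ?F"] unfolding system_ideal_def saturation_def by blast
  ultimately show ?thesis by blast
qed

text \<open>Reflexivity is given for \<open>Delta_infinity\<close> in the localization, so
  \<open>S a\<close> is moved there and \<open>a\<close> moved back. This needs both that
  \<open>Delta_infinity\<close> contains the fractions arising from the system ideal and that it
  contains no others.\<close>

lemma system_ideal_reflexive:
  assumes refl: "diff_reflexive (localization dpol_ring (- P)) (loc_endo dpol_ring (- P) (dpol_sigma \<sigma>))
      (Delta_infinity \<sigma> f P)"
    and a: "dpol_sigma \<sigma> a \<in> system_ideal \<sigma> f P"
  shows "a \<in> system_ideal \<sigma> f P"
proof -
  let ?S = "dpol_sigma \<sigma>" and ?Q = "system_ideal \<sigma> f P"
  have R: "ring_of_type_algebra = (type_subring UNIV :: ('n, 'k) dpol ring)" by (rule type_subring_UNIV[symmetric])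
  interpret pl: presented_localization "type_subring UNIV :: ('n, 'k) dpol ring" "\<lambda>x. x" UNIV "- P" "{0}"
    by (rule presented_localization_type[OF P])
  interpret Lr: cring pl.L by (rule pl.cring_L)
  let ?E = "loc_endo dpol_ring (- P) ?S"
  have L: "localization dpol_ring (- P) = pl.L" by (simp add: R)
  note image_ident [simp del]
  have map: "loc_map dpol_ring (- P) p = pl.frac p 1" for p
    by (simp add: loc_map_def pl.frac_def R type_subring_simps image_ident)
  have S_simps: "?S (p * q) = ?S p * ?S q" "?S (p + q) = ?S p + ?S q" "?S 0 = 0" "?S 1 = 1" for p q
    by (simp_all add: dpol_sigma_eq_map mpol_map_mult[OF \<sigma>] mpol_map_add[OF \<sigma>] mpol_map_0[OF \<sigma>] mpol_map_1[OF \<sigma>])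
  have S_diff: "?S (p - q) = ?S p - ?S q" for p q
    using S_simps(2)[of "p - q" q] by (simp add: eq_diff_eq)
  have E: "?E (pl.frac p s) = pl.frac (?S p) (?S s)" if "s \<notin> P" for p s
    using pl.loc_endo_frac[of ?S ?S p s] that by (simp add: R sigma_P S_simps S_diff image_ident)
  have oneP: "1 \<notin> P" by (rule prime_id_one[OF P])
  have J: "pl.frac z 1 \<in> J"
    if J: "diff_ideal pl.L ?E J" "\<And>a. pl.frac (f a) 1 \<in> J" and z: "z \<in> gen_ideal UNIV (range (prolong \<sigma> f))" for J z
  proof -
    interpret J: ideal J pl.L using J(1) by (simp add: diff_ideal_def)
    have EJ: "?E x \<in> J" if "x \<in> J" for x using J(1) that by (auto simp: diff_ideal_def)
    have F: "pl.frac (prolong \<sigma> f (r, l)) 1 \<in> J" for r l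
    proof (induction l)
      case 0
      then show ?case using J(2) by (simp add: prolong_def)
    next
      case (Suc l)
      from EJ[OF this] show ?case by (simp add: E oneP S_simps prolong_def)
    qed
    from z show ?thesis
    proof induction
      case zero
      show ?case using J.zero_closed unfolding pl.frac_zero .
    next
      case (step b x a)
      then obtain y where x: "x = prolong \<sigma> f y" by blast
      have "pl.frac b 1 \<otimes>\<^bsub>pl.L\<^esub> pl.frac x 1 \<in> J"
        using F[of "fst y" "snd y"] oneP by (intro J.I_l_closed) (simp_all add: x pl.frac_closed)
      from J.a_closed[OF this step.IH] show ?case
        using oneP by (simp add: pl.frac_mult pl.frac_add)
    qed
  qed
  from a obtain u where u: "u \<notin> P" "u * ?S a \<in> gen_ideal UNIV (range (prolong \<sigma> f))" by (auto simp: system_ideal_def saturation_def)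
  \<comment> \<open>Any difference ideal containing the \<open>f a\<close> contains all
    prolongations, hence \<open>u * ?S a\<close>, and \<open>u\<close> is a unit in the
    localization.\<close>
  have "pl.frac (?S a) 1 \<in> Delta_infinity \<sigma> f P"
    unfolding Delta_infinity_def diff_ideal_gen_def L map
  proof (rule InterI, clarify)
    fix J assume dJ: "diff_ideal pl.L ?E J" and "range (\<lambda>a. pl.frac (f a) 1) \<subseteq> J"
    then have zJ: "pl.frac (u * ?S a) 1 \<in> J" using J[OF dJ _ u(2)] by blast
    interpret J: ideal J pl.L using dJ by (simp add: diff_ideal_def)
    have "pl.frac 1 u \<otimes>\<^bsub>pl.L\<^esub> pl.frac (u * ?S a) 1 \<in> J"
      using zJ u(1) by (intro J.I_l_closed) (simp_all add: pl.frac_closed)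
    also have "pl.frac 1 u \<otimes>\<^bsub>pl.L\<^esub> pl.frac (u * ?S a) 1 = pl.frac (?S a) 1"
      using u(1) oneP by (simp add: pl.frac_mult) (rule pl.frac_eqI; simp add: mult.commute)
    finally show "pl.frac (?S a) 1 \<in> J" .
  qed
  then have "?E (pl.frac a 1) \<in> Delta_infinity \<sigma> f P" by (simp add: E oneP S_simps)
  then have "pl.frac a 1 \<in> Delta_infinity \<sigma> f P"
    using refl oneP unfolding diff_reflexive_def L by (auto simp: pl.frac_closed)
  \<comment> \<open>The fractions with numerator in the system ideal form a difference ideal
    containing the \<open>f a\<close>, so they bound \<open>Delta_infinity\<close> from
    above.\<close>
  moreover define J where "J = {pl.frac q s | q s. q \<in> ?Q \<and> s \<notin> P}"
  have "diff_ideal pl.L ?E J"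
    unfolding diff_ideal_def
  proof
    note QI = ideal_system_ideal
    show "ideal J pl.L"
    proof (rule idealI[OF Lr.ring_axioms])
      show "subgroup J (add_monoid pl.L)"
      proof (rule Lr.add.subgroupI)
        show "J \<subseteq> carrier pl.L" by (auto simp: J_def pl.frac_closed)
        show "J \<noteq> {}" using ideal_inD(2)[OF QI] oneP by (auto simp: J_def)
        fix x assume "x \<in> J"
        then obtain q s where q: "q \<in> ?Q" "s \<notin> P" "x = pl.frac q s" by (auto simp: J_def)
        have "\<ominus>\<^bsub>pl.L\<^esub> x = pl.frac (- q) s"
        proof (rule Lr.minus_equality)
          show "pl.frac (- q) s \<oplus>\<^bsub>pl.L\<^esub> x = \<zero>\<^bsub>pl.L\<^esub>"
            using q oneP by (simp add: pl.frac_add pl.frac_zero)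
              (rule pl.frac_eqI; simp add: prime_id_mult_iff[OF P])
        qed (use q in \<open>auto simp: pl.frac_closed\<close>)
        then show "\<ominus>\<^bsub>pl.L\<^esub> x \<in> J"
          using q ideal_in_uminus[OF subring_set_UNIV QI q(1)] by (auto simp: J_def)
        fix y assume "y \<in> J"
        then obtain q' s' where q': "q' \<in> ?Q" "s' \<notin> P" "y = pl.frac q' s'" by (auto simp: J_def)
        have "x \<oplus>\<^bsub>pl.L\<^esub> y = pl.frac (q * s' + q' * s) (s * s')" using q q' by (simp add: pl.frac_add)
        moreover have "q * s' + q' * s \<in> ?Q" using q q' by (intro ideal_inD(3,5)[OF QI]) auto
        moreover have "s * s' \<notin> P" using q q' by (simp add: prime_id_mult_iff[OF P])
        ultimately show "x \<oplus>\<^bsub>pl.L\<^esub> y \<in> J" unfolding J_def by blast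
      qed
      fix x y assume "x \<in> J" and y: "y \<in> carrier pl.L"
      then obtain q s where q: "q \<in> ?Q" "s \<notin> P" "x = pl.frac q s" by (auto simp: J_def)
      from y obtain b t where b: "t \<notin> P" "y = pl.frac b t" by (auto elim: pl.frac_cases)
      have yx: "y \<otimes>\<^bsub>pl.L\<^esub> x = pl.frac (b * q) (t * s)" using q b by (simp add: pl.frac_mult)
      moreover have "b * q \<in> ?Q" using q by (intro ideal_inD(4)[OF QI]) auto
      moreover have "t * s \<notin> P" using q b by (simp add: prime_id_mult_iff[OF P])
      ultimately show "y \<otimes>\<^bsub>pl.L\<^esub> x \<in> J" unfolding J_def by blast
      then show "x \<otimes>\<^bsub>pl.L\<^esub> y \<in> J" using Lr.m_comm[of x y] y q by (simp add: pl.frac_closed)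
    qed
    show "?E ` J \<subseteq> J"
      using system_ideal_sigma sigma_P unfolding J_def by (auto simp: E) blast
  qed
  moreover have "range (\<lambda>a. pl.frac (f a) 1) \<subseteq> J" using f_system_ideal oneP by (auto simp: J_def)
  ultimately have "pl.frac a 1 \<in> J"
    unfolding Delta_infinity_def diff_ideal_gen_def L map by blast
  then obtain q s where q: "q \<in> ?Q" "s \<notin> P" "pl.frac a 1 = pl.frac q s" by (auto simp: J_def)
  then obtain v where v: "v \<notin> P" "v * (a * s - q * 1) = 0" using pl.frac_eq_iff[of a 1 q s] oneP by auto
  have "(v * s) * a = v * q" using v(2) by (simp add: algebra_simps)
  moreover have "v * q \<in> ?Q" using q by (intro ideal_inD(4)[OF ideal_system_ideal]) auto
  moreover have "v * s \<notin> P" using v q by (simp add: prime_id_mult_iff[OF P])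
  ultimately show ?thesis using saturatedD[OF saturated_system_ideal, of a "v * s"] by simp
qed

end

section \<open>From quasi-regularity to the regularity bound\<close>

lemma rows_independent_indep:
  assumes P: "prime_id P" and B: "subring_set B" and fX: "finite T"
    and M: "\<And>i j. i \<in> T \<Longrightarrow> j \<in> J \<Longrightarrow> M i j \<in> B"
    and r: "rows_independent (type_subring B Quot (B \<inter> P)) T J
      (\<lambda>i j. (B \<inter> P) +>\<^bsub>type_subring B\<^esub> M i j)"
  shows "indep B P J T M"
  unfolding indep_def
proof (intro allI impI)
  interpret pb: prime_over_subring B P by unfold_locales (rule B, rule P)
  have BP: "B \<inter> P = P \<inter> B" by blast
  interpret pl: presented_localization "type_subring B Quot (P \<inter> B)" "\<lambda>a. pb.coset a" B "B - P" "P \<inter> B"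
    by (rule pb.presented_localization_quotient)
  let ?R = "type_subring B Quot (P \<inter> B)"
  fix c assume c: "\<forall>i\<in>T. c i \<in> B" "\<forall>j\<in>J. (\<Sum>i\<in>T. c i * M i j) \<in> P"
  have zero: "pb.coset a = \<zero>\<^bsub>?R\<^esub> \<longleftrightarrow> a \<in> P" if "a \<in> B" for a using pl.pi_zero_iff[OF that] that by simp
  have sum: "(\<Oplus>\<^bsub>?R\<^esub>i\<in>U. pb.coset (c i) \<otimes>\<^bsub>?R\<^esub> pb.coset (M i j)) = pb.coset (\<Sum>i\<in>U. c i * M i j)"
    if j: "j \<in> J" and "U \<subseteq> T" for j U
    using finite_subset[OF that(2) fX] that(2)
  proof (induction U rule: finite_induct)
    case empty
    then show ?case using zero[of 0] subring_set_zero[OF B] prime_id_zero[OF P] by simp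
  next
    case (insert i U)
    have cM: "c k \<in> B" "M k j \<in> B" if "k \<in> insert i U" for k using that insert.prems c(1) M j by blast+
    have "(\<Oplus>\<^bsub>?R\<^esub>i\<in>insert i U. pb.coset (c i) \<otimes>\<^bsub>?R\<^esub> pb.coset (M i j))
        = pb.coset (c i) \<otimes>\<^bsub>?R\<^esub> pb.coset (M i j) \<oplus>\<^bsub>?R\<^esub> (\<Oplus>\<^bsub>?R\<^esub>i\<in>U. pb.coset (c i) \<otimes>\<^bsub>?R\<^esub> pb.coset (M i j))"
      using insert.hyps cM by (intro pl.R.finsum_insert) (auto simp: pl.pi_closed)
    also have "\<dots> = pb.coset (c i * M i j + (\<Sum>i\<in>U. c i * M i j))"
    proof -
      have "c i * M i j \<in> B" "(\<Sum>i\<in>U. c i * M i j) \<in> B"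
        using cM by (auto intro!: subring_set_mult[OF B] subring_set_sum[OF B])
      then show ?thesis using insert cM by (simp add: pl.pi_add pl.pi_mult)
    qed
    finally show ?case using insert.hyps by simp
  qed
  have "(\<Oplus>\<^bsub>?R\<^esub>i\<in>T. pb.coset (c i) \<otimes>\<^bsub>?R\<^esub> pb.coset (M i j)) = \<zero>\<^bsub>?R\<^esub>" if j: "j \<in> J" for j
  proof -
    have "(\<Sum>i\<in>T. c i * M i j) \<in> B" using c(1) M j by (auto intro!: subring_set_mult[OF B] subring_set_sum[OF B])
    then show ?thesis using sum[OF j subset_refl] zero c(2) j by simp
  qed
  moreover have "(\<lambda>i. pb.coset (c i)) \<in> T \<rightarrow> carrier ?R" using c(1) by (auto simp: pl.pi_closed)
  ultimately have "\<forall>i\<in>T. pb.coset (c i) = \<zero>\<^bsub>?R\<^esub>"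
    using r unfolding rows_independent_def BP by fast
  then show "\<forall>i\<in>T. c i \<in> P" using zero c(1) by blast
qed

text \<open>The maximum in \<open>matrix_rank\<close> is attained, and the only subset with as many
  elements as the finite set \<open>T\<close> is \<open>T\<close> itself.\<close>

lemma full_matrix_rank:
  assumes "finite T" "matrix_rank R T J M = card T"
  shows "rows_independent R T J M"
proof -
  let ?C = "{card S | S. S \<subseteq> T \<and> rows_independent R S J M}"
  have "finite ?C" by (rule finite_subset[of _ "card ` Pow T"]) (use assms(1) in auto)
  moreover have "rows_independent R {} J M" by (simp add: rows_independent_def)
  then have "?C \<noteq> {}" by blast
  ultimately have "Max ?C \<in> ?C" by (rule Max_in)
  then obtain S where "S \<subseteq> T" "rows_independent R S J M" "card S = card T"
    using assms(2) unfolding matrix_rank_def by auto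
  then show ?thesis using card_subset_eq[OF assms(1)] by blast
qed

text \<open>Full rank over the domain means independence with coefficients in the ring of
  polynomials of order at most \<open>m + max_ord f - 1\<close>; these are then enlarged to the
  whole ring. Quasi-regularity speaks of positive \<open>m\<close>, and for \<open>m = 0\<close>
  there are no rows.\<close>

lemma quasi_regular_indep:
  fixes f :: "'r::finite \<Rightarrow> ('n::finite, 'k::field_char_0) dpol"
  assumes \<sigma>: "ring_endo \<sigma>" and P: "prime_id P" and q: "quasi_regular \<sigma> f P" and e: "max_ord f \<ge> 1"
    and ord: "\<And>a. f a \<in> polys (ord_le (max_ord f))"
  shows "indep UNIV P {(j, l). l < m + max_ord f} (UNIV \<times> {..<m}) (\<lambda>x v. mpol_deriv v (prolong \<sigma> f x))"
proof (cases "m = 0")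
  case True
  then show ?thesis by (simp add: indep_def)
next
  case False
  let ?e = "max_ord f" let ?K = "m + ?e - 1" let ?B = "polys (ord_le ?K) :: ('n, 'k) dpol set"
  let ?T = "UNIV \<times> {..<m} :: ('r \<times> nat) set" and ?J = "UNIV \<times> {..?K} :: ('n \<times> nat) set"
  have F: "prolong \<sigma> f x \<in> ?B" if "x \<in> ?T" for x
  proof -
    have "prolong \<sigma> f x \<in> polys (ord_le (snd x + ?e))"
      using prolong_polys[OF \<sigma>, where f = f, OF ord, of "fst x" "snd x"] by simp
    moreover have "ord_le (snd x + ?e) \<subseteq> (ord_le ?K :: ('n \<times> nat) set)" using that by (auto simp: ord_le_def)
    ultimately show ?thesis using polys_mono by blast
  qed
  have mset: "{..m - 1} = {..<m}" using False by auto
  have M: "(\<lambda>(a, l) v. (?B \<inter> P) +>\<^bsub>type_subring ?B\<^esub> mpol_deriv v ((dpol_sigma \<sigma> ^^ l) (f a)))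
      = (\<lambda>x v. (?B \<inter> P) +>\<^bsub>type_subring ?B\<^esub> mpol_deriv v (prolong \<sigma> f x))"
    by (auto simp: prolong_def fun_eq_iff)
  have "matrix_rank (A_ring ?K Quot p_ideal f P m) (UNIV \<times> {..m - 1}) ?J
      (\<lambda>(a, l) v. p_ideal f P m +>\<^bsub>A_ring ?K\<^esub> mpol_deriv v ((dpol_sigma \<sigma> ^^ l) (f a)))
    = card (UNIV :: 'r set) * m"
    using conjunct1[OF q[unfolded quasi_regular_def]] False by simp
  then have mr: "matrix_rank (type_subring ?B Quot (?B \<inter> P)) ?T ?J
      (\<lambda>x v. (?B \<inter> P) +>\<^bsub>type_subring ?B\<^esub> mpol_deriv v (prolong \<sigma> f x)) = card ?T"
    unfolding p_ideal_def A_set_eq A_ring_eq M mset by (simp add: card_cartesian_product)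
  interpret pb: prime_over_subring ?B P by unfold_locales (rule subring_set_polys, rule P)
  from full_matrix_rank[OF _ mr]
  have i: "indep ?B P ?J ?T (\<lambda>x v. mpol_deriv v (prolong \<sigma> f x))"
    by (intro rows_independent_indep[OF P subring_set_polys]) (use F in \<open>auto intro: mpol_deriv_polys\<close>)
  have "indep UNIV P ?J ?T (\<lambda>x v. mpol_deriv v (prolong \<sigma> f x))"
    by (rule pb.indep_coeffs_UNIV[OF _ _ _ i]) (use F in \<open>auto intro: mpol_deriv_polys\<close>)
  then show ?thesis by (rule indep_mono) (use False in auto)
qed

lemma max_ord_polys:
  fixes f :: "'r::finite \<Rightarrow> ('n::finite, 'k::zero) dpol"
  shows "f a \<in> polys (ord_le (max_ord f))"
proof -
  have "l \<le> max_ord f" if v: "(j, l) \<in> mpol_vars (f a)" for j l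
  proof -
    have "finite {l. (j, l) \<in> mpol_vars (f a)}"
      by (rule finite_subset[of _ "snd ` mpol_vars (f a)"]) (auto simp: finite_mpol_vars intro: rev_image_eqI)
    then have "l \<le> dpol_ord j (f a)" unfolding dpol_ord_def using v by (intro Max_ge) auto
    also have "{dpol_ord j (f i) | i j. True} = (\<lambda>(i, j). dpol_ord j (f i)) ` UNIV" by auto
    then have "dpol_ord j (f a) \<le> max_ord f" unfolding max_ord_def by (intro Max_ge) auto
    finally show ?thesis .
  qed
  then show ?thesis by (auto simp: polys_def ord_le_def)
qed

lemma endo_of_ring_hom:
  fixes \<sigma> :: "'k::comm_ring_1 \<Rightarrow> 'k"
  assumes "\<sigma> \<in> ring_hom ring_of_type_algebra ring_of_type_algebra"
  shows "ring_endo \<sigma>"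
  using ring_hom_add[OF assms] ring_hom_mult[OF assms] ring_hom_one[OF assms]
  by (simp add: ring_endo_def ring_of_type_algebra_def)

lemma prime_id_of_primeideal:
  fixes P :: "'a::comm_ring_1 set"
  assumes "primeideal P ring_of_type_algebra"
  shows "prime_id P"
proof -
  interpret primeideal P ring_of_type_algebra by fact
  have I: "ideal_in UNIV P"
    using is_ideal unfolding type_subring_UNIV[symmetric] by (rule ideal_in_of_ideal)
  moreover have "1 \<notin> P"
  proof
    assume "1 \<in> P"
    then have "x \<in> P" for x using ideal_inD(4)[OF I UNIV_I, of 1 x] by simp
    then show False using I_notcarr by (auto simp: ring_of_type_algebra_def)
  qed
  ultimately show ?thesis
    using I_prime by (auto simp: prime_id_def ring_of_type_algebra_def)
qed

lemma diff_prime_of_prime_id: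
  assumes P: "prime_id Q" and \<sigma>: "\<And>p. \<sigma> p \<in> Q \<longleftrightarrow> p \<in> Q"
  shows "diff_prime ring_of_type_algebra \<sigma> Q"
proof -
  have R: "ring_of_type_algebra = type_subring (UNIV :: 'a set)" by (rule type_subring_UNIV[symmetric])
  have I: "ideal Q ring_of_type_algebra"
    unfolding R by (rule ideal_type_subring[OF subring_set_UNIV]) (use P in \<open>simp add: prime_id_def\<close>)
  have "primeideal Q ring_of_type_algebra"
  proof (rule primeidealI[OF I])
    show "cring (ring_of_type_algebra :: 'a ring)" unfolding R by (rule cring_type_subring[OF subring_set_UNIV])
    show "carrier ring_of_type_algebra \<noteq> Q" using prime_id_one[OF P] by (auto simp: ring_of_type_algebra_def)
    show "a \<in> Q \<or> b \<in> Q" if "a \<otimes>\<^bsub>ring_of_type_algebra\<^esub> b \<in> Q" for a b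
      using that by (simp add: ring_of_type_algebra_def prime_id_mult_iff[OF P])
  qed
  then show ?thesis using I \<sigma> by (auto simp: diff_prime_def diff_ideal_def diff_reflexive_def)
qed

theorem theorem6p1:
  fixes \<sigma> :: "'k::field_char_0 \<Rightarrow> 'k"
    and f :: "'r::finite \<Rightarrow> ('n::finite, 'k) dpol"
    and P :: "('n, 'k) dpol set"
  assumes "\<sigma> \<in> ring_hom ring_of_type_algebra ring_of_type_algebra"
    and "minimal_diff_prime_over dpol_ring (dpol_sigma \<sigma>)
           (diff_ideal_gen dpol_ring (dpol_sigma \<sigma>) (range f)) P"
    and "max_ord f \<ge> 1"
    and "quasi_regular \<sigma> f P"
    and "rank_hypothesis \<sigma> f P"
  shows "hilbert_levin_regularity \<sigma> P \<le> max_ord f - 1"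
proof -
  let ?S = "dpol_sigma \<sigma>" and ?Q = "system_ideal \<sigma> f P"
  have \<sigma>: "ring_endo \<sigma>" by (rule endo_of_ring_hom[OF assms(1)])
  have dP: "diff_prime dpol_ring ?S P" and FP: "diff_ideal_gen dpol_ring ?S (range f) \<subseteq> P"
    and min: "\<And>Q. diff_prime dpol_ring ?S Q \<Longrightarrow> diff_ideal_gen dpol_ring ?S (range f) \<subseteq> Q \<Longrightarrow> Q \<subseteq> P \<Longrightarrow> Q = P"
    using assms(2) by (auto simp: minimal_diff_prime_over_def)
  have P: "prime_id P" using dP by (auto simp: diff_prime_def intro: prime_id_of_primeideal)
  have sigma_P: "?S p \<in> P \<longleftrightarrow> p \<in> P" for p
    using dP by (auto simp: diff_prime_def diff_ideal_def diff_reflexive_def ring_of_type_algebra_def)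
  have f_P: "f a \<in> P" for a
    using FP by (auto simp: diff_ideal_gen_def)
  note ind = quasi_regular_indep[OF \<sigma> P assms(4,3) max_ord_polys]
  \<comment> \<open>The system ideal is a competitor of \<open>P\<close> in the minimality
    assumption, once it is known to be a \<sigma>-prime ideal lying between the equations and
    \<open>P\<close>.\<close>
  have Q_prime: "prime_id ?Q"
    using ideal_system_ideal[where f = f, OF \<sigma> P sigma_P f_P] system_ideal_subset[where f = f, OF \<sigma> P sigma_P f_P] prime_id_one[OF P]
      system_ideal_prime[where f = f, OF \<sigma> P sigma_P f_P ind] by (auto simp: prime_id_def)
  \<comment> \<open>Stability under \<open>?S\<close> holds by construction; the converse direction
    is the reflexivity part of quasi-regularity.\<close>
  have Q_sigma: "?S p \<in> ?Q \<longleftrightarrow> p \<in> ?Q" for p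
    using system_ideal_sigma[where f = f, OF \<sigma> P sigma_P f_P] system_ideal_reflexive[where f = f, OF \<sigma> P sigma_P f_P] assms(4)
    unfolding quasi_regular_def by blast
  have "diff_prime dpol_ring ?S ?Q" by (rule diff_prime_of_prime_id[OF Q_prime Q_sigma])
  moreover have "diff_ideal_gen dpol_ring ?S (range f) \<subseteq> ?Q"
    using calculation f_system_ideal[where f = f, OF \<sigma> P sigma_P f_P]
    unfolding diff_ideal_gen_def diff_prime_def by blast
  ultimately have QP: "?Q = P" using min system_ideal_subset[where f = f, OF \<sigma> P sigma_P f_P] by blast
  interpret diff_setup \<sigma> f P "max_ord f"
  proof unfold_locales
    show "\<exists>s. s \<notin> P \<and> s * p \<in> gen_ideal UNIV (range (prolong \<sigma> f))" if "p \<in> P" for p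
    proof -
      have "p \<in> ?Q" unfolding QP by (rule that)
      then show ?thesis by (auto simp: system_ideal_def saturation_def)
    qed
  qed (rule \<sigma> P sigma_P max_ord_polys ind f_P)+
  show ?thesis by (rule regularity_bound[OF assms(3)])
qed

end
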